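(* Suppose that $3\le m\le 26$. Let $L_n$ be the number of leaves in a random $m$-ary search tree with $n$ keys. Then, as $n\to\infty$, $$\frac{L_n-\mu_{L,m}\,n}{\sqrt{n}}\stackrel{d}{\longrightarrow}\mathcal{N}\bigl(0,\sigma^2_{L,m}\bigr),$$ where $$\mu_{L,m}=\frac{1}{H_m-1}\sum_{k=2}^{m}\frac{1}{k(k+1)}=\frac{1}{H_m-1}\cdot\frac{m-1}{2(m+1)},$$ with $H_m$ the $m$th harmonic number, and $\sigma^2_{L,m}$ can be evaluated as $$\sigma^2_{L,m}=\sum_{i,j=2}^{m}\frac{\sigma_{ij}}{ij},$$ where $\Sigma=(\sigma_{ij})_{i,j=1}^{m}$ is the $m\times m$ matrix $$\Sigma=\sum_{j,k=2}^{m}\frac{u_j'Bu_k}{\lambda_1-\lambda_j-\lambda_k}\,v_jv_k',$$ with $B$, $\lambda_j$, $u_j$, $v_j$ defined from the gap urn for leaves described in the context.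
   Context: Here $\stackrel{d}{\longrightarrow}$ denotes convergence in distribution and $\mathcal{N}(\mu,\sigma^2)$ is the normal distribution with mean $\mu$ and variance $\sigma^2$. Vectors are column vectors and $'$ denotes transpose (without complex conjugation). Random $m$-ary search tree ($m\ge2$). It is constructed recursively from a sequence of $n$ keys which are i.i.d. uniform random numbers in $[0,1]$ (equivalently, a uniformly random permutation of $\{1,\dots,n\}$). Each node may contain up to $m-1$ keys. One starts with an empty root. The first $m-1$ keys are put in the root, in increasing order from left to right; they divide the set of real numbers into $m$ intervals $J_1,\dots,J_m$. When the root is full (contains $m-1$ keys) it gets $m$ children that are initially empty, and each further key is passed to one of the children: a key in $J_i$ is passed to the $i$-th child. The procedure repeats recursively in the subtrees until all keys are added. Nodes containing at least one key are internal; empty nodes are external. The tree is regarded as consisting only of its internal nodes. A leaf is an internal node that has no internal children (it may have external children). Gap urn for leaves. A node with $i\le m-2$ keys has $i+1$ gaps and a full node has none. Gaps are the balls of a generalised P\'olya urn with types $1,\dots,m$, all of activity $1$ (so $a=(1,\dots,1)'$). Type 1: the gap of an external node that is not a child of a leaf. Type $i$, $2\le i\le m-1$: each of the $i$ gaps of a leaf with $i-1$ keys. Type $m$: each of the $m$ gaps at the $m$ external children of a leaf with $m-1$ keys. At each step a gap is drawn uniformly at random and the new key is added there; if the drawn gap has type $i$, the vector of numbers of gaps of the different types changes by $\xi_i$, where, with $e_1,\dots,e_m$ the standard basis of $\mathbb{R}^m$, $$\xi_i=-i\,e_i+(i+1)\,e_{i+1}\quad(1\le i\le m-1),\qquad \xi_m=-m\,e_m+(m-1)\,e_1+2\,e_2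 .$$ Let $A$ be the $m\times m$ matrix whose $i$-th column is $\xi_i$. It is diagonalisable; let $\lambda_1,\dots,\lambda_m$ be its eigenvalues, where $\lambda_1=1$ is the largest, and let $\{u_i\}_{i=1}^m$ and $\{v_i\}_{i=1}^m$ be dual bases of left and right eigenvectors: $u_i'A=\lambda_iu_i'$, $Av_i=\lambda_iv_i$, $u_i'v_j=\delta_{ij}$, normalised so that $a'v_1=1$. Write $v_1=(v_{11},\dots,v_{1m})'$. Finally $$B=\sum_{i=1}^{m}v_{1i}\,\xi_i\xi_i'.$$ *)

theory Defs
  imports "HOL-Probability.Probability"
begin

text \<open>\<^bold>\<open>Search trees.\<close> \<open>External\<close> is an empty node; \<open>Node ks ts\<close> is a node with at least one key,
  its keys \<open>ks\<close> in increasing order. The children of a node of an \<open>m\<close>-ary tree are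
  \<open>ts 0, \<dots>, ts (m - 1)\<close>; the values of \<open>ts\<close> at other indices play no role. A node that is not
  full has only \<open>External\<close> children, which stands for having no children: both for the growth
  rule and for being a leaf only internal children matter.\<close>

datatype 'a mtree = External | Node "'a list" "nat \<Rightarrow> 'a mtree"

text \<open>A key \<open>x\<close> reaching a full node is passed to the child numbered (from \<open>0\<close>) by the number of
  keys of the node that are smaller than \<open>x\<close>.\<close>

primrec mst_insert :: "nat \<Rightarrow> 'a::linorder \<Rightarrow> 'a mtree \<Rightarrow> 'a mtree" where
  "mst_insert m x External = Node [x] (\<lambda>_. External)"
| "mst_insert m x (Node ks ts) =
     (if length ks < m - 1 then Node (insort x ks) ts
      else let i = length (filter (\<lambda>k. k < x) ks) in Node ks (ts(i := (mst_insert m x \<circ> ts) i)))"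

definition mst :: "nat \<Rightarrow> 'a::linorder list \<Rightarrow> 'a mtree" where
  "mst m xs = fold (mst_insert m) xs External"

primrec num_leaves :: "nat \<Rightarrow> 'a mtree \<Rightarrow> nat" where
  "num_leaves m External = 0"
| "num_leaves m (Node ks ts) =
     (if \<forall>j<m. ts j = External then 1 else (\<Sum>j<m. num_leaves m (ts j)))"

definition mst_leaves :: "nat \<Rightarrow> (nat \<Rightarrow> 'w \<Rightarrow> real) \<Rightarrow> nat \<Rightarrow> 'w \<Rightarrow> nat" where
  "mst_leaves m U n \<omega> = num_leaves m (mst m (map (\<lambda>i. U i \<omega>) [0..<n]))"

text \<open>\<^bold>\<open>The gap urn for leaves.\<close> Vectors and matrices of size \<open>m\<close> are functions of indices in
  \<open>{1..m}\<close>; nothing depends on their values elsewhere. They are complex throughout, since the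
  eigenvalues are.\<close>

definition unit_vector :: "nat \<Rightarrow> nat \<Rightarrow> complex" where
  "unit_vector i k = (if k = i then 1 else 0)"

definition gap_xi :: "nat \<Rightarrow> nat \<Rightarrow> nat \<Rightarrow> complex" where
  "gap_xi m i k =
     (if i < m then - of_nat i * unit_vector i k + of_nat (i + 1) * unit_vector (i + 1) k
      else - of_nat m * unit_vector m k + (of_nat m - 1) * unit_vector 1 k + 2 * unit_vector 2 k)"

text \<open>Column \<open>i\<close> is \<open>gap_xi m i\<close>.\<close>

definition gap_A :: "nat \<Rightarrow> nat \<Rightarrow> nat \<Rightarrow> complex" where
  "gap_A m k i = gap_xi m i k"

text \<open>The \<open>i\<close>-th left and right eigenvectors are \<open>u i\<close> and \<open>v i\<close>, with entries \<open>u i k\<close> and \<open>v i k\<close>.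
  The duality relation (without conjugation) makes both families bases of the space, so
  \<open>lam 1, \<dots>, lam m\<close> are the eigenvalues of \<open>A\<close> with multiplicity.\<close>

definition dual_eigenbases ::
  "nat \<Rightarrow> (nat \<Rightarrow> nat \<Rightarrow> complex) \<Rightarrow> (nat \<Rightarrow> complex) \<Rightarrow> (nat \<Rightarrow> nat \<Rightarrow> complex) \<Rightarrow> (nat \<Rightarrow> nat \<Rightarrow> complex) \<Rightarrow> bool"
where
  "dual_eigenbases m A lam u v \<longleftrightarrow>
     (\<forall>i\<in>{1..m}. \<forall>k\<in>{1..m}. (\<Sum>l=1..m. u i l * A l k) = lam i * u i k) \<and>
     (\<forall>i\<in>{1..m}. \<forall>k\<in>{1..m}. (\<Sum>l=1..m. A k l * v i l) = lam i * v i k) \<and>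
     (\<forall>i\<in>{1..m}. \<forall>j\<in>{1..m}. (\<Sum>k=1..m. u i k * v j k) = (if i = j then 1 else 0))"

definition gap_B :: "nat \<Rightarrow> (nat \<Rightarrow> nat \<Rightarrow> complex) \<Rightarrow> nat \<Rightarrow> nat \<Rightarrow> complex" where
  "gap_B m v r c = (\<Sum>i=1..m. v 1 i * gap_xi m i r * gap_xi m i c)"

definition gap_Sigma ::
  "nat \<Rightarrow> (nat \<Rightarrow> complex) \<Rightarrow> (nat \<Rightarrow> nat \<Rightarrow> complex) \<Rightarrow> (nat \<Rightarrow> nat \<Rightarrow> complex) \<Rightarrow> nat \<Rightarrow> nat \<Rightarrow> complex"
where
  "gap_Sigma m lam u v r c =
     (\<Sum>j=2..m. \<Sum>k=2..m.
        (\<Sum>p=1..m. \<Sum>q=1..m. u j p * gap_B m v p q * u k q) / (lam 1 - lam j - lam k) * v j r * v k c)"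

definition mu_L :: "nat \<Rightarrow> real" where
  "mu_L m = 1 / (harm m - 1) * (\<Sum>k=2..m. 1 / (real k * (real k + 1)))"

text \<open>The normal law with mean \<open>a\<close> and variance \<open>s \<ge> 0\<close>, a point mass if \<open>s = 0\<close>.
  (The library's \<open>normal_density\<close> takes the standard deviation.)\<close>

definition normal_law :: "real \<Rightarrow> real \<Rightarrow> real measure" where
  "normal_law a s =
     (if s = 0 then return borel a else density lborel (\<lambda>x. ennreal (normal_density a (sqrt s) x)))"

end

theory Submission
  imports Defs "HOL-Combinatorics.Multiset_Permutations" "Jordan_Normal_Form.Determinant"
begin

text \<open>\<^bold>\<open>Why the theorem holds.\<close> The last of \<open>n + 1\<close> keys in uniformly random relative order has a
uniform rank among the others, independently of the order of the others; so, given the tree of the first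
\<open>n\<close> keys, it falls into each of the \<open>n + 1\<close> gaps with the same probability. Hence the vector \<open>X n\<close> of the
numbers of gaps of the different types is the gap urn (\<open>gap_counts_step\<close>), and the number of leaves is the linear
functional \<open>w \<bullet> X n\<close> with \<open>w i = 1 / i\<close> for \<open>i \<ge> 2\<close> and \<open>w 1 = 0\<close>, because a leaf owns \<open>i\<close> gaps of one
type \<open>i\<close> (\<open>num_leaves_gap_types\<close>).

\<^bold>\<open>A martingale in the urn.\<close> If \<open>u\<close> is a left eigenvector for the eigenvalue \<open>\<lambda>\<close>, one draw from \<open>k\<close> balls
multiplies the conditional mean of \<open>u \<bullet> X\<close> by \<open>1 + \<lambda> / k\<close>. So, for fixed \<open>n\<close>, the numbers
\<open>\<Sum>j\<ge>2. (w \<bullet> v j) * (\<Prod>l=k+1..n. 1 + \<lambda> j / l) * (u j \<bullet> X k)\<close> form a martingale in \<open>k = 0, \<dots>, n\<close> that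
ends in \<open>w \<bullet> X n - (w \<bullet> v 1) * (n + 1)\<close>. Its increments are real, and their conditional law
is determined by the composition \<open>X k / (k + 1)\<close>, which converges to \<open>v 1\<close> (\<open>deviation_tendsto_zero\<close>).
When all \<open>Re (\<lambda> j)\<close> with \<open>j \<ge> 2\<close> are below \<open>1 / 2\<close>, the increments divided by \<open>sqrt n\<close> are negligible and
their variances add up to the limit in the theorem, since the mean over \<open>k = 1, \<dots>, n\<close> of
\<open>(\<Prod>l=k+1..n. 1 + \<alpha> / l) * (\<Prod>l=k+1..n. 1 + \<beta> / l)\<close> tends to \<open>1 / (1 - \<alpha> - \<beta>)\<close>
(\<open>growth_product_mean_tendsto\<close>).

\<^bold>\<open>The limit law.\<close> The increments are replaced one at a time by independent centred Gaussian ones with the variance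
computed from \<open>v 1\<close>. In the characteristic function each replacement costs little (\<open>hybrid_step\<close>), and the costs add
up to something that vanishes (\<open>hybrid_difference_tendsto\<close>). Levy's continuity theorem concludes.

\<^bold>\<open>Where \<open>m \<le> 26\<close> enters.\<close> Every eigenvalue is \<open>- m\<close> or a root of \<open>(z + 1) \<cdots> (z + m - 1) = m!\<close>.
For \<open>m \<le> 26\<close> the only root with real part at least \<open>1 / 2\<close> is \<open>1\<close> (\<open>half_plane_root\<close>): a root in the upper part of
that half-plane has too small an imaginary part for the arguments of its \<open>m - 1\<close> factors to add up to \<open>2 * pi\<close>.\<close>

section \<open>Linear recursions and the growth factors of eigenvectors\<close>

text \<open>All the limits along the urn come from this one recursion: the contraction factors multiply to at most a constant
times \<open>exp (- d * harm n)\<close>, which tends to \<open>0\<close>, while a perturbation \<open>e n / (n + 1)\<close> with \<open>e n < d * b\<close> cannot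
keep the sequence above the level \<open>b\<close>.\<close>

lemma recursion_tendsto_zero:
  fixes x e :: "nat \<Rightarrow> real"
  assumes d: "d > 0" and pos: "\<And>n. x n \<ge> 0" and e: "e \<longlonglongrightarrow> 0"
    and rec: "eventually (\<lambda>n. x (Suc n) \<le> (1 - d / real (Suc n)) * x n + e n / real (Suc n)) sequentially"
  shows "x \<longlonglongrightarrow> 0"
proof (rule order_tendstoI)
  fix a :: real assume "a < 0"
  then show "eventually (\<lambda>n. a < x n) sequentially" using pos by (auto intro: always_eventually less_le_trans)
next
  fix a :: real assume a: "0 < a"
  define b where "b = a / 2"
  have b: "b > 0" "b < a" using a by (auto simp: b_def)
  have "eventually (\<lambda>n. e n < d * b) sequentially"
    using e d b by (intro order_tendstoD) auto
  moreover have "eventually (\<lambda>n. d \<le> real (Suc n)) sequentially"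
  proof -
    obtain k where "d \<le> real k" using real_arch_simple by blast
    then show ?thesis by (auto simp: eventually_sequentially intro!: exI[of _ k])
  qed
  ultimately have "eventually (\<lambda>n. e n < d * b \<and> d \<le> real (Suc n) \<and>
     x (Suc n) \<le> (1 - d / real (Suc n)) * x n + e n / real (Suc n)) sequentially"
    using rec by eventually_elim auto
  then obtain N where N: "\<And>n. n \<ge> N \<Longrightarrow> e n < d * b \<and> d \<le> real (Suc n) \<and>
     x (Suc n) \<le> (1 - d / real (Suc n)) * x n + e n / real (Suc n)"
    by (auto simp: eventually_sequentially)
  have bound: "x n - b \<le> (x N) * exp (- d * (harm n - harm N))" if "n \<ge> N" for n
    using that
  \<comment> \<open>Measured from the level \<open>b\<close>, the recursion contracts: the perturbation is absorbed by \<open>d * b / (n + 1)\<close>.\<close>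
  proof (induction n rule: dec_induct)
    case base
    then show ?case using b by simp
  next
    case (step n)
    have r: "0 \<le> 1 - d / real (Suc n)" using N[of n] step by simp
    have "x (Suc n) - b \<le> (1 - d / real (Suc n)) * x n + (d * b) / real (Suc n) - b"
    proof -
      have "e n / real (Suc n) \<le> d * b / real (Suc n)"
        using N[of n] step by (intro divide_right_mono) auto
      then show ?thesis using N[of n] step by linarith
    qed
    also have "\<dots> = (1 - d / real (Suc n)) * (x n - b)"
      by (simp add: field_simps del: of_nat_Suc)
    also have "\<dots> \<le> (1 - d / real (Suc n)) * (x N * exp (- d * (harm n - harm N)))"
      using r step by (intro mult_left_mono) auto
    also have "\<dots> \<le> exp (- d / real (Suc n)) * (x N * exp (- d * (harm n - harm N)))"
      using exp_ge_add_one_self[of "- d / real (Suc n)"] pos[of N]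
      by (intro mult_right_mono) auto
    also have "\<dots> = x N * exp (- d * (harm (Suc n) - harm N))"
      by (simp add: harm_Suc exp_add[symmetric] field_simps)
    finally show ?case .
  qed
  have "((\<lambda>n. x N * exp (- d * (harm n - harm N))) \<longlongrightarrow> x N * 0) sequentially"
  proof (intro tendsto_intros filterlim_compose[OF exp_at_bot])
    have "filterlim (\<lambda>n. - (d * harm N) + d * harm n) at_top sequentially"
      by (intro filterlim_tendsto_add_at_top[OF tendsto_const] filterlim_tendsto_pos_mult_at_top[OF tendsto_const d] harm_at_top)
    then have "filterlim (\<lambda>n. - (- (d * harm N) + d * harm n)) at_bot sequentially"
      by (simp add: filterlim_uminus_at_bot)
    then show "filterlim (\<lambda>n. - d * (harm n - harm N)) at_bot sequentially"
      by (simp add: algebra_simps)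
  qed
  then have "eventually (\<lambda>n. x N * exp (- d * (harm n - harm N)) < a - b) sequentially"
    using b by (intro order_tendstoD(2)[where y = 0]) auto
  moreover have "eventually (\<lambda>n. n \<ge> N) sequentially" by (rule eventually_ge_at_top)
  ultimately show "eventually (\<lambda>n. x n < a) sequentially"
    by eventually_elim (use bound in fastforce)
qed

text \<open>The factor by which the conditional mean of \<open>u \<bullet> X\<close> changes between times \<open>k\<close> and \<open>n\<close>, when \<open>u\<close> is a left
eigenvector for the eigenvalue \<open>z\<close>.\<close>

definition growth :: "complex \<Rightarrow> nat \<Rightarrow> nat \<Rightarrow> complex" where
  "growth z k n = (\<Prod>l\<in>{k<..n}. 1 + z / of_nat l)"

lemma growth_self [simp]: "growth z n n = 1"
  by (simp add: growth_def)

lemma growth_Suc: "k \<le> n \<Longrightarrow> growth z k (Suc n) = (1 + z / of_nat (Suc n)) * growth z k n"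
proof -
  assume "k \<le> n"
  then have "{k<..Suc n} = insert (Suc n) {k<..n}" by auto
  then show ?thesis by (simp add: growth_def)
qed

lemma growth_step: "k < n \<Longrightarrow> growth z k n = (1 + z / of_nat (Suc k)) * growth z (Suc k) n"
proof -
  assume "k < n"
  then have "{k<..n} = insert (Suc k) {Suc k<..n}" by auto
  then show ?thesis by (simp add: growth_def)
qed

lemma norm_square_1_plus_divide:
  "(cmod (1 + z / of_nat (Suc n)))\<^sup>2 = 1 + 2 * Re z / real (Suc n) + (cmod z)\<^sup>2 / (real (Suc n))\<^sup>2"
proof -
  have "(cmod (1 + z / of_nat (Suc n)))\<^sup>2 = (1 + Re z / real (Suc n))\<^sup>2 + (Im z / real (Suc n))\<^sup>2"
    by (simp add: cmod_power2 Re_divide_of_nat Im_divide_of_nat del: of_nat_Suc)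
  also have "\<dots> = 1 + 2 * Re z / real (Suc n) + ((Re z)\<^sup>2 + (Im z)\<^sup>2) / (real (Suc n))\<^sup>2"
    by (simp add: power2_eq_square field_simps del: of_nat_Suc)
  finally show ?thesis by (simp add: cmod_power2)
qed

text \<open>This is the place where the threshold \<open>1 / 2\<close> matters: after division by \<open>n\<close> the squared growth factor
contracts by \<open>1 - (1 - 2 * Re z) / n\<close> up to terms of order \<open>1 / n\<^sup>2\<close>, and half of that rate survives them.\<close>

lemma damped_growth_factor:
  assumes "Re z < 1 / 2"
  obtains d where "d > 0" 
    "eventually (\<lambda>n. (cmod (1 + z / of_nat (Suc n)))\<^sup>2 * (real n / real (Suc n)) \<le> 1 - d / real (Suc n)) sequentially"
proof
  define d where "d = (1 - 2 * Re z) / 2"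
  show "d > 0" using assms by (simp add: d_def)
  obtain N where N: "(cmod z)\<^sup>2 + \<bar>2 * Re z\<bar> \<le> d * real N"
    using real_arch_simple[of "((cmod z)\<^sup>2 + \<bar>2 * Re z\<bar>) / d"] \<open>d > 0\<close> by (auto simp: field_simps)
  show "eventually (\<lambda>n. (cmod (1 + z / of_nat (Suc n)))\<^sup>2 * (real n / real (Suc n)) \<le> 1 - d / real (Suc n)) sequentially"
    unfolding eventually_sequentially
  proof (intro exI allI impI)
    fix n assume n: "N \<le> n"
    define s where "s = real (Suc n)"
    have s: "s > 0" "real n = s - 1" by (auto simp: s_def)
    have "d * real N \<le> d * s" using n \<open>d > 0\<close> by (auto simp: s_def)
    then have "(cmod z)\<^sup>2 + \<bar>2 * Re z\<bar> \<le> d * s" using N by linarith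
    then have *: "(cmod z)\<^sup>2 - 2 * Re z \<le> d * s" by linarith
    have "(1 + 2 * Re z / s + (cmod z)\<^sup>2 / s\<^sup>2) * ((s - 1) / s)
       = 1 - 2 * d / s + ((cmod z)\<^sup>2 - 2 * Re z) / s\<^sup>2 - (cmod z)\<^sup>2 / s ^ 3"
      using s by (simp add: d_def field_simps power2_eq_square power3_eq_cube)
    also have "\<dots> \<le> 1 - 2 * d / s + (d * s) / s\<^sup>2 - 0"
      using s * by (intro diff_mono add_mono divide_right_mono) auto
    also have "\<dots> = 1 - d / s" using s by (simp add: field_simps power2_eq_square)
    finally show "(cmod (1 + z / of_nat (Suc n)))\<^sup>2 * (real n / real (Suc n)) \<le> 1 - d / real (Suc n)"
      unfolding norm_square_1_plus_divide s_def[symmetric] s(2) .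
  qed
qed

lemma growth_weighted_squares_tendsto:
  assumes z: "Re z < 1 / 2" and e: "e \<longlonglongrightarrow> 0" "\<And>k. e k \<ge> 0"
  shows "(\<lambda>n. (\<Sum>k\<le>n. (cmod (growth z k n))\<^sup>2 * e k) / real n) \<longlonglongrightarrow> 0"
proof -
  obtain d where d: "d > 0" and 
    ev: "eventually (\<lambda>n. (cmod (1 + z / of_nat (Suc n)))\<^sup>2 * (real n / real (Suc n)) \<le> 1 - d / real (Suc n)) sequentially"
    using damped_growth_factor[OF z] .
  let ?S = "\<lambda>n. \<Sum>k\<le>n. (cmod (growth z k n))\<^sup>2 * e k"
  have S: "?S (Suc n) = (cmod (1 + z / of_nat (Suc n)))\<^sup>2 * ?S n + e (Suc n)" for n
    by (simp add: growth_Suc norm_mult power_mult_distrib sum_distrib_left mult.assoc)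
  show ?thesis
  proof (rule recursion_tendsto_zero[OF d, of _ "\<lambda>n. e (Suc n)"])
    show "0 \<le> ?S n / real n" for n using e by (intro divide_nonneg_nonneg sum_nonneg) auto
    show "(\<lambda>n. e (Suc n)) \<longlonglongrightarrow> 0" using e by (simp add: LIMSEQ_Suc)
    have "eventually (\<lambda>n::nat. n > 0) sequentially" by (rule eventually_gt_at_top)
    with ev show "eventually (\<lambda>n. ?S (Suc n) / real (Suc n) \<le> 
        (1 - d / real (Suc n)) * (?S n / real n) + e (Suc n) / real (Suc n)) sequentially"
    proof eventually_elim
      case (elim n)
      have "?S (Suc n) / real (Suc n) = ((cmod (1 + z / of_nat (Suc n)))\<^sup>2 * (real n / real (Suc n))) * (?S n / real n) + e (Suc n) / real (Suc n)"
        unfolding S using elim(2) by (simp add: field_simps del: of_nat_Suc)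
      also have "\<dots> \<le> (1 - d / real (Suc n)) * (?S n / real n) + e (Suc n) / real (Suc n)"
        using elim e by (intro add_mono mult_right_mono divide_nonneg_nonneg sum_nonneg) auto
      finally show ?case .
    qed
  qed
qed

text \<open>For the third and fourth powers the limit \<open>0\<close> says that no single step carries a positive fraction of the
fluctuation, a Lyapunov condition.\<close>

lemma growth_power_sum_tendsto:
  assumes z: "Re z < 1 / 2" and p: "p \<ge> (3::nat)"
  shows "(\<lambda>n. \<Sum>k\<le>n. (cmod (growth z k n) / sqrt (real n)) ^ p) \<longlonglongrightarrow> 0"
proof -
  obtain d where d: "d > 0" and 
    ev: "eventually (\<lambda>n. (cmod (1 + z / of_nat (Suc n)))\<^sup>2 * (real n / real (Suc n)) \<le> 1 - d / real (Suc n)) sequentially"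
    using damped_growth_factor[OF z] .
  let ?S = "\<lambda>n. \<Sum>k\<le>n. (cmod (growth z k n) / sqrt (real n)) ^ p"
  let ?b = "\<lambda>n. cmod (1 + z / of_nat (Suc n)) * sqrt (real n / real (Suc n))"
  have S: "?S (Suc n) = ?b n ^ p * ?S n + (1 / sqrt (real (Suc n))) ^ p" if "n > 0" for n
  proof -
    have "cmod (growth z k (Suc n)) / sqrt (real (Suc n)) = ?b n * (cmod (growth z k n) / sqrt (real n))" if "k \<le> n" for k
      using \<open>n > 0\<close> that by (simp add: growth_Suc norm_mult real_sqrt_divide)
    then show ?thesis
      by (simp add: sum_distrib_left power_mult_distrib[symmetric])
  qed
  show ?thesis
  proof (rule recursion_tendsto_zero[OF d, of _ "\<lambda>n. 1 / sqrt (real (Suc n))"])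
    show "0 \<le> ?S n" for n by (intro sum_nonneg) auto
    have "(\<lambda>n. sqrt (1 / real (Suc n))) \<longlonglongrightarrow> sqrt 0"
      by (intro tendsto_intros LIMSEQ_Suc lim_const_over_n)
    then show "(\<lambda>n. 1 / sqrt (real (Suc n))) \<longlonglongrightarrow> 0" by (simp add: real_sqrt_divide)
    have "eventually (\<lambda>n::nat. n > 0) sequentially" by (rule eventually_gt_at_top)
    with ev show "eventually (\<lambda>n. ?S (Suc n) \<le> 
        (1 - d / real (Suc n)) * ?S n + (1 / sqrt (real (Suc n))) / real (Suc n)) sequentially"
    proof eventually_elim
      case (elim n)
      have b2: "(?b n)\<^sup>2 \<le> 1 - d / real (Suc n)" using elim by (simp add: power_mult_distrib)
      also have "\<dots> \<le> 1" using d by simp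
      finally have b1: "?b n \<le> 1" by (simp add: power2_le_imp_le)
      have "?b n ^ p \<le> (?b n)\<^sup>2" using p b1 by (intro power_decreasing) auto
      with b2 have bp: "?b n ^ p \<le> 1 - d / real (Suc n)" by simp
      have "(1 / sqrt (real (Suc n))) ^ p \<le> (1 / sqrt (real (Suc n))) ^ 3"
        using p by (intro power_decreasing) auto
      also have "\<dots> = (1 / sqrt (real (Suc n))) / real (Suc n)"
      proof -
        have "sqrt (real (Suc n)) ^ 3 = sqrt (real (Suc n)) * real (Suc n)"
          by (simp add: power3_eq_cube)
        then show ?thesis by (simp add: power_one_over del: of_nat_Suc)
      qed
      finally have q: "(1 / sqrt (real (Suc n))) ^ p \<le> (1 / sqrt (real (Suc n))) / real (Suc n)" .
      show ?case unfolding S[OF elim(2)]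
        by (intro add_mono mult_right_mono bp q sum_nonneg) auto
    qed
  qed
qed

text \<open>The sum \<open>S n\<close> satisfies \<open>S (n + 1) = (1 + a / (n + 1)) * (1 + b / (n + 1)) * S n + 1\<close>; a solution of size \<open>r * n\<close>
needs \<open>r * (1 - a - b) = 1\<close>, and the distance of \<open>S n / n\<close> from this \<open>r\<close> obeys a contracting recursion.\<close>

lemma growth_product_mean_tendsto:
  assumes a: "Re a < 1 / 2" and b: "Re b < 1 / 2"
  shows "(\<lambda>n. (\<Sum>k=1..n. growth a k n * growth b k n) / of_nat n) \<longlonglongrightarrow> 1 / (1 - a - b)"
proof -
  define r where "r = 1 / (1 - a - b)"
  have "Re (1 - a - b) > 0" using a b by simp
  then have "1 - a - b \<noteq> 0" by (metis less_irrefl zero_complex.simps(1))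
  then have r: "r * (1 - a - b) = 1" by (simp add: r_def)
  let ?S = "\<lambda>n. \<Sum>k=1..n. growth a k n * growth b k n"
  define f where "f n = (1 + a / of_nat (Suc n)) * (1 + b / of_nat (Suc n))" for n
  have S: "?S (Suc n) = f n * ?S n + 1" for n
    by (simp add: growth_Suc sum_distrib_left f_def mult_ac)
  obtain d1 where d1: "d1 > 0" and 
    ev1: "eventually (\<lambda>n. (cmod (1 + a / of_nat (Suc n)))\<^sup>2 * (real n / real (Suc n)) \<le> 1 - d1 / real (Suc n)) sequentially"
    using damped_growth_factor[OF a] .
  obtain d2 where d2: "d2 > 0" and 
    ev2: "eventually (\<lambda>n. (cmod (1 + b / of_nat (Suc n)))\<^sup>2 * (real n / real (Suc n)) \<le> 1 - d2 / real (Suc n)) sequentially"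
    using damped_growth_factor[OF b] .
  define d where "d = min d1 d2"
  have d: "d > 0" using d1 d2 by (simp add: d_def)
  define x where "x n = cmod (?S n / of_nat n - r)" for n
  define C where "C = cmod (r * (a * b - a - b)) + cmod (r * a * b)"
  have "x \<longlonglongrightarrow> 0"
  proof (rule recursion_tendsto_zero[OF d, of _ "\<lambda>n. C / real (Suc n)"])
    show "0 \<le> x n" for n by (simp add: x_def)
    show "(\<lambda>n. C / real (Suc n)) \<longlonglongrightarrow> 0" by (intro LIMSEQ_Suc lim_const_over_n)
    have "eventually (\<lambda>n::nat. n > 0) sequentially" by (rule eventually_gt_at_top)
    with ev1 ev2 show "eventually (\<lambda>n. x (Suc n) \<le> (1 - d / real (Suc n)) * x n + C / real (Suc n) / real (Suc n)) sequentially"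
    proof eventually_elim
      case (elim n)
      define s where "s = (of_nat (Suc n) :: complex)"
      have s: "s \<noteq> 0" "of_nat n = s - 1" "cmod s = real (Suc n)" unfolding s_def
        by (simp_all del: of_nat_Suc add: of_nat_neq_0) simp_all
      have s1: "s - 1 \<noteq> 0" using elim(3) s(2) by (metis of_nat_eq_0_iff less_irrefl)
      define q where "q = ?S n / of_nat n - r"
      have Sq: "?S n = (s - 1) * (q + r)" using s1 by (simp add: q_def s)
      have "?S (Suc n) / of_nat (Suc n) - r = (f n * ((s - 1) * (q + r)) + 1) / s - r"
        unfolding S Sq by (simp only: s_def)
      also have "\<dots> = f n * ((s - 1) / s) * q + (r * (f n * (s - 1)) + 1 - r * s) / s"
        using s by (simp add: field_simps)
      also have "r * (f n * (s - 1)) + 1 - r * s = (r * (a * b - a - b)) / s - r * a * b / s\<^sup>2"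
      proof -
        have *: "f n * (s - 1) = s - (1 - a - b) + (a * b - a - b) / s - a * b / s\<^sup>2"
          using s(1) unfolding f_def s_def[symmetric] by (simp add: field_simps power2_eq_square)
        have "r * (f n * (s - 1)) + 1 - r * s = 1 - r * (1 - a - b) + (r * (a * b - a - b)) / s - r * a * b / s\<^sup>2"
          unfolding * by (simp add: algebra_simps)
        then show ?thesis using r by simp
      qed
      finally have "x (Suc n) = cmod (f n * ((s - 1) / s) * q + ((r * (a * b - a - b)) / s - r * a * b / s\<^sup>2) / s)"
        by (simp add: x_def)
      also have "\<dots> \<le> cmod (f n * ((s - 1) / s)) * cmod q + (cmod (r * (a * b - a - b)) / cmod s + cmod (r * a * b) / (cmod s)\<^sup>2) / cmod s"
        by (intro norm_triangle_le add_mono) 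
           (simp_all only: norm_mult norm_divide norm_power, auto intro!: divide_right_mono norm_triangle_le_diff simp: norm_mult norm_divide norm_power)
      also have "\<dots> \<le> (1 - d / real (Suc n)) * x n + C / real (Suc n) / real (Suc n)"
        unfolding s(3)[symmetric]
      proof (intro add_mono mult_mono divide_right_mono)
        define A where "A = cmod (1 + a / s)"
        define B where "B = cmod (1 + b / s)"
        define t where "t = real n / real (Suc n)"
        have "cmod (f n * ((s - 1) / s)) = A * B * t"
          using s by (simp add: f_def norm_mult norm_divide A_def B_def t_def s_def[symmetric]) (simp add: s(2)[symmetric])
        also have "\<dots> \<le> (A\<^sup>2 * t + B\<^sup>2 * t) / 2"
        proof -
          have "0 \<le> (A - B)\<^sup>2 * t" by (simp add: t_def)
          then show ?thesis by (simp add: power2_eq_square algebra_simps)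
        qed
        also have "\<dots> \<le> ((1 - d1 / real (Suc n)) + (1 - d2 / real (Suc n))) / 2"
          using elim unfolding A_def B_def t_def s_def by (intro divide_right_mono add_mono) auto
        also have "\<dots> \<le> ((1 - d / real (Suc n)) + (1 - d / real (Suc n))) / 2"
          by (intro divide_right_mono add_mono diff_left_mono) (auto simp: d_def)
        finally have *: "cmod (f n * ((s - 1) / s)) \<le> 1 - d / real (Suc n)" by simp
        then show "cmod (f n * ((s - 1) / s)) \<le> 1 - d / cmod s" by (simp only: s)
        show "0 \<le> 1 - d / cmod s" unfolding s(3) using * norm_ge_zero order_trans by blast
        show "cmod q \<le> x n" by (simp add: x_def q_def)
        have "cmod (r * a * b) / (cmod s)\<^sup>2 \<le> cmod (r * a * b) / cmod s"
          using s by (intro divide_left_mono) (auto simp: power2_eq_square)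
        then show "cmod (r * (a * b - a - b)) / cmod s + cmod (r * a * b) / (cmod s)\<^sup>2 \<le> C / cmod s"
          unfolding C_def add_divide_distrib by simp
      qed auto
      finally show ?case unfolding s(3) .
    qed
  qed
  then show ?thesis unfolding x_def r_def[symmetric]
    by (simp add: tendsto_norm_zero_iff LIM_zero_iff)
qed

section \<open>Exchanging one bounded increment for a Gaussian one\<close>

lemma abs_exp_minus_quadratic:
  fixes a :: real
  assumes "a \<ge> 0"
  shows "\<bar>exp (- a) - 1 + a\<bar> \<le> a\<^sup>2 / 2"
proof -
  have "exp (- a) = 1 / exp a" by (simp add: exp_minus field_simps)
  also have "\<dots> \<le> 1 / (1 + a + a\<^sup>2 / 2)"
    using exp_lower_Taylor_quadratic[OF assms] assms by (intro divide_left_mono) (auto intro!: mult_pos_pos add_pos_nonneg)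
  also have "\<dots> \<le> 1 - a + a\<^sup>2 / 2"
  proof -
    have "1 \<le> 1 + a ^ 4 / 4" by simp
    also have "\<dots> = (1 - a + a\<^sup>2 / 2) * (1 + a + a\<^sup>2 / 2)"
      by (simp add: algebra_simps power2_eq_square power4_eq_xxxx)
    finally have "1 \<le> (1 - a + a\<^sup>2 / 2) * (1 + a + a\<^sup>2 / 2)" .
    moreover have "1 + a + a\<^sup>2 / 2 > 0" using assms by (intro add_pos_nonneg) auto
    ultimately show ?thesis by (simp only: pos_divide_le_eq)
  qed
  finally have "exp (- a) - 1 + a \<le> a\<^sup>2 / 2" by simp
  moreover have "exp (- a) - 1 + a \<ge> 0" using exp_ge_add_one_self[of "- a"] by simp
  ultimately show ?thesis by simp
qed

text \<open>A crude form of the power mean inequality: the sum is at most \<open>card J\<close> times its largest term.\<close>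

lemma sum_power_le:
  fixes a :: "'i \<Rightarrow> real"
  assumes "finite J" "\<And>j. j \<in> J \<Longrightarrow> a j \<ge> 0" "p > 0"
  shows "(\<Sum>j\<in>J. a j) ^ p \<le> real (card J) ^ p * (\<Sum>j\<in>J. a j ^ p)"
proof (cases "J = {}")
  case False
  then obtain i where i: "i \<in> J" "\<And>j. j \<in> J \<Longrightarrow> a j \<le> a i"
    using obtains_MAX[OF assms(1), of a] assms(1) by (metis Max_ge finite_imageI imageI)
  have "(\<Sum>j\<in>J. a j) \<le> real (card J) * a i"
    using i by (intro sum_bounded_above) auto
  then have "(\<Sum>j\<in>J. a j) ^ p \<le> (real (card J) * a i) ^ p"
    using assms by (intro power_mono sum_nonneg) auto
  also have "a i ^ p \<le> (\<Sum>j\<in>J. a j ^ p)"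
    using assms i by (intro member_le_sum) auto
  then have "(real (card J) * a i) ^ p \<le> real (card J) ^ p * (\<Sum>j\<in>J. a j ^ p)"
    by (simp add: power_mult_distrib mult_left_mono)
  finally show ?thesis .
qed (use assms in \<open>simp add: zero_power\<close>)

text \<open>A variable takes the values \<open>D i\<close> with probabilities \<open>q i\<close>, and \<open>p\<close> is a second law under which it is centred.
The characteristic function of the variable, centred under \<open>q\<close>, is compared with the one of a Gaussian
variable that has the variance computed from \<open>p\<close>. Taylor expansion to second order leaves a third moment; the
two variances differ by at most a multiple of the distance of \<open>q\<close> and \<open>p\<close>.\<close>

lemma centred_exponential_mean_bound:
  fixes q p D :: "'i \<Rightarrow> real" and s B :: real
  assumes I: "finite I" and q: "\<And>i. i \<in> I \<Longrightarrow> q i \<ge> 0" "(\<Sum>i\<in>I. q i) = 1"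
    and p: "\<And>i. i \<in> I \<Longrightarrow> p i \<ge> 0" "(\<Sum>i\<in>I. p i) = 1"
    and pD: "(\<Sum>i\<in>I. p i * D i) = 0" and B: "\<And>i. i \<in> I \<Longrightarrow> \<bar>D i\<bar> \<le> B"
  shows "cmod ((\<Sum>i\<in>I. of_real (q i) * iexp (s * (D i - (\<Sum>l\<in>I. q l * D l)))) - of_real (exp (- (s\<^sup>2 / 2 * (\<Sum>i\<in>I. p i * (D i)\<^sup>2)))))
    \<le> (2 * \<bar>s\<bar> * B) ^ 3 / 6 + s\<^sup>2 * B\<^sup>2 * (\<Sum>i\<in>I. \<bar>q i - p i\<bar>) + (s\<^sup>2 * B\<^sup>2)\<^sup>2 / 8"
proof -
  define b where "b = (\<Sum>l\<in>I. q l * D l)"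
  define V where "V = (\<Sum>i\<in>I. p i * (D i)\<^sup>2)"
  define th where "th i = s * (D i - b)" for i
  define S where "S = (\<Sum>i\<in>I. \<bar>q i - p i\<bar>)"
  define a where "a = s\<^sup>2 / 2 * V"
  have ne: "I \<noteq> {}" using q(2) by auto
  then obtain i0 where "i0 \<in> I" by auto
  then have B0: "B \<ge> 0" using B[of i0] by linarith
  have D2: "(D i)\<^sup>2 \<le> B\<^sup>2" if "i \<in> I" for i
    using B[OF that] B0 by (simp add: abs_le_square_iff[symmetric])
  have V0: "V \<ge> 0" unfolding V_def by (intro sum_nonneg) (simp add: p)
  have "V \<le> (\<Sum>i\<in>I. p i * B\<^sup>2)"
    unfolding V_def by (intro sum_mono mult_left_mono D2 p)
  also have "\<dots> = B\<^sup>2" by (simp add: sum_distrib_right[symmetric] p)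
  finally have VB: "V \<le> B\<^sup>2" .
  have b1: "\<bar>b\<bar> \<le> B"
  proof -
    have "\<bar>b\<bar> \<le> (\<Sum>i\<in>I. q i * B)"
      unfolding b_def by (rule order_trans[OF sum_abs]) (auto intro!: sum_mono mult_left_mono B simp: abs_mult q)
    also have "\<dots> = B" by (simp add: sum_distrib_right[symmetric] q)
    finally show ?thesis .
  qed
  have b2: "\<bar>b\<bar> \<le> B * S"
  proof -
    have "b = (\<Sum>i\<in>I. (q i - p i) * D i)"
      using pD by (simp add: b_def left_diff_distrib sum_subtractf)
    also have "\<bar>\<dots>\<bar> \<le> (\<Sum>i\<in>I. \<bar>q i - p i\<bar> * B)"
      by (rule order_trans[OF sum_abs]) (auto intro!: sum_mono mult_left_mono B simp: abs_mult)
    also have "\<dots> = B * S" unfolding S_def sum_distrib_right[symmetric] by (rule mult.commute)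
    finally show ?thesis .
  qed
  have thB: "\<bar>th i\<bar> \<le> 2 * \<bar>s\<bar> * B" if "i \<in> I" for i
  proof -
    have "\<bar>D i - b\<bar> \<le> 2 * B" using B[OF that] b1 by linarith
    then show ?thesis unfolding th_def abs_mult using mult_left_mono[of "\<bar>D i - b\<bar>" "2 * B" "\<bar>s\<bar>"] by simp
  qed
  have sum_th: "(\<Sum>i\<in>I. q i * th i) = 0"
  proof -
    have "(\<Sum>i\<in>I. q i * th i) = s * ((\<Sum>i\<in>I. q i * D i) - b * (\<Sum>i\<in>I. q i))"
      unfolding th_def sum_distrib_left sum_subtractf[symmetric] by (intro sum.cong) (auto simp: algebra_simps)
    then show ?thesis by (simp add: q b_def)
  qed
  have sum_th2: "(\<Sum>i\<in>I. q i * (th i)\<^sup>2) = s\<^sup>2 * ((\<Sum>i\<in>I. q i * (D i)\<^sup>2) - b\<^sup>2)"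
  proof -
    have "(\<Sum>i\<in>I. q i * (th i)\<^sup>2) = s\<^sup>2 * ((\<Sum>i\<in>I. q i * (D i)\<^sup>2) - 2 * b * (\<Sum>i\<in>I. q i * D i) + b\<^sup>2 * (\<Sum>i\<in>I. q i))"
      unfolding th_def sum_distrib_left sum_subtractf[symmetric] sum.distrib[symmetric]
      by (intro sum.cong) (auto simp: algebra_simps power2_eq_square)
    also have "(\<Sum>i\<in>I. q i * D i) = b" by (simp add: b_def)
    finally show ?thesis by (simp add: q power2_eq_square algebra_simps)
  qed
  have var: "\<bar>(\<Sum>i\<in>I. q i * (D i)\<^sup>2) - b\<^sup>2 - V\<bar> \<le> 2 * (B\<^sup>2 * S)"
  proof -
    have "(\<Sum>i\<in>I. q i * (D i)\<^sup>2) - V = (\<Sum>i\<in>I. (q i - p i) * (D i)\<^sup>2)"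
      by (simp add: V_def left_diff_distrib sum_subtractf)
    also have "\<bar>\<dots>\<bar> \<le> (\<Sum>i\<in>I. \<bar>q i - p i\<bar> * B\<^sup>2)"
      by (rule order_trans[OF sum_abs]) (auto intro!: sum_mono mult_left_mono D2 simp: abs_mult)
    also have "\<dots> = B\<^sup>2 * S" unfolding S_def sum_distrib_right[symmetric] by (rule mult.commute)
    finally have 1: "\<bar>(\<Sum>i\<in>I. q i * (D i)\<^sup>2) - V\<bar> \<le> B\<^sup>2 * S" .
    have "b\<^sup>2 \<le> B * (B * S)"
      using mult_mono[OF b1 b2] B0 by (simp add: power2_eq_square)
    then have "b\<^sup>2 \<le> B\<^sup>2 * S" by (simp add: power2_eq_square)
    then show ?thesis using 1 zero_le_power2[of b] by linarith
  qed
  let ?R = "\<lambda>x. iexp x - (1 + \<i> * of_real x - of_real (x\<^sup>2 / 2))"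
  have R: "cmod (?R x) \<le> \<bar>x\<bar> ^ 3 / 6" for x
  proof -
    have "(\<Sum>k\<le>2. (\<i> * complex_of_real x) ^ k / fact k) = 1 + \<i> * of_real x - of_real (x\<^sup>2 / 2)"
      by (simp add: numeral_2_eq_2 power_mult_distrib)
    then show ?thesis using iexp_approx1[of x 2] by (simp add: fact_numeral)
  qed
  have decomp: "(\<Sum>i\<in>I. of_real (q i) * iexp (th i)) - of_real (exp (- a)) =
    (\<Sum>i\<in>I. of_real (q i) * ?R (th i)) + of_real (a - (\<Sum>i\<in>I. q i * (th i)\<^sup>2) / 2 - (exp (- a) - 1 + a))"
  proof -
    have "(\<Sum>i\<in>I. of_real (q i) * (1 + \<i> * of_real (th i) - of_real ((th i)\<^sup>2 / 2)))
      = of_real (\<Sum>i\<in>I. q i) + \<i> * of_real (\<Sum>i\<in>I. q i * th i) - of_real ((\<Sum>i\<in>I. q i * (th i)\<^sup>2) / 2)"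
      by (simp add: sum.distrib sum_subtractf sum_distrib_left sum_divide_distrib algebra_simps)
    then have "(\<Sum>i\<in>I. of_real (q i) * (1 + \<i> * of_real (th i) - of_real ((th i)\<^sup>2 / 2)))
      = 1 - of_real ((\<Sum>i\<in>I. q i * (th i)\<^sup>2) / 2)"
      unfolding sum_th q(2) by simp
    moreover have "(\<Sum>i\<in>I. of_real (q i) * ?R (th i)) = (\<Sum>i\<in>I. of_real (q i) * iexp (th i))
      - (\<Sum>i\<in>I. of_real (q i) * (1 + \<i> * of_real (th i) - of_real ((th i)\<^sup>2 / 2)))"
      unfolding sum_subtractf[symmetric] by (simp add: right_diff_distrib)
    ultimately show ?thesis by simp
  qed
  have "cmod (\<Sum>i\<in>I. of_real (q i) * ?R (th i)) \<le> (\<Sum>i\<in>I. q i * ((2 * \<bar>s\<bar> * B) ^ 3 / 6))"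
  proof (rule order_trans[OF norm_sum], rule sum_mono)
    fix i assume i: "i \<in> I"
    have "cmod (?R (th i)) \<le> (2 * \<bar>s\<bar> * B) ^ 3 / 6"
      using R[of "th i"] power_mono[OF thB[OF i], of 3] by simp
    then show "cmod (of_real (q i) * ?R (th i)) \<le> q i * ((2 * \<bar>s\<bar> * B) ^ 3 / 6)"
      using q(1)[OF i] unfolding norm_mult by (simp only: norm_of_real abs_of_nonneg mult_left_mono)
  qed
  also have "\<dots> = (2 * \<bar>s\<bar> * B) ^ 3 / 6" by (simp only: sum_distrib_right[symmetric] q mult_1)
  finally have 1: "cmod (\<Sum>i\<in>I. of_real (q i) * ?R (th i)) \<le> (2 * \<bar>s\<bar> * B) ^ 3 / 6" .
  have 2: "\<bar>a - (\<Sum>i\<in>I. q i * (th i)\<^sup>2) / 2\<bar> \<le> s\<^sup>2 * B\<^sup>2 * S"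
  proof -
    have "a - (\<Sum>i\<in>I. q i * (th i)\<^sup>2) / 2 = - (s\<^sup>2 / 2 * ((\<Sum>i\<in>I. q i * (D i)\<^sup>2) - b\<^sup>2 - V))"
      unfolding sum_th2 a_def by (simp add: field_simps)
    then have "\<bar>a - (\<Sum>i\<in>I. q i * (th i)\<^sup>2) / 2\<bar> = s\<^sup>2 / 2 * \<bar>(\<Sum>i\<in>I. q i * (D i)\<^sup>2) - b\<^sup>2 - V\<bar>"
      by (simp add: abs_mult)
    also have "\<dots> \<le> s\<^sup>2 / 2 * (2 * (B\<^sup>2 * S))" by (intro mult_left_mono var) auto
    finally show ?thesis by simp
  qed
  have a0: "a \<ge> 0" using V0 by (simp add: a_def)
  have 3: "\<bar>exp (- a) - 1 + a\<bar> \<le> (s\<^sup>2 * B\<^sup>2)\<^sup>2 / 8"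
  proof -
    have "a \<le> s\<^sup>2 * B\<^sup>2 / 2" using VB by (simp add: a_def mult_left_mono)
    then have "a\<^sup>2 / 2 \<le> (s\<^sup>2 * B\<^sup>2 / 2)\<^sup>2 / 2" using a0 by (intro divide_right_mono power_mono) auto
    then show ?thesis using abs_exp_minus_quadratic[OF a0] by (simp add: power_divide)
  qed
  have "cmod ((\<Sum>i\<in>I. of_real (q i) * iexp (th i)) - of_real (exp (- a))) \<le>
     (2 * \<bar>s\<bar> * B) ^ 3 / 6 + (s\<^sup>2 * B\<^sup>2 * S + (s\<^sup>2 * B\<^sup>2)\<^sup>2 / 8)"
    unfolding decomp
    by (rule norm_triangle_le, rule add_mono[OF 1], unfold norm_of_real) (use 2 3 in linarith)
  then show ?thesis unfolding th_def b_def a_def V_def S_def by simp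
qed

section \<open>Urns that gain one ball in each step\<close>

text \<open>The law of the urn at time \<open>n\<close> is the law of \<open>X n s\<close> for \<open>s\<close> uniformly distributed on the finite set
\<open>states n\<close>. Consecutive sets of states need not be related; only the laws are: the last assumption says
that the mean of every function at time \<open>n + 1\<close> arises by drawing a ball uniformly from the \<open>n + 1\<close> balls at
time \<open>n\<close> and adding \<open>xi i\<close> if its type is \<open>i\<close>.\<close>

locale unit_urn =
  fixes m :: nat and xi :: "nat \<Rightarrow> nat \<Rightarrow> real" and states :: "nat \<Rightarrow> 's set" and X :: "nat \<Rightarrow> 's \<Rightarrow> nat \<Rightarrow> real"
  assumes finite_states: "finite (states n)" and states_nonempty: "states n \<noteq> {}"
    and X_nonneg: "s \<in> states n \<Longrightarrow> X n s i \<ge> 0"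
    and X_total: "s \<in> states n \<Longrightarrow> (\<Sum>i=1..m. X n s i) = real (Suc n)"
    and X_step: "\<And>f :: (nat \<Rightarrow> real) \<Rightarrow> complex.
       (\<Sum>s\<in>states (Suc n). f (X (Suc n) s)) / of_nat (card (states (Suc n))) =
       (\<Sum>s\<in>states n. \<Sum>i=1..m. of_real (X n s i / real (Suc n)) * f (\<lambda>k. X n s k + xi i k)) / of_nat (card (states n))"
begin

definition mean :: "nat \<Rightarrow> ('s \<Rightarrow> 'b::real_normed_field) \<Rightarrow> 'b" where
  "mean n f = (\<Sum>s\<in>states n. f s) / of_nat (card (states n))"

lemma card_states_pos: "card (states n) > 0"
  using finite_states states_nonempty by (simp add: card_gt_0_iff)

lemma mean_const [simp]: "mean n (\<lambda>_. c) = c"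
  using card_states_pos[of n] by (simp add: mean_def)

lemma mean_add: "mean n (\<lambda>s. f s + g s) = mean n f + mean n g"
  by (simp add: mean_def sum.distrib add_divide_distrib)

lemma mean_diff: "mean n (\<lambda>s. f s - g s) = mean n f - mean n g"
  by (simp add: mean_def sum_subtractf diff_divide_distrib)

lemma mean_cmult: "mean n (\<lambda>s. c * f s) = c * mean n f"
  by (simp add: mean_def sum_distrib_left)

lemma mean_sum: "mean n (\<lambda>s. \<Sum>i\<in>A. f i s) = (\<Sum>i\<in>A. mean n (f i))"
  unfolding mean_def by (subst sum.swap) (simp add: sum_divide_distrib)

lemma mean_cong: "(\<And>s. s \<in> states n \<Longrightarrow> f s = g s) \<Longrightarrow> mean n f = mean n g"
  by (simp add: mean_def)

lemma mean_mono: "(\<And>s. s \<in> states n \<Longrightarrow> f s \<le> g s) \<Longrightarrow> mean n f \<le> (mean n g :: real)"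
  unfolding mean_def by (intro divide_right_mono sum_mono) auto

lemma mean_nonneg: "(\<And>s. s \<in> states n \<Longrightarrow> f s \<ge> 0) \<Longrightarrow> (mean n f :: real) \<ge> 0"
  unfolding mean_def by (intro divide_nonneg_nonneg sum_nonneg) auto

lemma norm_mean_le: "norm (mean n f) \<le> mean n (\<lambda>s. norm (f s))"
  unfolding mean_def by (simp add: norm_divide norm_sum divide_right_mono)

lemma mean_le_sqrt_mean_square:
  assumes "\<And>s. s \<in> states n \<Longrightarrow> f s \<ge> (0::real)"
  shows "mean n f \<le> sqrt (mean n (\<lambda>s. (f s)\<^sup>2))"
proof (rule real_le_rsqrt)
  have "(mean n f)\<^sup>2 = (\<Sum>s\<in>states n. f s)\<^sup>2 / (real (card (states n)))\<^sup>2"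
    by (simp add: mean_def power_divide)
  also have "\<dots> \<le> ((\<Sum>s\<in>states n. (f s)\<^sup>2) * real (card (states n))) / (real (card (states n)))\<^sup>2"
    using assms by (intro divide_right_mono sum_squared_le_sum_of_squares) auto
  also have "\<dots> = mean n (\<lambda>s. (f s)\<^sup>2)"
    using card_states_pos[of n] by (simp add: mean_def power2_eq_square)
  finally show "(mean n f)\<^sup>2 \<le> mean n (\<lambda>s. (f s)\<^sup>2)" .
qed

lemma mean_Suc:
  fixes f :: "(nat \<Rightarrow> real) \<Rightarrow> complex"
  shows "mean (Suc n) (\<lambda>s. f (X (Suc n) s)) =
    mean n (\<lambda>s. \<Sum>i=1..m. of_real (X n s i / real (Suc n)) * f (\<lambda>k. X n s k + xi i k))"
  unfolding mean_def by (rule X_step)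

lemma of_real_mean: "of_real (mean n f) = (mean n (\<lambda>s. of_real (f s)) :: complex)"
  by (simp add: mean_def)

lemma mean_Suc_real:
  fixes f :: "(nat \<Rightarrow> real) \<Rightarrow> real"
  shows "mean (Suc n) (\<lambda>s. f (X (Suc n) s)) =
    mean n (\<lambda>s. \<Sum>i=1..m. X n s i / real (Suc n) * f (\<lambda>k. X n s k + xi i k))"
proof -
  have "complex_of_real (mean (Suc n) (\<lambda>s. f (X (Suc n) s))) = 
    complex_of_real (mean n (\<lambda>s. \<Sum>i=1..m. X n s i / real (Suc n) * f (\<lambda>k. X n s k + xi i k)))"
    unfolding of_real_mean by (subst mean_Suc) simp
  then show ?thesis by (simp only: of_real_eq_iff)
qed

end

text \<open>The eigenvectors for the leading eigenvalue are \<open>u 1 = (1, \<dots>, 1)\<close>, which counts the balls, and the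
limiting composition \<open>p\<close> of the urn.\<close>

locale unit_urn_spectrum = unit_urn m xi states X
  for m :: nat and xi :: "nat \<Rightarrow> nat \<Rightarrow> real" and states :: "nat \<Rightarrow> 's set" and X :: "nat \<Rightarrow> 's \<Rightarrow> nat \<Rightarrow> real" +
  fixes lam :: "nat \<Rightarrow> complex" and u v :: "nat \<Rightarrow> nat \<Rightarrow> complex" and p :: "nat \<Rightarrow> real"
  assumes left_eigen: "\<And>j i. j \<in> {1..m} \<Longrightarrow> i \<in> {1..m} \<Longrightarrow> (\<Sum>l=1..m. u j l * of_real (xi i l)) = lam j * u j i"
    and dual: "\<And>i j. i \<in> {1..m} \<Longrightarrow> j \<in> {1..m} \<Longrightarrow> (\<Sum>k=1..m. u i k * v j k) = (if i = j then 1 else 0)"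
    and complete: "\<And>r c. r \<in> {1..m} \<Longrightarrow> c \<in> {1..m} \<Longrightarrow> (\<Sum>j=1..m. v j r * u j c) = (if r = c then 1 else 0)"
    and u_one: "\<And>k. k \<in> {1..m} \<Longrightarrow> u 1 k = 1"
    and v_one: "\<And>k. k \<in> {1..m} \<Longrightarrow> v 1 k = of_real (p k)"
    and p_nonneg: "\<And>k. k \<in> {1..m} \<Longrightarrow> p k \<ge> 0"
    and small: "\<And>j. j \<in> {2..m} \<Longrightarrow> Re (lam j) < 1 / 2"
    and m_pos: "m \<ge> 1"
begin

lemma sum_p: "(\<Sum>i=1..m. p i) = 1"
proof -
  have "(\<Sum>k=1..m. u 1 k * v 1 k) = 1" using dual[of 1 1] m_pos by simp
  also have "(\<Sum>k=1..m. u 1 k * v 1 k) = of_real (\<Sum>i=1..m. p i)"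
    by (simp add: u_one v_one del: One_nat_def)
  finally show ?thesis using of_real_eq_1_iff by blast
qed

lemma left_orthogonal: 
  assumes "j \<in> {2..m}"
  shows "(\<Sum>i=1..m. of_real (p i) * u j i) = 0"
proof -
  have "(\<Sum>k=1..m. u j k * v 1 k) = 0" using dual[of j 1] assms m_pos by simp
  then show ?thesis by (simp add: v_one mult.commute del: One_nat_def)
qed

definition dot :: "(nat \<Rightarrow> complex) \<Rightarrow> (nat \<Rightarrow> real) \<Rightarrow> complex" where
  "dot h x = (\<Sum>i=1..m. h i * of_real (x i))"

text \<open>Expanding \<open>|u \<bullet> (X + xi i)|\<^sup>2\<close>, the mixed term has mean \<open>2 * Re \<lambda> * |u \<bullet> X|\<^sup>2 / (n + 1)\<close> by the eigenvector
equation, and the last term is bounded.\<close>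

lemma second_moment_step:
  assumes j: "j \<in> {2..m}"
  obtains C where "C \<ge> 0" "\<And>n. mean (Suc n) (\<lambda>s. (cmod (dot (u j) (X (Suc n) s)))\<^sup>2) \<le>
     (1 + 1 / real (Suc n)) * mean n (\<lambda>s. (cmod (dot (u j) (X n s)))\<^sup>2) + C"
proof
  define b where "b i = lam j * u j i" for i
  define C where "C = (\<Sum>i=1..m. (cmod (b i))\<^sup>2)"
  show "C \<ge> 0" unfolding C_def by (intro sum_nonneg) auto
  fix n
  have "mean (Suc n) (\<lambda>s. (cmod (dot (u j) (X (Suc n) s)))\<^sup>2) = 
    mean n (\<lambda>s. \<Sum>i=1..m. X n s i / real (Suc n) * (cmod (dot (u j) (\<lambda>k. X n s k + xi i k)))\<^sup>2)"
    by (rule mean_Suc_real[where f = "\<lambda>x. (cmod (dot (u j) x))\<^sup>2"])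
  also have "\<dots> \<le> mean n (\<lambda>s. (1 + 1 / real (Suc n)) * (cmod (dot (u j) (X n s)))\<^sup>2 + C)"
  proof (rule mean_mono)
    fix s assume s: "s \<in> states n"
    define a where "a = dot (u j) (X n s)"
    define q where "q i = X n s i / real (Suc n)" for i
    have q: "q i \<ge> 0" "q i \<le> 1" if "i \<in> {1..m}" for i
    proof -
      show "q i \<ge> 0" using X_nonneg[OF s] by (simp add: q_def)
      have "X n s i \<le> (\<Sum>i=1..m. X n s i)" using X_nonneg[OF s] that by (intro member_le_sum) auto
      then show "q i \<le> 1" using X_total[OF s] by (simp add: q_def)
    qed
    have sq: "(\<Sum>i=1..m. q i) = 1"
      unfolding q_def sum_divide_distrib[symmetric] X_total[OF s] by simp
    have ab: "dot (u j) (\<lambda>k. X n s k + xi i k) = a + b i" if "i \<in> {1..m}" for i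
      using left_eigen[of j i] that j by (simp add: dot_def a_def b_def sum.distrib algebra_simps)
    have "(\<Sum>i=1..m. of_real (q i) * b i) = lam j * a / of_nat (Suc n)"
      by (simp add: q_def b_def a_def dot_def sum_distrib_left sum_divide_distrib mult_ac del: of_nat_Suc)
    then have mb: "(\<Sum>i=1..m. q i * Re (b i)) = Re (lam j * a) / real (Suc n)" 
          "(\<Sum>i=1..m. q i * Im (b i)) = Im (lam j * a) / real (Suc n)"
      by (auto simp: complex_eq_iff Re_divide_of_nat Im_divide_of_nat simp del: of_nat_Suc)
    have "(\<Sum>i=1..m. X n s i / real (Suc n) * (cmod (dot (u j) (\<lambda>k. X n s k + xi i k)))\<^sup>2)
      = (\<Sum>i=1..m. q i * (cmod (a + b i))\<^sup>2)"
      unfolding q_def by (intro sum.cong) (auto simp: ab)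
    also have "\<dots> = (\<Sum>i=1..m. (cmod a)\<^sup>2 * q i + 2 * Re a * (q i * Re (b i)) + 2 * Im a * (q i * Im (b i)) + q i * (cmod (b i))\<^sup>2)"
      unfolding cmod_power2 by (intro sum.cong) (auto simp: power2_eq_square algebra_simps)
    also have "\<dots> = (cmod a)\<^sup>2 * (\<Sum>i=1..m. q i) + 2 * Re a * (\<Sum>i=1..m. q i * Re (b i)) + 2 * Im a * (\<Sum>i=1..m. q i * Im (b i)) + (\<Sum>i=1..m. q i * (cmod (b i))\<^sup>2)"
      by (simp only: sum.distrib sum_distrib_left)
    also have "\<dots> = (cmod a)\<^sup>2 + 2 * Re (lam j) * (cmod a)\<^sup>2 / real (Suc n) + (\<Sum>i=1..m. q i * (cmod (b i))\<^sup>2)"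
      unfolding mb sq cmod_power2[of a] by (simp add: power2_eq_square algebra_simps add_divide_distrib diff_divide_distrib del: of_nat_Suc)
    also have "\<dots> \<le> (cmod a)\<^sup>2 + 1 * (cmod a)\<^sup>2 / real (Suc n) + C"
      unfolding C_def using small[OF j] q by (intro add_mono divide_right_mono mult_right_mono sum_mono mult_left_le_one_le) auto
    finally show "(\<Sum>i=1..m. X n s i / real (Suc n) * (cmod (dot (u j) (\<lambda>k. X n s k + xi i k)))\<^sup>2) 
      \<le> (1 + 1 / real (Suc n)) * (cmod (dot (u j) (X n s)))\<^sup>2 + C"
      by (simp add: a_def algebra_simps)
  qed
  finally show "mean (Suc n) (\<lambda>s. (cmod (dot (u j) (X (Suc n) s)))\<^sup>2) \<le>
     (1 + 1 / real (Suc n)) * mean n (\<lambda>s. (cmod (dot (u j) (X n s)))\<^sup>2) + C"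
    by (simp add: mean_add mean_cmult)
qed

text \<open>The step estimate gives second moments of order at most \<open>n * ln n\<close>, much less than the \<open>n\<^sup>2\<close> that a law of large
numbers requires.\<close>

lemma second_moment_negligible:
  assumes j: "j \<in> {2..m}"
  shows "(\<lambda>n. mean n (\<lambda>s. (cmod (dot (u j) (X n s)))\<^sup>2) / (real n)\<^sup>2) \<longlonglongrightarrow> 0"
proof -
  obtain C where C: "C \<ge> 0" "\<And>n. mean (Suc n) (\<lambda>s. (cmod (dot (u j) (X (Suc n) s)))\<^sup>2) \<le>
     (1 + 1 / real (Suc n)) * mean n (\<lambda>s. (cmod (dot (u j) (X n s)))\<^sup>2) + C"
    using second_moment_step[OF j] by blast
  define Q where "Q n = mean n (\<lambda>s. (cmod (dot (u j) (X n s)))\<^sup>2)" for n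
  have Q0: "Q n \<ge> 0" for n unfolding Q_def by (intro mean_nonneg) auto
  show ?thesis unfolding Q_def[symmetric]
  proof (rule recursion_tendsto_zero[of 1 _ "\<lambda>n. C / real (Suc n)"])
    show "(\<lambda>n. C / real (Suc n)) \<longlonglongrightarrow> 0" by (intro LIMSEQ_Suc lim_const_over_n)
    show "eventually (\<lambda>n. Q (Suc n) / (real (Suc n))\<^sup>2 \<le> (1 - 1 / real (Suc n)) * (Q n / (real n)\<^sup>2) + C / real (Suc n) / real (Suc n)) sequentially"
      using eventually_gt_at_top[of "0::nat"]
    proof eventually_elim
      case (elim n)
      define r where "r = real n"
      have r: "r > 0" "real (Suc n) = r + 1" using elim by (auto simp: r_def)
      have "Q (Suc n) / (r + 1)\<^sup>2 \<le> ((1 + 1 / (r + 1)) * Q n + C) / (r + 1)\<^sup>2"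
        using C(2)[of n] unfolding Q_def r(2) by (intro divide_right_mono) auto
      also have "\<dots> = (1 + 1 / (r + 1)) * r\<^sup>2 / (r + 1)\<^sup>2 * (Q n / r\<^sup>2) + C / (r + 1) / (r + 1)"
        using r(1) by (simp add: add_divide_distrib power2_eq_square)
      also have "(1 + 1 / (r + 1)) * r\<^sup>2 / (r + 1)\<^sup>2 \<le> 1 - 1 / (r + 1)"
      proof -
        have "(1 + 1 / (r + 1)) * r\<^sup>2 / (r + 1)\<^sup>2 = (r / (r + 1)) * ((r + 2) * r / (r + 1)\<^sup>2)"
          using r(1) by (simp add: add_divide_eq_iff power2_eq_square mult_ac)
        also have "(r + 2) * r / (r + 1)\<^sup>2 \<le> 1"
          
        proof -
          have "(r + 2) * r \<le> (r + 1)\<^sup>2" by (simp add: power2_eq_square algebra_simps)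
          moreover have "0 < (r + 1)\<^sup>2" using r(1) by (intro zero_less_power) simp
          ultimately show ?thesis by simp
        qed
        then have "(r / (r + 1)) * ((r + 2) * r / (r + 1)\<^sup>2) \<le> r / (r + 1)"
          using r(1) by (intro mult_right_le_one_le) auto
        also have "r / (r + 1) = 1 - 1 / (r + 1)" using r(1) by (simp add: field_simps)
        finally show ?thesis .
      qed
      then have "(1 + 1 / (r + 1)) * r\<^sup>2 / (r + 1)\<^sup>2 * (Q n / r\<^sup>2) \<le> (1 - 1 / (r + 1)) * (Q n / r\<^sup>2)"
        using Q0[of n] by (intro mult_right_mono) auto
      finally show ?case unfolding r(2) r_def[symmetric] by simp
    qed
  qed (use Q0 in auto)
qed

definition deviation :: "nat \<Rightarrow> real" where
  "deviation n = mean n (\<lambda>s. \<Sum>i=1..m. \<bar>X n s i / real (Suc n) - p i\<bar>)"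

lemma deviation_nonneg: "deviation n \<ge> 0"
  unfolding deviation_def by (intro mean_nonneg sum_nonneg) auto

lemma split_first: "(\<Sum>j=1..m. f j) = f 1 + (\<Sum>j=2..m. f j)" for f :: "nat \<Rightarrow> 'c::comm_monoid_add"
  using m_pos by (simp add: sum.atLeast_Suc_atMost numeral_2_eq_2)

lemma X_expansion:
  assumes s: "s \<in> states n" and i: "i \<in> {1..m}"
  shows "of_real (X n s i) = of_real (real (Suc n) * p i) + (\<Sum>j=2..m. v j i * dot (u j) (X n s))"
proof -
  have "of_real (X n s i) = (\<Sum>c=1..m. (if i = c then 1 else 0) * complex_of_real (X n s c))"
  proof -
    have "(\<Sum>c=1..m. (if i = c then 1 else 0) * complex_of_real (X n s c)) = (\<Sum>c=1..m. if i = c then complex_of_real (X n s c) else 0)"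
      by (intro sum.cong) auto
    then show ?thesis using i by simp
  qed
  also have "\<dots> = (\<Sum>c=1..m. (\<Sum>j=1..m. v j i * u j c) * complex_of_real (X n s c))"
    using i by (intro sum.cong refl) (simp only: complete)
  also have "\<dots> = (\<Sum>j=1..m. v j i * dot (u j) (X n s))"
    unfolding dot_def sum_distrib_left sum_distrib_right by (subst sum.swap) (simp add: mult.assoc)
  also have "\<dots> = v 1 i * dot (u 1) (X n s) + (\<Sum>j=2..m. v j i * dot (u j) (X n s))"
    by (rule split_first)
  also have "dot (u 1) (X n s) = of_real (\<Sum>i=1..m. X n s i)"
    by (simp add: dot_def u_one del: One_nat_def)
  finally show ?thesis unfolding X_total[OF s] v_one[OF i] by (simp add: mult.commute)
qed

text \<open>The law of large numbers for the urn. In the basis \<open>v\<close> the coordinate of \<open>X n\<close> along \<open>v 1\<close> is the number of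
balls \<open>n + 1\<close>, and the other coordinates \<open>u j \<bullet> X n\<close> are negligible against \<open>n\<close>.\<close>

lemma deviation_tendsto_zero: "deviation \<longlonglongrightarrow> 0"
proof (rule tendsto_sandwich[OF _ _ tendsto_const])
  define Y where "Y j n = sqrt (mean n (\<lambda>s. (cmod (dot (u j) (X n s)))\<^sup>2)) / real n" for j n
  have Y: "(\<lambda>n. Y j n) \<longlonglongrightarrow> 0" if "j \<in> {2..m}" for j
  proof -
    have "(\<lambda>n. sqrt (mean n (\<lambda>s. (cmod (dot (u j) (X n s)))\<^sup>2) / (real n)\<^sup>2)) \<longlonglongrightarrow> sqrt 0"
      by (intro tendsto_intros second_moment_negligible that)
    then show ?thesis by (simp add: Y_def real_sqrt_divide)
  qed
  show "(\<lambda>n. \<Sum>i=1..m. \<Sum>j=2..m. cmod (v j i) * Y j n) \<longlonglongrightarrow> 0"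
    by (intro tendsto_null_sum tendsto_mult_right_zero Y)
  show "eventually (\<lambda>n. 0 \<le> deviation n) sequentially" using deviation_nonneg by simp
  show "eventually (\<lambda>n. deviation n \<le> (\<Sum>i=1..m. \<Sum>j=2..m. cmod (v j i) * Y j n)) sequentially"
    using eventually_gt_at_top[of "0::nat"]
  proof eventually_elim
    case (elim n)
    have "deviation n \<le> mean n (\<lambda>s. \<Sum>i=1..m. \<Sum>j=2..m. cmod (v j i) / real n * cmod (dot (u j) (X n s)))"
      unfolding deviation_def
    proof (intro mean_mono sum_mono)
      fix s i assume s: "s \<in> states n" and i: "i \<in> {1..m}"
      have "X n s i / real (Suc n) - p i = (X n s i - real (Suc n) * p i) / real (Suc n)"
        by (simp add: field_simps del: of_nat_Suc)
      then have "\<bar>X n s i / real (Suc n) - p i\<bar> = \<bar>X n s i - real (Suc n) * p i\<bar> / real (Suc n)"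
        by (simp add: abs_divide del: of_nat_Suc)
      also have "\<dots> \<le> \<bar>X n s i - real (Suc n) * p i\<bar> / real n"
        using elim by (intro divide_left_mono) auto
      also have "\<bar>X n s i - real (Suc n) * p i\<bar> = cmod (of_real (X n s i) - of_real (real (Suc n) * p i))"
        by (metis norm_of_real of_real_diff real_norm_def)
      also have "\<dots> = cmod (\<Sum>j=2..m. v j i * dot (u j) (X n s))"
        unfolding X_expansion[OF s i] by simp
      also have "\<dots> \<le> (\<Sum>j=2..m. cmod (v j i) * cmod (dot (u j) (X n s)))"
        by (rule order_trans[OF norm_sum]) (simp add: norm_mult)
      finally show "\<bar>X n s i / real (Suc n) - p i\<bar> \<le> (\<Sum>j=2..m. cmod (v j i) / real n * cmod (dot (u j) (X n s)))"
        by (simp add: sum_divide_distrib divide_right_mono)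
    qed
    also have "\<dots> = (\<Sum>i=1..m. \<Sum>j=2..m. cmod (v j i) / real n * mean n (\<lambda>s. cmod (dot (u j) (X n s))))"
      by (simp only: mean_sum mean_cmult)
    also have "\<dots> \<le> (\<Sum>i=1..m. \<Sum>j=2..m. cmod (v j i) / real n * sqrt (mean n (\<lambda>s. (cmod (dot (u j) (X n s)))\<^sup>2)))"
      by (intro sum_mono mult_left_mono mean_le_sqrt_mean_square) auto
    finally show ?case by (simp add: Y_def)
  qed
qed

end

section \<open>The martingale of a linear functional and its limit law\<close>

context unit_urn_spectrum
begin

context
  fixes w :: "nat \<Rightarrow> real"
begin

text \<open>The functional \<open>w\<close> is \<open>\<Sum>j. coef j * u j\<close> in the basis of left eigenvectors.\<close>

definition coef :: "nat \<Rightarrow> complex" where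
  "coef j = (\<Sum>i=1..m. of_real (w i) * v j i)"

definition drift :: real where
  "drift = (\<Sum>i=1..m. w i * p i)"

text \<open>Row vectors indexed by the time \<open>k\<close>: the conditional mean of the functional \<open>\<Sum>j\<ge>2. coef j * u j\<close> of the urn at
time \<open>n\<close>, given the urn at time \<open>k\<close>, is the product of this row vector with \<open>X k\<close>.\<close>

definition complex_weight :: "nat \<Rightarrow> nat \<Rightarrow> nat \<Rightarrow> complex" where
  "complex_weight k n i = (\<Sum>j=2..m. coef j * growth (lam j) k n * u j i)"

text \<open>The change of the functional \<open>complex_weight k n\<close> when a ball of type \<open>i\<close> is drawn.\<close>

definition complex_increment :: "nat \<Rightarrow> nat \<Rightarrow> nat \<Rightarrow> complex" where
  "complex_increment k n i = (\<Sum>j=2..m. coef j * growth (lam j) k n * (lam j * u j i))"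

definition weight :: "nat \<Rightarrow> nat \<Rightarrow> nat \<Rightarrow> real" where
  "weight k n i = Re (complex_weight k n i)"

definition increment :: "nat \<Rightarrow> nat \<Rightarrow> nat \<Rightarrow> real" where
  "increment k n i = (\<Sum>l=1..m. weight k n l * xi i l)"

lemma complex_increment_eq:
  assumes "i \<in> {1..m}"
  shows "complex_increment k n i = (\<Sum>l=1..m. complex_weight k n l * of_real (xi i l))"
proof -
  have "complex_increment k n i = (\<Sum>j=2..m. coef j * growth (lam j) k n * (\<Sum>l=1..m. u j l * of_real (xi i l)))"
    unfolding complex_increment_def using assms by (intro sum.cong refl) (simp add: left_eigen del: One_nat_def)
  also have "\<dots> = (\<Sum>l=1..m. complex_weight k n l * of_real (xi i l))"
    unfolding complex_weight_def sum_distrib_left sum_distrib_right by (subst sum.swap) (simp add: mult.assoc)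
  finally show ?thesis .
qed

lemma complex_weight_step:
  assumes "k < n"
  shows "complex_weight k n i = complex_weight (Suc k) n i + complex_increment (Suc k) n i / of_nat (Suc k)"
  unfolding complex_weight_def complex_increment_def sum_divide_distrib sum.distrib[symmetric]
  using growth_step[OF assms] by (intro sum.cong refl) (simp add: algebra_simps del: of_nat_Suc)

lemma coef_one: "coef 1 = of_real drift"
  unfolding coef_def drift_def of_real_sum by (intro sum.cong refl) (simp add: v_one del: One_nat_def)

lemma complex_weight_final:
  assumes "i \<in> {1..m}"
  shows "complex_weight n n i = of_real (w i - drift)"
proof -
  have "(\<Sum>j=1..m. coef j * u j i) = (\<Sum>r=1..m. of_real (w r) * (\<Sum>j=1..m. v j r * u j i))"
    unfolding coef_def sum_distrib_left sum_distrib_right by (subst sum.swap) (simp add: mult.assoc)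
  also have "\<dots> = (\<Sum>r=1..m. if r = i then of_real (w r) else 0)"
    using assms by (intro sum.cong refl) (simp only: complete, simp)
  also have "\<dots> = of_real (w i)" using assms by simp
  finally have "(\<Sum>j=1..m. coef j * u j i) = of_real (w i)" .
  then have "coef 1 * u 1 i + complex_weight n n i = of_real (w i)"
    unfolding split_first complex_weight_def by simp
  then have "complex_weight n n i = of_real (w i) - coef 1 * u 1 i" by (simp add: algebra_simps)
  then show ?thesis unfolding coef_one u_one[OF assms] by simp
qed

text \<open>The row vector at time \<open>n\<close> is \<open>w\<close> minus a constant, and the recursion backwards in time has real coefficients.\<close>

lemma complex_weight_real:
  assumes "k \<le> n" "i \<in> {1..m}"
  shows "complex_weight k n i = of_real (weight k n i)"
proof -
  have "\<forall>i\<in>{1..m}. complex_weight k n i \<in> \<real>"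
    using assms(1)
  proof (induction k rule: inc_induct)
    case base
    show ?case using complex_weight_final by simp
  next
    case (step k)
    show ?case
    proof
      fix i assume i: "i \<in> {1..m}"
      have "complex_increment (Suc k) n i \<in> \<real>"
        unfolding complex_increment_eq[OF i] using step by (intro sum_in_Reals Reals_mult) auto
      then show "complex_weight k n i \<in> \<real>"
        unfolding complex_weight_step[OF step.hyps(2)] using step.IH i by (intro Reals_add Reals_divide) auto
    qed
  qed
  then have "complex_weight k n i \<in> \<real>" using assms(2) by blast
  then show ?thesis by (simp add: weight_def)
qed

lemma complex_increment_real:
  assumes "k \<le> n" "i \<in> {1..m}"
  shows "complex_increment k n i = of_real (increment k n i)"
  unfolding complex_increment_eq[OF assms(2)] increment_def of_real_sum
  by (intro sum.cong refl) (simp add: complex_weight_real assms)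

lemma weight_step:
  assumes "k < n" "i \<in> {1..m}"
  shows "weight k n i = weight (Suc k) n i + increment (Suc k) n i / real (Suc k)"
proof -
  have "complex_of_real (weight k n i) = of_real (weight (Suc k) n i + increment (Suc k) n i / real (Suc k))"
    using complex_weight_step[OF assms(1), of i] assms by (simp add: complex_weight_real complex_increment_real del: of_nat_Suc)
  then show ?thesis by (simp only: of_real_eq_iff)
qed

lemma weight_final: "i \<in> {1..m} \<Longrightarrow> weight n n i = w i - drift"
  by (simp add: weight_def complex_weight_final)

text \<open>Under the limiting composition the increments have mean zero, as \<open>p\<close> is orthogonal to \<open>u j\<close> for \<open>j \<ge> 2\<close>.\<close>

lemma increment_centred:
  assumes "k \<le> n"
  shows "(\<Sum>i=1..m. p i * increment k n i) = 0"
proof -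
  have "complex_of_real (\<Sum>i=1..m. p i * increment k n i) = (\<Sum>i=1..m. of_real (p i) * complex_increment k n i)"
    unfolding of_real_sum using assms by (intro sum.cong refl) (simp add: complex_increment_real)
  also have "\<dots> = (\<Sum>j=2..m. coef j * growth (lam j) k n * lam j * (\<Sum>i=1..m. of_real (p i) * u j i))"
    unfolding complex_increment_def sum_distrib_left by (subst sum.swap) (simp add: mult_ac)
  also have "\<dots> = 0" by (intro sum.neutral ballI) (simp only: left_orthogonal, simp)
  finally show ?thesis by (simp only: of_real_eq_0_iff)
qed

text \<open>Up to a constant, a bound for the weights and the increments at time \<open>k\<close>.\<close>

definition total_growth :: "nat \<Rightarrow> nat \<Rightarrow> real" where
  "total_growth k n = (\<Sum>j=2..m. cmod (growth (lam j) k n))"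

lemma total_growth_nonneg: "total_growth k n \<ge> 0"
  unfolding total_growth_def by (intro sum_nonneg) auto

lemma weight_increment_bound:
  obtains K where "K \<ge> 0"
    "\<And>(k::nat) n i. k \<le> n \<Longrightarrow> i \<in> {1..m} \<Longrightarrow> \<bar>weight k n i\<bar> \<le> K * total_growth k n"
    "\<And>(k::nat) n i. k \<le> n \<Longrightarrow> i \<in> {1..m} \<Longrightarrow> \<bar>increment k n i\<bar> \<le> K * total_growth k n"
proof
  define K where "K = (\<Sum>j=2..m. \<Sum>i=1..m. cmod (coef j * u j i) + cmod (coef j * (lam j * u j i)))"
  have K: "cmod (coef j * u j i) + cmod (coef j * (lam j * u j i)) \<le> K" if "j \<in> {2..m}" "i \<in> {1..m}" for i j
  proof -
    have "cmod (coef j * u j i) + cmod (coef j * (lam j * u j i)) \<le> (\<Sum>i=1..m. cmod (coef j * u j i) + cmod (coef j * (lam j * u j i)))"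
      using that(2) by (intro member_le_sum) auto
    also have "\<dots> \<le> K" unfolding K_def using that(1) by (intro member_le_sum sum_nonneg) auto
    finally show ?thesis .
  qed
  show "K \<ge> 0" unfolding K_def by (intro sum_nonneg) auto
  fix k n i :: nat assume kn: "k \<le> n" and i: "i \<in> {1..m}"
  have "\<bar>weight k n i\<bar> = cmod (complex_weight k n i)" unfolding complex_weight_real[OF kn i] by simp
  also have "\<dots> \<le> (\<Sum>j=2..m. K * cmod (growth (lam j) k n))"
    unfolding complex_weight_def
  proof (rule order_trans[OF norm_sum], rule sum_mono)
    fix j assume j: "j \<in> {2..m}"
    have "cmod (coef j * u j i) \<le> K" using K[OF j i] norm_ge_zero[of "coef j * (lam j * u j i)"] by linarith
    then have "cmod (coef j * u j i) * cmod (growth (lam j) k n) \<le> K * cmod (growth (lam j) k n)"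
      by (rule mult_right_mono) simp
    then show "cmod (coef j * growth (lam j) k n * u j i) \<le> K * cmod (growth (lam j) k n)"
      by (simp add: norm_mult mult_ac)
  qed
  finally show "\<bar>weight k n i\<bar> \<le> K * total_growth k n" by (simp add: total_growth_def sum_distrib_left)
  have "\<bar>increment k n i\<bar> = cmod (complex_increment k n i)" unfolding complex_increment_real[OF kn i] by simp
  also have "\<dots> \<le> (\<Sum>j=2..m. K * cmod (growth (lam j) k n))"
    unfolding complex_increment_def
  proof (rule order_trans[OF norm_sum], rule sum_mono)
    fix j assume j: "j \<in> {2..m}"
    have "cmod (coef j * (lam j * u j i)) \<le> K" using K[OF j i] norm_ge_zero[of "coef j * u j i"] by linarith
    then have "cmod (coef j * (lam j * u j i)) * cmod (growth (lam j) k n) \<le> K * cmod (growth (lam j) k n)"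
      by (rule mult_right_mono) simp
    then show "cmod (coef j * growth (lam j) k n * (lam j * u j i)) \<le> K * cmod (growth (lam j) k n)"
      by (simp add: norm_mult mult_ac)
  qed
  finally show "\<bar>increment k n i\<bar> \<le> K * total_growth k n" by (simp add: total_growth_def sum_distrib_left)
qed

lemma total_growth_power_sum_tendsto:
  assumes "q \<ge> (3::nat)"
  shows "(\<lambda>n. \<Sum>k\<le>n. (total_growth k n / sqrt (real n)) ^ q) \<longlonglongrightarrow> 0"
proof (rule tendsto_sandwich[OF _ _ tendsto_const])
  let ?b = "\<lambda>n. real (card {2..m}) ^ q * (\<Sum>j=2..m. \<Sum>k\<le>n. (cmod (growth (lam j) k n) / sqrt (real n)) ^ q)"
  show "?b \<longlonglongrightarrow> 0"
    by (intro tendsto_mult_right_zero tendsto_null_sum growth_power_sum_tendsto small assms)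
  show "eventually (\<lambda>n. 0 \<le> (\<Sum>k\<le>n. (total_growth k n / sqrt (real n)) ^ q)) sequentially"
    by (intro always_eventually allI sum_nonneg zero_le_power divide_nonneg_nonneg total_growth_nonneg) auto
  have "(\<Sum>k\<le>n. (total_growth k n / sqrt (real n)) ^ q) \<le> ?b n" for n
  proof -
    have "(\<Sum>k\<le>n. (total_growth k n / sqrt (real n)) ^ q) \<le> (\<Sum>k\<le>n. real (card {2..m}) ^ q * (\<Sum>j=2..m. (cmod (growth (lam j) k n) / sqrt (real n)) ^ q))"
      unfolding total_growth_def sum_divide_distrib using assms by (intro sum_mono sum_power_le) auto
    then show ?thesis unfolding sum_distrib_left[symmetric] by (subst sum.swap)
  qed
  then show "eventually (\<lambda>n. (\<Sum>k\<le>n. (total_growth k n / sqrt (real n)) ^ q) \<le> ?b n) sequentially" by simp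
qed

lemma total_growth_weighted_tendsto:
  assumes "e \<longlonglongrightarrow> 0" "\<And>k. e k \<ge> 0"
  shows "(\<lambda>n. (\<Sum>k\<le>n. (total_growth k n)\<^sup>2 * e k) / real n) \<longlonglongrightarrow> 0"
proof (rule tendsto_sandwich[OF _ _ tendsto_const])
  let ?b = "\<lambda>n. real (card {2..m}) ^ 2 * (\<Sum>j=2..m. (\<Sum>k\<le>n. (cmod (growth (lam j) k n))\<^sup>2 * e k) / real n)"
  show "?b \<longlonglongrightarrow> 0"
    by (intro tendsto_mult_right_zero tendsto_null_sum growth_weighted_squares_tendsto small assms)
  show "eventually (\<lambda>n. 0 \<le> (\<Sum>k\<le>n. (total_growth k n)\<^sup>2 * e k) / real n) sequentially"
    using assms(2) by (intro always_eventually allI sum_nonneg divide_nonneg_nonneg mult_nonneg_nonneg) auto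
  have "(\<Sum>k\<le>n. (total_growth k n)\<^sup>2 * e k) / real n \<le> ?b n" for n
  proof -
    have "(\<Sum>k\<le>n. (total_growth k n)\<^sup>2 * e k) \<le> (\<Sum>k\<le>n. (real (card {2..m}) ^ 2 * (\<Sum>j=2..m. (cmod (growth (lam j) k n))\<^sup>2)) * e k)"
      unfolding total_growth_def using assms(2) by (intro sum_mono mult_right_mono sum_power_le) auto
    also have "\<dots> = real (card {2..m}) ^ 2 * (\<Sum>j=2..m. (\<Sum>k\<le>n. (cmod (growth (lam j) k n))\<^sup>2 * e k))"
      unfolding sum_distrib_left sum_distrib_right by (subst sum.swap) (simp add: mult_ac)
    finally have "(\<Sum>k\<le>n. (total_growth k n)\<^sup>2 * e k) / real n \<le> \<dots> / real n"
      by (rule divide_right_mono) simp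
    then show ?thesis by (simp only: sum_divide_distrib[symmetric] times_divide_eq_right)
  qed
  then show "eventually (\<lambda>n. (\<Sum>k\<le>n. (total_growth k n)\<^sup>2 * e k) / real n \<le> ?b n) sequentially" by simp
qed

definition variance_term :: "nat \<Rightarrow> nat \<Rightarrow> real" where
  "variance_term k n = (\<Sum>i=1..m. p i * (increment k n i)\<^sup>2)"

definition limit_variance :: complex where
  "limit_variance = (\<Sum>j=2..m. \<Sum>k=2..m. coef j * coef k *
      (\<Sum>i=1..m. of_real (p i) * (lam j * u j i) * (lam k * u k i)) / (1 - lam j - lam k))"

text \<open>The variance term is a quadratic form in the growth factors, so its mean over \<open>k\<close> converges coefficient by
coefficient.\<close>

lemma mean_variance_tendsto:
  "(\<lambda>n. of_real ((\<Sum>k=1..n. variance_term k n) / real n)) \<longlonglongrightarrow> limit_variance"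
proof -
  let ?b = "\<lambda>j k. \<Sum>i=1..m. complex_of_real (p i) * (lam j * u j i) * (lam k * u k i)"
  have eq: "complex_of_real ((\<Sum>l=1..n. variance_term l n) / real n) = 
     (\<Sum>j=2..m. \<Sum>k=2..m. coef j * coef k * ?b j k * ((\<Sum>l=1..n. growth (lam j) l n * growth (lam k) l n) / of_nat n))" for n
  proof -
    have "complex_of_real (variance_term l n) = (\<Sum>j=2..m. \<Sum>k=2..m. coef j * coef k * ?b j k * (growth (lam j) l n * growth (lam k) l n))"
      if "l \<in> {1..n}" for l
    proof -
      have "complex_of_real (variance_term l n) = (\<Sum>i=1..m. of_real (p i) * (complex_increment l n i * complex_increment l n i))"
        unfolding variance_term_def of_real_sum using that by (intro sum.cong refl) (simp add: complex_increment_real power2_eq_square)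
      also have "\<dots> = (\<Sum>i=1..m. \<Sum>j=2..m. \<Sum>k=2..m. of_real (p i) * ((coef j * growth (lam j) l n * (lam j * u j i)) * (coef k * growth (lam k) l n * (lam k * u k i))))"
        unfolding complex_increment_def sum_product by (simp only: sum_distrib_left)
      also have "\<dots> = (\<Sum>j=2..m. \<Sum>k=2..m. \<Sum>i=1..m. of_real (p i) * ((coef j * growth (lam j) l n * (lam j * u j i)) * (coef k * growth (lam k) l n * (lam k * u k i))))"
        by (subst sum.swap, rule sum.cong[OF refl], rule sum.swap)
      also have "\<dots> = (\<Sum>j=2..m. \<Sum>k=2..m. coef j * coef k * ?b j k * (growth (lam j) l n * growth (lam k) l n))"
        unfolding sum_distrib_left sum_distrib_right by (intro sum.cong refl) (simp add: mult_ac)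
      finally show ?thesis .
    qed
    then have "complex_of_real (\<Sum>l=1..n. variance_term l n) = 
      (\<Sum>l=1..n. \<Sum>j=2..m. \<Sum>k=2..m. coef j * coef k * ?b j k * (growth (lam j) l n * growth (lam k) l n))"
      unfolding of_real_sum by (intro sum.cong refl)
    also have "\<dots> = (\<Sum>j=2..m. \<Sum>k=2..m. \<Sum>l=1..n. coef j * coef k * ?b j k * (growth (lam j) l n * growth (lam k) l n))"
      by (subst sum.swap, rule sum.cong[OF refl], rule sum.swap)
    finally have "complex_of_real (\<Sum>l=1..n. variance_term l n) = 
      (\<Sum>j=2..m. \<Sum>k=2..m. coef j * coef k * ?b j k * (\<Sum>l=1..n. growth (lam j) l n * growth (lam k) l n))"
      by (simp only: sum_distrib_left)
    then show ?thesis
      by (simp only: of_real_divide of_real_of_nat_eq times_divide_eq_right sum_divide_distrib[symmetric])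
  qed
  show ?thesis unfolding eq limit_variance_def
  proof (intro tendsto_sum)
    fix j k assume "j \<in> {2..m}" "k \<in> {2..m}"
    then have "(\<lambda>n. (\<Sum>l=1..n. growth (lam j) l n * growth (lam k) l n) / of_nat n) \<longlonglongrightarrow> 1 / (1 - lam j - lam k)"
      by (intro growth_product_mean_tendsto small)
    from tendsto_mult[OF tendsto_const this, of "coef j * coef k * ?b j k"]
    show "(\<lambda>n. coef j * coef k * ?b j k * ((\<Sum>l=1..n. growth (lam j) l n * growth (lam k) l n) / of_nat n))
       \<longlonglongrightarrow> coef j * coef k * ?b j k / (1 - lam j - lam k)" by simp
  qed
qed

lemma variance_term_nonneg: "variance_term k n \<ge> 0"
  unfolding variance_term_def by (intro sum_nonneg mult_nonneg_nonneg) (auto intro: p_nonneg)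

lemma limit_variance_real:
  obtains sigma2 where "sigma2 \<ge> 0" "limit_variance = of_real sigma2"
    "(\<lambda>n. (\<Sum>k=1..n. variance_term k n) / real n) \<longlonglongrightarrow> sigma2"
proof
  have lim: "(\<lambda>n. (\<Sum>k=1..n. variance_term k n) / real n) \<longlonglongrightarrow> Re limit_variance"
    using tendsto_Re[OF mean_variance_tendsto] by simp
  then show "(\<lambda>n. (\<Sum>k=1..n. variance_term k n) / real n) \<longlonglongrightarrow> Re limit_variance" .
  show "Re limit_variance \<ge> 0"
    by (rule tendsto_lowerbound[OF lim]) (auto intro!: always_eventually divide_nonneg_nonneg sum_nonneg variance_term_nonneg)
  show "limit_variance = of_real (Re limit_variance)"
    by (rule LIMSEQ_unique[OF mean_variance_tendsto tendsto_of_real[OF lim]])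
qed

text \<open>The characteristic function, at \<open>t\<close>, of the sum of the martingale at time \<open>k\<close> and an independent centred Gaussian
variable with the variances of the remaining steps, divided by \<open>sqrt n\<close>. It interpolates between (almost) a
Gaussian law at \<open>k = 0\<close> and the law of the functional at \<open>k = n\<close>.\<close>

definition hybrid :: "real \<Rightarrow> nat \<Rightarrow> nat \<Rightarrow> complex" where
  "hybrid t n k = mean k (\<lambda>s. iexp (t / sqrt (real n) * (\<Sum>i=1..m. weight k n i * X k s i))) *
     of_real (exp (- ((t / sqrt (real n))\<^sup>2 / 2 * (\<Sum>l=Suc k..n. variance_term l n))))"

text \<open>The steps after \<open>k + 1\<close> contribute the same factor to both terms. Conditionally on the urn at time \<open>k\<close>, the step
from \<open>k\<close> to \<open>k + 1\<close> adds an increment that is centred because the weights form a martingale, and the estimate for the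
exchange of one increment applies with \<open>q\<close> the current and \<open>p\<close> the limiting composition.\<close>

lemma hybrid_step:
  fixes t :: real
  assumes K: "K \<ge> 0" "\<And>(k::nat) n i. k \<le> n \<Longrightarrow> i \<in> {1..m} \<Longrightarrow> \<bar>increment k n i\<bar> \<le> K * total_growth k n"
    and k: "k < n"
  defines "s \<equiv> t / sqrt (real n)"
  defines "B \<equiv> K * total_growth (Suc k) n"
  shows "cmod (hybrid t n (Suc k) - hybrid t n k) \<le>
    (2 * \<bar>s\<bar> * B) ^ 3 / 6 + s\<^sup>2 * B\<^sup>2 * deviation k + (s\<^sup>2 * B\<^sup>2)\<^sup>2 / 8"
proof -
  define R where "R = exp (- (s\<^sup>2 / 2 * (\<Sum>l=Suc (Suc k)..n. variance_term l n)))"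
  define a where "a = exp (- (s\<^sup>2 / 2 * variance_term (Suc k) n))"
  define Mk where "Mk z = (\<Sum>i=1..m. weight k n i * X k z i)" for z
  define q where "q z i = X k z i / real (Suc k)" for z i
  define D where "D i = increment (Suc k) n i" for i
  define db where "db z = (\<Sum>l=1..m. q z l * D l)" for z
  have R: "0 \<le> R" "R \<le> 1" unfolding R_def
    by (auto intro!: mult_nonneg_nonneg sum_nonneg variance_term_nonneg)
  have split: "exp (- (s\<^sup>2 / 2 * (\<Sum>l=Suc k..n. variance_term l n))) = a * R"
  proof -
    have "(\<Sum>l=Suc k..n. variance_term l n) = variance_term (Suc k) n + (\<Sum>l=Suc (Suc k)..n. variance_term l n)"
      using k by (intro sum.atLeast_Suc_atMost) auto
    then show ?thesis by (simp add: a_def R_def exp_add[symmetric] algebra_simps)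
  qed
  \<comment> \<open>The martingale property: the new value is the old one plus the increment minus its conditional mean.\<close>
  have shift: "(\<Sum>l=1..m. weight (Suc k) n l * (X k z l + xi i l)) = Mk z + (D i - db z)" if "i \<in> {1..m}" for i z
  proof -
    have "Mk z = (\<Sum>l=1..m. weight (Suc k) n l * X k z l) + db z"
      unfolding Mk_def db_def sum.distrib[symmetric] q_def D_def using k
      by (intro sum.cong refl) (simp add: weight_step algebra_simps del: of_nat_Suc)
    then show ?thesis by (simp add: D_def increment_def sum.distrib algebra_simps)
  qed
  have shift_exp: "iexp (s * (\<Sum>l=1..m. weight (Suc k) n l * (X k z l + xi i l))) = iexp (s * Mk z) * iexp (s * (D i - db z))"
    if "i \<in> {1..m}" for i z
    unfolding shift[OF that] distrib_left[of s] by (simp add: exp_add distrib_left)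
  have "mean (Suc k) (\<lambda>z. iexp (s * (\<Sum>i=1..m. weight (Suc k) n i * X (Suc k) z i)))
     = mean k (\<lambda>z. \<Sum>i=1..m. of_real (X k z i / real (Suc k)) * iexp (s * (\<Sum>l=1..m. weight (Suc k) n l * (X k z l + xi i l))))"
    by (rule mean_Suc[where f = "\<lambda>x. iexp (s * (\<Sum>i=1..m. weight (Suc k) n i * x i))"])
  also have "\<dots> = mean k (\<lambda>z. iexp (s * Mk z) * (\<Sum>i=1..m. of_real (q z i) * iexp (s * (D i - db z))))"
    unfolding sum_distrib_left[of "iexp _"]
    by (intro mean_cong sum.cong refl) (subst shift_exp, assumption, simp only: q_def mult_ac)
  finally have Suc_k: "mean (Suc k) (\<lambda>z. iexp (s * (\<Sum>i=1..m. weight (Suc k) n i * X (Suc k) z i)))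
     = mean k (\<lambda>z. iexp (s * Mk z) * (\<Sum>i=1..m. of_real (q z i) * iexp (s * (D i - db z))))" .
  have mean_split: "mean k (\<lambda>z. E z * (F z - c)) = mean k (\<lambda>z. E z * F z) - c * mean k E" for E F and c :: complex
    unfolding mean_cmult[symmetric] mean_diff[symmetric] by (simp add: right_diff_distrib mult.commute)
  have "hybrid t n (Suc k) - hybrid t n k = of_real R * mean k (\<lambda>z. iexp (s * Mk z) * ((\<Sum>i=1..m. of_real (q z i) * iexp (s * (D i - db z))) - of_real a))"
    unfolding hybrid_def s_def[symmetric] split R_def[symmetric] Mk_def[symmetric] Suc_k mean_split
    by (simp only: of_real_mult right_diff_distrib mult_ac)
  also have "cmod \<dots> \<le> 1 * mean k (\<lambda>z. cmod (iexp (s * Mk z) * ((\<Sum>i=1..m. of_real (q z i) * iexp (s * (D i - db z))) - of_real a)))"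
    unfolding norm_mult[of "of_real R"] using R by (intro mult_mono norm_mean_le) auto
  also have "\<dots> = mean k (\<lambda>z. cmod ((\<Sum>i=1..m. of_real (q z i) * iexp (s * (D i - db z))) - of_real a))"
    by (simp add: norm_mult)
  also have "\<dots> \<le> mean k (\<lambda>z. (2 * \<bar>s\<bar> * B) ^ 3 / 6 + s\<^sup>2 * B\<^sup>2 * (\<Sum>i=1..m. \<bar>q z i - p i\<bar>) + (s\<^sup>2 * B\<^sup>2)\<^sup>2 / 8)"
  proof (rule mean_mono)
    fix z assume z: "z \<in> states k"
    show "cmod ((\<Sum>i=1..m. of_real (q z i) * iexp (s * (D i - db z))) - of_real a) \<le> 
      (2 * \<bar>s\<bar> * B) ^ 3 / 6 + s\<^sup>2 * B\<^sup>2 * (\<Sum>i=1..m. \<bar>q z i - p i\<bar>) + (s\<^sup>2 * B\<^sup>2)\<^sup>2 / 8"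
      unfolding a_def variance_term_def db_def D_def
    proof (rule centred_exponential_mean_bound)
      show "(\<Sum>i=1..m. q z i) = 1" unfolding q_def sum_divide_distrib[symmetric] X_total[OF z] by simp
      show "q z i \<ge> 0" for i using X_nonneg[OF z] by (simp add: q_def)
      show "(\<Sum>i=1..m. p i * increment (Suc k) n i) = 0" using k by (intro increment_centred) auto
      show "\<bar>increment (Suc k) n i\<bar> \<le> B" if "i \<in> {1..m}" for i unfolding B_def using k that by (intro K) auto
    qed (auto simp: sum_p p_nonneg simp del: One_nat_def)
  qed
  also have "\<dots> = (2 * \<bar>s\<bar> * B) ^ 3 / 6 + s\<^sup>2 * B\<^sup>2 * deviation k + (s\<^sup>2 * B\<^sup>2)\<^sup>2 / 8"
    unfolding deviation_def q_def mean_add mean_cmult by simp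
  finally show ?thesis .
qed

text \<open>The costs of the exchanges add up to third and fourth powers of the increments, which are negligible, and to
their squares weighted by the deviation of the composition from its limit, which tends to zero.\<close>

lemma hybrid_difference_tendsto: "(\<lambda>n. hybrid t n n - hybrid t n 0) \<longlonglongrightarrow> 0"
proof -
  obtain K where K: "K \<ge> 0"
    "\<And>(k::nat) n i. k \<le> n \<Longrightarrow> i \<in> {1..m} \<Longrightarrow> \<bar>increment k n i\<bar> \<le> K * total_growth k n"
    using weight_increment_bound by metis
  let ?g = "\<lambda>k n. total_growth k n / sqrt (real n)"
  \<comment> \<open>The increment of step \<open>k\<close> is drawn from the urn at time \<open>k - 1\<close>; at \<open>k = 0\<close> there is no step, and the value there is immaterial.\<close>
  let ?e = "\<lambda>k. deviation (k - 1)"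
  let ?b = "\<lambda>n. (2 * \<bar>t\<bar> * K) ^ 3 / 6 * (\<Sum>k\<le>n. ?g k n ^ 3) + t\<^sup>2 * K\<^sup>2 * ((\<Sum>k\<le>n. (total_growth k n)\<^sup>2 * ?e k) / real n)
     + (t\<^sup>2 * K\<^sup>2)\<^sup>2 / 8 * (\<Sum>k\<le>n. ?g k n ^ 4)"
  have e0: "?e \<longlonglongrightarrow> 0"
  proof (rule LIMSEQ_offset[where k = 1])
    show "(\<lambda>n. deviation (n + 1 - 1)) \<longlonglongrightarrow> 0" using deviation_tendsto_zero by simp
  qed
  have b0: "?b \<longlonglongrightarrow> 0"
    by (intro tendsto_add_zero tendsto_mult_right_zero total_growth_power_sum_tendsto total_growth_weighted_tendsto e0 deviation_nonneg) auto
  have "cmod (hybrid t n n - hybrid t n 0) \<le> ?b n" for n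
  proof -
    have "cmod (hybrid t n n - hybrid t n 0) = cmod (\<Sum>k<n. hybrid t n (Suc k) - hybrid t n k)"
      by (subst sum_lessThan_telescope) simp
    also have "\<dots> \<le> (\<Sum>k<n. (2 * \<bar>t\<bar> * K) ^ 3 / 6 * ?g (Suc k) n ^ 3 + t\<^sup>2 * K\<^sup>2 * ((total_growth (Suc k) n)\<^sup>2 * ?e (Suc k) / real n)
        + (t\<^sup>2 * K\<^sup>2)\<^sup>2 / 8 * ?g (Suc k) n ^ 4)"
    proof (rule order_trans[OF norm_sum], rule sum_mono)
      fix k assume "k \<in> {..<n}"
      then have k: "k < n" by simp
      define s where "s = t / sqrt (real n)"
      define G where "G = total_growth (Suc k) n"
      have 1: "(2 * \<bar>s\<bar> * (K * G)) ^ 3 / 6 = (2 * \<bar>t\<bar> * K) ^ 3 / 6 * (G / sqrt (real n)) ^ 3"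
        by (simp add: s_def abs_divide power_mult_distrib power_divide)
      have s2: "s\<^sup>2 = t\<^sup>2 / real n" by (simp add: s_def power_divide)
      have 2: "s\<^sup>2 * (K * G)\<^sup>2 = t\<^sup>2 * K\<^sup>2 * (G\<^sup>2 / real n)"
        by (simp add: s2 power_mult_distrib)
      have 3: "(G / sqrt (real n)) ^ 4 = (G\<^sup>2 / real n)\<^sup>2"
        by (simp add: power_divide flip: power_mult) (simp add: power4_eq_xxxx power2_eq_square)
      show "cmod (hybrid t n (Suc k) - hybrid t n k) \<le> (2 * \<bar>t\<bar> * K) ^ 3 / 6 * ?g (Suc k) n ^ 3 + t\<^sup>2 * K\<^sup>2 * ((total_growth (Suc k) n)\<^sup>2 * ?e (Suc k) / real n)
        + (t\<^sup>2 * K\<^sup>2)\<^sup>2 / 8 * ?g (Suc k) n ^ 4"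
        using hybrid_step[OF K k, of t] unfolding s_def[symmetric] G_def[symmetric] 1 2 3 power_mult_distrib[of "t\<^sup>2 * K\<^sup>2"]
        by (simp add: mult.assoc)
    qed
    also have "\<dots> = (\<Sum>k\<in>{1..n}. (2 * \<bar>t\<bar> * K) ^ 3 / 6 * ?g k n ^ 3 + t\<^sup>2 * K\<^sup>2 * ((total_growth k n)\<^sup>2 * ?e k / real n)
        + (t\<^sup>2 * K\<^sup>2)\<^sup>2 / 8 * ?g k n ^ 4)"
      by (rule sum.reindex_bij_witness[of _ "\<lambda>k. k - 1" Suc]) auto
    also have "\<dots> \<le> (\<Sum>k\<le>n. (2 * \<bar>t\<bar> * K) ^ 3 / 6 * ?g k n ^ 3 + t\<^sup>2 * K\<^sup>2 * ((total_growth k n)\<^sup>2 * ?e k / real n)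
        + (t\<^sup>2 * K\<^sup>2)\<^sup>2 / 8 * ?g k n ^ 4)"
    proof (intro sum_mono2 add_nonneg_nonneg)
      fix k
      have "0 \<le> ?g k n" by (simp add: total_growth_nonneg)
      then show "0 \<le> (2 * \<bar>t\<bar> * K) ^ 3 / 6 * ?g k n ^ 3" "0 \<le> (t\<^sup>2 * K\<^sup>2)\<^sup>2 / 8 * ?g k n ^ 4"
        using K(1) by (auto intro!: mult_nonneg_nonneg)
      show "0 \<le> t\<^sup>2 * K\<^sup>2 * ((total_growth k n)\<^sup>2 * ?e k / real n)"
        by (auto intro!: mult_nonneg_nonneg divide_nonneg_nonneg deviation_nonneg)
    qed auto
    also have "\<dots> = ?b n"
      by (simp add: sum.distrib sum_distrib_left sum_divide_distrib)
    finally show ?thesis .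
  qed
  then show ?thesis by (intro Lim_null_comparison[OF _ b0]) (auto intro: always_eventually)
qed

lemma initial_weight_tendsto: "(\<lambda>n. total_growth 0 n / sqrt (real n)) \<longlonglongrightarrow> 0"
proof -
  have "(\<lambda>n. (total_growth 0 n / sqrt (real n)) ^ 3) \<longlonglongrightarrow> 0"
  proof (rule tendsto_sandwich[OF _ _ tendsto_const total_growth_power_sum_tendsto[of 3]])
    have nn: "0 \<le> (total_growth k n / sqrt (real n)) ^ 3" for k n
      by (intro zero_le_power divide_nonneg_nonneg total_growth_nonneg) auto
    then show "eventually (\<lambda>n. 0 \<le> (total_growth 0 n / sqrt (real n)) ^ 3) sequentially" by simp
    have "(total_growth 0 n / sqrt (real n)) ^ 3 \<le> (\<Sum>k\<le>n. (total_growth k n / sqrt (real n)) ^ 3)" for n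
      using nn by (intro member_le_sum) auto
    then show "eventually (\<lambda>n. (total_growth 0 n / sqrt (real n)) ^ 3 \<le> (\<Sum>k\<le>n. (total_growth k n / sqrt (real n)) ^ 3)) sequentially"
      by simp
  qed simp
  then have "(\<lambda>n. root 3 ((total_growth 0 n / sqrt (real n)) ^ 3)) \<longlonglongrightarrow> root 3 0"
    by (rule tendsto_real_root)
  then show ?thesis by (simp add: real_root_power_cancel total_growth_nonneg)
qed

text \<open>At time \<open>0\<close> the martingale is at most a constant times the growth factors up to \<open>n\<close>, which are of smaller order
than \<open>sqrt n\<close>; only the Gaussian part remains.\<close>

lemma hybrid_initial_tendsto:
  assumes "(\<lambda>n. (\<Sum>k=1..n. variance_term k n) / real n) \<longlonglongrightarrow> sigma2"
  shows "(\<lambda>n. hybrid t n 0) \<longlonglongrightarrow> of_real (exp (- (t\<^sup>2 * sigma2 / 2)))"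
proof -
  obtain K where K: "K \<ge> 0"
    "\<And>(k::nat) n i. k \<le> n \<Longrightarrow> i \<in> {1..m} \<Longrightarrow> \<bar>weight k n i\<bar> \<le> K * total_growth k n"
    using weight_increment_bound by metis
  define Y where "Y n z = t / sqrt (real n) * (\<Sum>i=1..m. weight 0 n i * X 0 z i)" for n z
  have Y: "(\<lambda>n. Y n z) \<longlonglongrightarrow> 0" if z: "z \<in> states 0" for z
  proof (rule Lim_null_comparison)
    show "(\<lambda>n. \<bar>t\<bar> * K * (total_growth 0 n / sqrt (real n))) \<longlonglongrightarrow> 0"
      by (intro tendsto_mult_right_zero initial_weight_tendsto)
    have "norm (Y n z) \<le> \<bar>t\<bar> * K * (total_growth 0 n / sqrt (real n))" for n
    proof -
      have "\<bar>\<Sum>i=1..m. weight 0 n i * X 0 z i\<bar> \<le> (\<Sum>i=1..m. K * total_growth 0 n * X 0 z i)"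
        using X_nonneg[OF z] by (intro order_trans[OF sum_abs] sum_mono) (auto simp: abs_mult intro!: mult_right_mono K)
      also have "\<dots> = K * total_growth 0 n" unfolding sum_distrib_left[symmetric] X_total[OF z] by simp
      finally have "\<bar>t\<bar> / sqrt (real n) * \<bar>\<Sum>i=1..m. weight 0 n i * X 0 z i\<bar> \<le> \<bar>t\<bar> / sqrt (real n) * (K * total_growth 0 n)"
        by (intro mult_left_mono) auto
      then show ?thesis by (simp add: Y_def abs_mult)
    qed
    then show "eventually (\<lambda>n. norm (Y n z) \<le> \<bar>t\<bar> * K * (total_growth 0 n / sqrt (real n))) sequentially" by simp
  qed
  have "(\<lambda>n. mean 0 (\<lambda>z. iexp (Y n z))) \<longlonglongrightarrow> mean 0 (\<lambda>z. iexp 0)"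
    unfolding mean_def using card_states_pos[of 0] by (intro tendsto_intros Y) auto
  then have 1: "(\<lambda>n. mean 0 (\<lambda>z. iexp (Y n z))) \<longlonglongrightarrow> 1" by simp
  have "(\<lambda>n. complex_of_real (exp (- (t\<^sup>2 / 2 * ((\<Sum>k=1..n. variance_term k n) / real n))))) \<longlonglongrightarrow> of_real (exp (- (t\<^sup>2 / 2 * sigma2)))"
    by (intro tendsto_intros assms)
  from tendsto_mult[OF 1 this] have "(\<lambda>n. mean 0 (\<lambda>z. iexp (Y n z)) *
      of_real (exp (- (t\<^sup>2 / 2 * ((\<Sum>k=1..n. variance_term k n) / real n))))) \<longlonglongrightarrow> of_real (exp (- (t\<^sup>2 * sigma2 / 2)))"
    by simp
  moreover have "(t / sqrt (real n))\<^sup>2 / 2 * (\<Sum>l=Suc 0..n. variance_term l n) = t\<^sup>2 / 2 * ((\<Sum>k=1..n. variance_term k n) / real n)" for n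
    by (simp add: power_divide)
  ultimately show ?thesis unfolding hybrid_def Y_def by (simp only:)
qed

theorem urn_characteristic_function_tendsto:
  obtains sigma2 where "sigma2 \<ge> 0" "limit_variance = of_real sigma2"
    "\<And>t. (\<lambda>n. mean n (\<lambda>s. iexp (t * (((\<Sum>i=1..m. w i * X n s i) - drift * real (Suc n)) / sqrt (real n)))))
        \<longlonglongrightarrow> of_real (exp (- (t\<^sup>2 * sigma2 / 2)))"
proof -
  obtain sigma2 where s: "sigma2 \<ge> 0" "limit_variance = of_real sigma2"
    "(\<lambda>n. (\<Sum>k=1..n. variance_term k n) / real n) \<longlonglongrightarrow> sigma2"
    using limit_variance_real .
  have "(\<lambda>n. mean n (\<lambda>s. iexp (t * (((\<Sum>i=1..m. w i * X n s i) - drift * real (Suc n)) / sqrt (real n)))))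
        \<longlonglongrightarrow> of_real (exp (- (t\<^sup>2 * sigma2 / 2)))" for t
  proof -
    have "mean n (\<lambda>s. iexp (t * (((\<Sum>i=1..m. w i * X n s i) - drift * real (Suc n)) / sqrt (real n)))) = hybrid t n n" for n
    proof -
      have "(\<Sum>i=1..m. weight n n i * X n s i) = (\<Sum>i=1..m. w i * X n s i) - drift * real (Suc n)" if "s \<in> states n" for s
        unfolding X_total[OF that, symmetric] sum_distrib_left sum_subtractf[symmetric]
        by (intro sum.cong refl) (simp add: weight_final left_diff_distrib)
      then have "mean n (\<lambda>s. iexp (t / sqrt (real n) * (\<Sum>i=1..m. weight n n i * X n s i))) =
          mean n (\<lambda>s. iexp (t * (((\<Sum>i=1..m. w i * X n s i) - drift * real (Suc n)) / sqrt (real n))))"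
        by (intro mean_cong) simp
      then show ?thesis unfolding hybrid_def by simp
    qed
    then show ?thesis
      using tendsto_add[OF hybrid_difference_tendsto[of t] hybrid_initial_tendsto[OF s(3), of t]] by simp
  qed
  with s(1,2) show ?thesis by (rule that)
qed

end

end

section \<open>The roots of the characteristic equation\<close>

lemma prod_polar:
  fixes f :: "nat \<Rightarrow> complex"
  assumes "\<And>j. j \<in> I \<Longrightarrow> Re (f j) > 0"
  shows "prod f I = of_real (cmod (prod f I)) * cis (\<Sum>j\<in>I. arctan (Im (f j) / Re (f j)))"
  using assms
proof (induction I rule: infinite_finite_induct)
  case (insert i I)
  have "f i = rcis (cmod (f i)) (Arg (f i))" by (simp add: rcis_cmod_Arg)
  also have "Arg (f i) = arctan (Im (f i) / Re (f i))" using insert.prems by (intro arg_conv_arctan) auto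
  finally have fi: "f i = of_real (cmod (f i)) * cis (arctan (Im (f i) / Re (f i)))" by (simp add: rcis_def)
  have IH: "prod f I = of_real (cmod (prod f I)) * cis (\<Sum>j\<in>I. arctan (Im (f j) / Re (f j)))"
    using insert by auto
  have "prod f (insert i I) = f i * prod f I" using insert.hyps by simp
  also have "\<dots> = (of_real (cmod (f i)) * cis (arctan (Im (f i) / Re (f i)))) * (of_real (cmod (prod f I)) * cis (\<Sum>j\<in>I. arctan (Im (f j) / Re (f j))))"
    using fi IH by (rule arg_cong2[where f = "(*)"])
  also have "\<dots> = of_real (cmod (prod f (insert i I))) * cis (\<Sum>j\<in>insert i I. arctan (Im (f j) / Re (f j)))"
    using insert.hyps by (simp add: norm_mult cis_mult[symmetric] mult_ac)
  finally show ?case .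
qed auto

text \<open>Exact multiplication of Gaussian integers, kept as pairs so that products can be evaluated by rewriting.\<close>

fun gaussian_times :: "int \<times> int \<Rightarrow> int \<times> int \<Rightarrow> int \<times> int" where
  "gaussian_times (a, b) (c, d) = (a * c - b * d, a * d + b * c)"

text \<open>The product of the numbers \<open>j + 1 / 2 + y * \<i>\<close> for \<open>j \<le> n\<close> at the height \<open>y = 551 / 250\<close>, each factor multiplied
by \<open>250\<close>. The height lies just above the one, about \<open>2.2034\<close>, at which the modulus of the product of \<open>25\<close> factors
equals \<open>26!\<close>; the argument of the product is there still below \<open>2 * pi\<close>, by less than \<open>0.01\<close>.\<close>

fun scaled_product :: "nat \<Rightarrow> int \<times> int" where
  "scaled_product 0 = (1, 0)"
| "scaled_product (Suc n) = gaussian_times (125 * (2 * int n + 3), 551) (scaled_product n)"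

lemma scaled_product_eq:
  "(\<Prod>j=1..n. Complex (real j + 1 / 2) (551 / 250)) * of_real (250 ^ n) =
     Complex (of_int (fst (scaled_product n))) (of_int (snd (scaled_product n)))"
proof (induction n)
  case (Suc n)
  obtain r i where ri: "scaled_product n = (r, i)" by fastforce
  define P where "P = (\<Prod>j=1..n. Complex (real j + 1 / 2) (551 / 250)) * of_real (250 ^ n)"
  have P: "P = Complex (of_int r) (of_int i)" using Suc by (simp add: P_def ri)
  have "(\<Prod>j=1..Suc n. Complex (real j + 1 / 2) (551 / 250)) * of_real (250 ^ Suc n)
     = P * (Complex (real (Suc n) + 1 / 2) (551 / 250) * of_real 250)"
    by (simp add: P_def mult_ac)
  also have "\<dots> = Complex (of_int (fst (scaled_product (Suc n)))) (of_int (snd (scaled_product (Suc n))))"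
    unfolding P by (simp add: ri complex_eq_iff algebra_simps)
  finally show ?case .
qed (simp add: complex_eq_iff)

lemma scaled_product_25:
  "snd (scaled_product 25) < 0" 
  "62500 ^ 25 * (fact 26)\<^sup>2 < (fst (scaled_product 25))\<^sup>2 + (snd (scaled_product 25))\<^sup>2"
  by (simp_all add: eval_nat_numeral fact_numeral)

text \<open>The bound \<open>arctan x \<le> x\<close> already confines the total argument to \<open>[0, 3 * pi)\<close>. There a negative sine leaves only the
interval between \<open>pi\<close> and \<open>2 * pi\<close>, and the sign of the sine is the sign of the imaginary part of the exact product.\<close>

lemma total_argument_less_two_pi: "(\<Sum>j=1..25. arctan ((551 / 250) / (real j + 1 / 2))) < 2 * pi"
proof -
  define S where "S = (\<Sum>j=1..25. arctan ((551 / 250) / (real j + 1 / 2)))"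
  define P where "P = (\<Prod>j=1..25. Complex (real j + 1 / 2) (551 / 250))"
  have "P = of_real (cmod P) * cis S"
    unfolding P_def S_def by (subst prod_polar) auto
  then have "Im P = Im (of_real (cmod P) * cis S)" by (rule arg_cong)
  then have Im_P: "Im P = cmod P * sin S" by simp
  have "P * of_real (250 ^ 25) = Complex (of_int (fst (scaled_product 25))) (of_int (snd (scaled_product 25)))"
    unfolding P_def by (rule scaled_product_eq)
  then have "Im (P * of_real (250 ^ 25)) = of_int (snd (scaled_product 25))" by (simp only: complex.sel)
  then have "Im P * 250 ^ 25 = of_int (snd (scaled_product 25))" by simp
  also have "\<dots> < 0" using scaled_product_25(1) by (simp only: of_int_less_0_iff)
  finally have sin_neg: "sin S < 0" unfolding Im_P by (simp add: mult_less_0_iff)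
  have "S \<le> (\<Sum>j=1..25. (551 / 250) / (real j + 1 / 2))"
    unfolding S_def by (intro sum_mono arctan_le_self) auto
  also have "\<dots> < 9" by (simp add: sum.atLeast_Suc_atMost)
  finally have S9: "S < 3 * pi" using pi_gt3 by linarith
  show ?thesis
  proof (rule ccontr)
    assume "\<not> ?thesis"
    then have "0 \<le> sin (S - 2 * pi)" using S9 unfolding S_def[symmetric] by (intro sin_ge_zero) auto
    then show False using sin_neg by (simp add: sin_diff)
  qed
qed

lemma prod_shift_fact: "m \<ge> 1 \<Longrightarrow> (\<Prod>j=1..m-1. real j + 1) = fact m"
proof -
  have "(\<Prod>j=1..n. real j + 1) = fact (Suc n)" for n
    by (induction n) (auto simp: algebra_simps)
  from this[of "m - 1"] show "m \<ge> 1 \<Longrightarrow> ?thesis" by simp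
qed

text \<open>One evaluation, at \<open>m = 26\<close>, covers all \<open>m\<close>: divided by \<open>fact m\<close> squared, the product has the factors \<open>f j\<close>, which are
at least \<open>1\<close> for \<open>j \<le> 4\<close> and at most \<open>1\<close> afterwards. As a function of \<open>m\<close> the quotient first increases and then
decreases, so that on \<open>2 \<le> m \<le> 26\<close> it is smallest at one of the ends.\<close>

lemma modulus_product_gt:
  assumes "2 \<le> m" "m \<le> 26"
  shows "(\<Prod>j=1..m-1. (real j + 1 / 2)\<^sup>2 + (551 / 250)\<^sup>2) > (fact m)\<^sup>2"
proof -
  define f where "f j = ((real j + 1 / 2)\<^sup>2 + (551 / 250)\<^sup>2) / (real j + 1)\<^sup>2" for j
  have f: "f j = 1 + ((551 / 250)\<^sup>2 - 3 / 4 - real j) / (real j + 1)\<^sup>2" for j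
    by (simp add: f_def divide_simps) (simp add: power2_eq_square algebra_simps)
  have ge: "f j \<ge> 1" if "j \<le> 4" for j
    using that unfolding f by (simp add: power2_eq_square)
  have le: "f j \<le> 1" if "j \<ge> 5" for j
    using that unfolding f by (simp add: power2_eq_square divide_nonpos_nonneg)
  have f0: "f j \<ge> 0" for j by (simp add: f_def)
  have "(\<Prod>j=1..m-1. f j) > 1"
  proof (cases "m \<le> 5")
    case True
    have "1 < f 1" by (simp add: f_def power2_eq_square)
    moreover have "1 \<le> (\<Prod>j=2..m-1. f j)" using True by (intro prod_ge_1 ge) auto
    ultimately have "1 * 1 < f 1 * (\<Prod>j=2..m-1. f j)"
      by (intro mult_less_le_imp_less) auto
    then have "1 < f 1 * (\<Prod>j=2..m-1. f j)" by simp
    also have "\<dots> = (\<Prod>j=1..m-1. f j)" using assms by (subst (2) prod.atLeast_Suc_atMost) (auto simp: numeral_2_eq_2)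
    finally show ?thesis .
  next
    case False
    define P where "P = (\<Prod>j=1..25. Complex (real j + 1 / 2) (551 / 250))"
    have P2: "(cmod P)\<^sup>2 = (\<Prod>j=1..25. (real j + 1 / 2)\<^sup>2 + (551 / 250)\<^sup>2)"
      unfolding P_def by (simp only: prod_norm[symmetric] prod_power_distrib cmod_power2 complex.sel)
    have "P * of_real (250 ^ 25) = Complex (of_int (fst (scaled_product 25))) (of_int (snd (scaled_product 25)))"
      unfolding P_def by (rule scaled_product_eq)
    then have "(cmod (P * of_real (250 ^ 25)))\<^sup>2 = of_int ((fst (scaled_product 25))\<^sup>2 + (snd (scaled_product 25))\<^sup>2)"
      by (simp only: cmod_power2 complex.sel of_int_add of_int_power)
    also have "\<dots> > of_int (62500 ^ 25 * (fact 26)\<^sup>2)"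
      using scaled_product_25(2) by (simp only: of_int_less_iff)
    finally have "(fact 26)\<^sup>2 < (cmod P)\<^sup>2"
      by (simp add: norm_mult power_mult_distrib)
    moreover have "(\<Prod>j=1..25. f j) = (\<Prod>j=1..25. (real j + 1 / 2)\<^sup>2 + (551 / 250)\<^sup>2) / (\<Prod>j=1..26-1. real j + 1)\<^sup>2"
      unfolding f_def prod_dividef prod_power_distrib by simp
    moreover have "(\<Prod>j=1..26-1. real j + 1) = fact 26" by (rule prod_shift_fact) simp
    ultimately have "1 < (\<Prod>j=1..25. f j)"
      by (simp only: P2[symmetric]) (simp add: less_divide_eq)
    also have "{1..25::nat} = {1..m-1} \<union> {m..25}" using assms by auto
    also have "(\<Prod>j\<in>{1..m-1} \<union> {m..25}. f j) = (\<Prod>j=1..m-1. f j) * (\<Prod>j=m..25. f j)"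
      by (intro prod.union_disjoint) auto
    also have "\<dots> \<le> (\<Prod>j=1..m-1. f j) * 1"
      using False by (intro mult_left_mono prod_le_1 prod_nonneg) (auto intro: le f0)
    finally show ?thesis by simp
  qed
  also have "(\<Prod>j=1..m-1. f j) = (\<Prod>j=1..m-1. (real j + 1 / 2)\<^sup>2 + (551 / 250)\<^sup>2) / (\<Prod>j=1..m-1. real j + 1)\<^sup>2"
    by (simp add: f_def prod_dividef prod_power_distrib)
  also have "(\<Prod>j=1..m-1. real j + 1) = fact m" using assms by (intro prod_shift_fact) simp
  finally show ?thesis by simp
qed

text \<open>At a root the modulus of the product is \<open>m!\<close>, so the height of the root is below \<open>551 / 250\<close>; then the arguments of the
factors add up to less than \<open>2 * pi\<close>. As the product is positive, the sum of the arguments is \<open>0\<close>, and the root is real.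
On the positive axis the product is strictly increasing.\<close>

lemma half_plane_root_upper:
  assumes m: "2 \<le> m" "m \<le> 26" and root: "(\<Prod>j=1..m-1. z + of_nat j) = fact m"
    and re: "Re z \<ge> 1 / 2" and im: "Im z \<ge> 0"
  shows "z = 1"
proof -
  define x where "x = Re z"
  define y where "y = Im z"
  have xy: "x \<ge> 1 / 2" "y \<ge> 0" using re im by (auto simp: x_def y_def)
  have y_less: "y < 551 / 250"
  proof (rule ccontr)
    assume "\<not> y < 551 / 250"
    then have y: "551 / 250 \<le> y" by simp
    have "(fact m)\<^sup>2 < (\<Prod>j=1..m-1. (real j + 1 / 2)\<^sup>2 + (551 / 250)\<^sup>2)"
      using m by (rule modulus_product_gt)
    also have "\<dots> \<le> (\<Prod>j=1..m-1. (cmod (z + of_nat j))\<^sup>2)"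
    proof (intro prod_mono conjI)
      fix j
      have "(real j + 1 / 2)\<^sup>2 \<le> (x + real j)\<^sup>2" using xy by (intro power_mono) auto
      moreover have "(551 / 250)\<^sup>2 \<le> y\<^sup>2" using y by (intro power_mono) auto
      ultimately show "(real j + 1 / 2)\<^sup>2 + (551 / 250)\<^sup>2 \<le> (cmod (z + of_nat j))\<^sup>2"
        by (simp add: cmod_power2 x_def y_def)
    qed auto
    also have "\<dots> = (cmod (\<Prod>j=1..m-1. z + of_nat j))\<^sup>2"
      by (simp add: prod_norm[symmetric] prod_power_distrib)
    also have "\<dots> = (fact m)\<^sup>2" unfolding root by simp
    finally show False by simp
  qed
  define Th where "Th = (\<Sum>j=1..m-1. arctan (y / (x + real j)))"
  have "(\<Prod>j=1..m-1. z + of_nat j) = of_real (cmod (\<Prod>j=1..m-1. z + of_nat j)) * cis (\<Sum>j=1..m-1. arctan (Im (z + of_nat j) / Re (z + of_nat j)))"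
    using re by (intro prod_polar) auto
  then have "fact m = of_real (fact m) * cis Th"
    unfolding root by (simp add: Th_def x_def y_def)
  then have "cis Th = 1" by simp
  then have "cos Th = 1" by (metis cis.sel(1) one_complex.sel(1))
  then obtain n :: int where n: "Th = of_int n * 2 * pi" using cos_one_2pi_int by auto
  have Th0: "Th \<ge> 0" unfolding Th_def using xy by (intro sum_nonneg) auto
  have "Th \<le> (\<Sum>j=1..m-1. arctan ((551 / 250) / (real j + 1 / 2)))"
    unfolding Th_def using xy y_less by (intro sum_mono arctan_monotone' frac_le) auto
  also have "\<dots> \<le> (\<Sum>j=1..25. arctan ((551 / 250) / (real j + 1 / 2)))"
    using m by (intro sum_mono2) auto
  also have "\<dots> < 2 * pi" by (rule total_argument_less_two_pi)
  finally have "of_int n * (2 * pi) < 1 * (2 * pi)" using n by simp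
  then have "n < 1" by (simp add: mult_less_cancel_right_pos)
  moreover have "n \<ge> 0" using n Th0 pi_gt_zero by (simp add: zero_le_mult_iff)
  ultimately have "Th = 0" using n by simp
  then have "\<forall>j\<in>{1..m-1}. arctan (y / (x + real j)) = 0"
    unfolding Th_def using xy by (subst (asm) sum_nonneg_eq_0_iff) auto
  then have "arctan (y / (x + real 1)) = 0" using m by force
  then have "y = 0" using xy by (simp add: arctan_eq_zero_iff)
  then have z: "z = of_real x" by (simp add: complex_eq_iff x_def y_def)
  have "complex_of_real (\<Prod>j=1..m-1. x + real j) = of_real (fact m)"
    using root unfolding z by simp
  then have real_root: "(\<Prod>j=1..m-1. x + real j) = (\<Prod>j=1..m-1. real j + 1)"
    using prod_shift_fact[of m] m by (simp only: of_real_eq_iff)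
  have "x = 1"
  proof (rule ccontr)
    assume "x \<noteq> 1"
    then consider "x < 1" | "x > 1" by linarith
    then show False
    proof cases
      case 1
      have "(\<Prod>j=1..m-1. x + real j) < (\<Prod>j=1..m-1. real j + 1)"
        using 1 xy m by (intro prod_mono_strict) auto
      then show False using real_root by simp
    next
      case 2
      have "(\<Prod>j=1..m-1. real j + 1) < (\<Prod>j=1..m-1. x + real j)"
        using 2 xy m by (intro prod_mono_strict) auto
      then show False using real_root by simp
    qed
  qed
  then show ?thesis using z by simp
qed

lemma half_plane_root:
  assumes m: "2 \<le> m" "m \<le> 26" and root: "(\<Prod>j=1..m-1. z + of_nat j) = fact m" and re: "Re z \<ge> 1 / 2"
  shows "z = 1"
proof (cases "Im z \<ge> 0")
  case False
  have "(\<Prod>j=1..m-1. cnj z + of_nat j) = cnj (\<Prod>j=1..m-1. z + of_nat j)" by simp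
  also have "\<dots> = fact m" unfolding root by simp
  finally have "cnj z = 1" using m re False by (intro half_plane_root_upper) auto
  then show ?thesis by (metis complex_cnj_cnj complex_cnj_one)
qed (use half_plane_root_upper assms in blast)

section \<open>The spectrum of the gap urn\<close>

lemma sum_unit_vector:
  "a \<in> {1..m} \<Longrightarrow> (\<Sum>l=1..m. f l * unit_vector a l) = f a"
  by (simp add: unit_vector_def if_distrib[of "\<lambda>x. _ * x"] cong: if_cong)

lemma sum_gap_xi_less:
  assumes "1 \<le> i" "i < m"
  shows "(\<Sum>l=1..m. f l * gap_xi m i l) = - of_nat i * f i + of_nat (i + 1) * f (i + 1)"
proof -
  have "(\<Sum>l=1..m. f l * gap_xi m i l) =
      - of_nat i * (\<Sum>l=1..m. f l * unit_vector i l) + of_nat (i + 1) * (\<Sum>l=1..m. f l * unit_vector (i + 1) l)"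
    using assms unfolding gap_xi_def sum_distrib_left sum.distrib[symmetric]
    by (intro sum.cong refl) (simp add: algebra_simps)
  then show ?thesis using assms by (simp add: sum_unit_vector del: One_nat_def)
qed

lemma sum_gap_xi_last:
  assumes "2 \<le> m"
  shows "(\<Sum>l=1..m. f l * gap_xi m m l) = - of_nat m * f m + (of_nat m - 1) * f 1 + 2 * f 2"
proof -
  have "(\<Sum>l=1..m. f l * gap_xi m m l) =
      - of_nat m * (\<Sum>l=1..m. f l * unit_vector m l) + (of_nat m - 1) * (\<Sum>l=1..m. f l * unit_vector 1 l)
       + 2 * (\<Sum>l=1..m. f l * unit_vector 2 l)"
    using assms unfolding gap_xi_def sum_distrib_left sum.distrib[symmetric]
    by (intro sum.cong refl) (simp add: algebra_simps)
  then show ?thesis using assms by (simp add: sum_unit_vector del: One_nat_def)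
qed

text \<open>All rows but the second. In the equations for the eigenvalue \<open>1\<close> that one follows from them, as every column has
the sum \<open>1\<close>.\<close>

lemma gap_row:
  assumes m: "3 \<le> m"
  shows "(\<Sum>l=1..m. gap_xi m l 1 * x l) = - x 1 + (of_nat m - 1) * x m"
    and "\<And>k. 3 \<le> k \<Longrightarrow> k \<le> m \<Longrightarrow> (\<Sum>l=1..m. gap_xi m l k * x l) = of_nat k * x (k - 1) - of_nat k * x k"
proof -
  have split: "(\<Sum>l=1..m. gap_xi m l k * x l) = (\<Sum>l=1..<m. gap_xi m l k * x l) + gap_xi m m k * x m" for k
  proof -
    have "{1..m} = insert m {1..<m}" using m by auto
    then show ?thesis by (simp add: add.commute)
  qed
  have front: "(\<Sum>l=1..<m. gap_xi m l k * x l) =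
      (\<Sum>l=1..<m. if l = k then - of_nat k * x k else 0) + (\<Sum>l=1..<m. if l = k - 1 \<and> k \<ge> 1 then of_nat k * x (k - 1) else 0)" for k
    unfolding sum.distrib[symmetric] by (intro sum.cong refl) (auto simp: gap_xi_def unit_vector_def)
  show "(\<Sum>l=1..m. gap_xi m l 1 * x l) = - x 1 + (of_nat m - 1) * x m"
    unfolding split front using m by (simp add: gap_xi_def unit_vector_def)
  fix k assume k: "3 \<le> k" "k \<le> m"
  then have "k - 1 \<in> {1..<m}" by auto
  then have "(\<Sum>l=1..<m. if l = k - 1 \<and> k \<ge> 1 then of_nat k * x (k - 1) else 0) = of_nat k * x (k - 1)"
    using k by simp
  moreover have "(\<Sum>l=1..<m. if l = k then - of_nat k * x k else 0) + gap_xi m m k * x m = - of_nat k * x k"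
    using k by (cases "k = m") (auto simp: gap_xi_def unit_vector_def)
  ultimately show "(\<Sum>l=1..m. gap_xi m l k * x l) = of_nat k * x (k - 1) - of_nat k * x k"
    unfolding split front by (simp add: algebra_simps)
qed

lemma harm_minus_one_pos: "m \<ge> 2 \<Longrightarrow> harm m - 1 > (0::real)"
proof -
  assume "m \<ge> 2"
  then have "harm 2 \<le> (harm m :: real)" by (rule harm_mono)
  moreover have "harm 2 = (3 / 2 :: real)" by (simp add: harm_def numeral_2_eq_2)
  ultimately show ?thesis by simp
qed

text \<open>The right eigenvector for the eigenvalue \<open>1\<close>, with entries adding up to \<open>1\<close>: the limiting composition.\<close>

definition gap_stationary :: "nat \<Rightarrow> nat \<Rightarrow> real" where
  "gap_stationary m k = (if k = 1 then (real m - 1) / (2 * (real m + 1)) else 1 / (real k + 1)) / (harm m - 1)"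

lemma sum_inverse_Suc: "m \<ge> 1 \<Longrightarrow> (\<Sum>k=2..m. 1 / (real k + 1)) = harm m + 1 / (real m + 1) - 3 / 2"
proof (induction m rule: dec_induct)
  case base
  then show ?case by (simp add: harm_def)
next
  case (step m)
  have "(\<Sum>k=2..Suc m. 1 / (real k + 1)) = (\<Sum>k=2..m. 1 / (real k + 1)) + 1 / (real (Suc m) + 1)"
    by (subst sum.cl_ivl_Suc) (use step in simp)
  then show ?case using step.IH by (simp add: harm_Suc inverse_eq_divide add_ac)
qed

lemma sum_telescope_inverse: "m \<ge> 1 \<Longrightarrow> (\<Sum>k=2..m. 1 / (real k * (real k + 1))) = (real m - 1) / (2 * (real m + 1))"
proof (induction m rule: dec_induct)
  case (step m)
  have "(\<Sum>k=2..Suc m. 1 / (real k * (real k + 1))) = (\<Sum>k=2..m. 1 / (real k * (real k + 1))) + 1 / (real (Suc m) * (real (Suc m) + 1))"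
    by (subst sum.cl_ivl_Suc) (use step in simp)
  also have "\<dots> = (real (Suc m) - 1) / (2 * (real (Suc m) + 1))"
  proof -
    define a where "a = real m"
    have a: "real (Suc m) = a + 1" "real m = a" "a + 1 \<noteq> 0" "a + 1 + 1 \<noteq> 0" by (auto simp: a_def)
    show ?thesis unfolding step.IH a(1,2) using a(3,4) by (simp add: divide_simps) (simp add: algebra_simps)
  qed
  finally show ?case .
qed simp

lemma mu_L_eq: "m \<ge> 1 \<Longrightarrow> mu_L m = 1 / (harm m - 1) * ((real m - 1) / (2 * (real m + 1)))"
  by (simp add: mu_L_def sum_telescope_inverse)

lemma mu_L_stationary:
  "m \<ge> 1 \<Longrightarrow> (\<Sum>i=2..m. 1 / real i * gap_stationary m i) = mu_L m"
  by (simp add: mu_L_def gap_stationary_def sum_divide_distrib divide_simps) (simp add: mult_ac)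

locale gap_spectrum =
  fixes m :: nat and lam :: "nat \<Rightarrow> complex" and u v :: "nat \<Rightarrow> nat \<Rightarrow> complex"
  assumes m3: "3 \<le> m"
    and eigen: "dual_eigenbases m (gap_A m) lam u v"
    and lam1: "lam 1 = 1"
    and normalised: "(\<Sum>i=1..m. v 1 i) = 1"
begin

lemma left: "j \<in> {1..m} \<Longrightarrow> i \<in> {1..m} \<Longrightarrow> (\<Sum>l=1..m. u j l * gap_xi m i l) = lam j * u j i"
  and right: "j \<in> {1..m} \<Longrightarrow> k \<in> {1..m} \<Longrightarrow> (\<Sum>l=1..m. gap_xi m l k * v j l) = lam j * v j k"
  and dual: "i \<in> {1..m} \<Longrightarrow> j \<in> {1..m} \<Longrightarrow> (\<Sum>k=1..m. u i k * v j k) = (if i = j then 1 else 0)"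
  using eigen unfolding dual_eigenbases_def gap_A_def by auto

text \<open>A left inverse of a square matrix is a right inverse.\<close>

lemma complete:
  assumes "r \<in> {1..m}" "c \<in> {1..m}"
  shows "(\<Sum>j=1..m. v j r * u j c) = (if r = c then 1 else 0)"
proof -
  define P where "P = Matrix.mat m m (\<lambda>(i, k). u (Suc i) (Suc k))"
  define Q where "Q = Matrix.mat m m (\<lambda>(k, j). v (Suc j) (Suc k))"
  have shift: "(\<Sum>k = 0..<m. f (Suc k)) = (\<Sum>k=1..m. f k)" for f :: "nat \<Rightarrow> complex"
    by (rule sum.reindex_bij_witness[of _ "\<lambda>k. k - 1" Suc]) auto
  have PQ: "P * Q = 1\<^sub>m m"
  proof (rule eq_matI)
    fix i j assume "i < dim_row (1\<^sub>m m)" "j < dim_col (1\<^sub>m m)"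
    then have ij: "i < m" "j < m" by auto
    have "(P * Q) $$ (i, j) = (\<Sum>k = 0..<m. u (Suc i) (Suc k) * v (Suc j) (Suc k))"
      using ij by (simp add: P_def Q_def scalar_prod_def)
    also have "\<dots> = (\<Sum>k=1..m. u (Suc i) k * v (Suc j) k)" by (rule shift)
    also have "\<dots> = 1\<^sub>m m $$ (i, j)" using ij dual[of "Suc i" "Suc j"] by simp
    finally show "(P * Q) $$ (i, j) = 1\<^sub>m m $$ (i, j)" .
  qed (auto simp: P_def Q_def)
  have "Q * P = 1\<^sub>m m"
    by (rule mat_mult_left_right_inverse[OF _ _ PQ]) (auto simp: P_def Q_def)
  moreover have "(Q * P) $$ (r - 1, c - 1) = (\<Sum>k = 0..<m. v (Suc k) r * u (Suc k) c)"
  proof -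
    have "r - 1 < m" "c - 1 < m" "Suc (r - 1) = r" "Suc (c - 1) = c" using assms by auto
    then show ?thesis by (simp add: P_def Q_def scalar_prod_def del: One_nat_def)
  qed
  moreover have "\<dots> = (\<Sum>j=1..m. v j r * u j c)" by (rule shift)
  ultimately have "(\<Sum>j=1..m. v j r * u j c) = 1\<^sub>m m $$ (r - 1, c - 1)" by simp
  also have "\<dots> = (if r = c then 1 else 0)" using assms by auto
  finally show ?thesis .
qed

lemma u_step:
  assumes "j \<in> {1..m}" "1 \<le> k" "k < m"
  shows "of_nat (Suc k) * u j (Suc k) = (lam j + of_nat k) * u j k"
  using left[of j k] sum_gap_xi_less[of k m "u j"] assms by (simp add: algebra_simps)

text \<open>The first \<open>m - 1\<close> coordinates of the eigenvector equation form a recursion, so a left eigenvector is determined by its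
eigenvalue and its first entry.\<close>

lemma u_explicit:
  assumes "j \<in> {1..m}" "1 \<le> k" "k \<le> m"
  shows "fact k * u j k = (\<Prod>i=1..k-1. lam j + of_nat i) * u j 1"
  using assms(2,3)
proof (induction k rule: dec_induct)
  case (step k)
  have "fact (Suc k) * u j (Suc k) = fact k * (of_nat (Suc k) * u j (Suc k))" by (simp add: mult_ac)
  also have "\<dots> = (lam j + of_nat k) * (fact k * u j k)"
    using step assms(1) by (subst u_step) (auto simp: mult_ac)
  also have "\<dots> = (\<Prod>i=1..k. lam j + of_nat i) * u j 1"
  proof -
    have "{1..k} = insert k {1..k-1}" using step by auto
    then show ?thesis using step by (simp add: mult_ac)
  qed
  finally show ?case by simp
qed simp

lemma u_first_nonzero:
  assumes "j \<in> {1..m}"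
  shows "u j 1 \<noteq> 0"
proof
  assume "u j 1 = 0"
  then have "u j k = 0" if "k \<in> {1..m}" for k
    using u_explicit[OF assms, of k] that by simp
  then have "(\<Sum>k=1..m. u j k * v j k) = 0" by simp
  then show False using dual[OF assms assms] by simp
qed

text \<open>For the eigenvalue \<open>1\<close> the recursion makes \<open>u j\<close> constant, so \<open>u j \<bullet> v 1\<close> is a nonzero multiple of the sum of the
entries of \<open>v 1\<close>, and duality leaves only \<open>j = 1\<close>.\<close>

lemma eigenvalue_one:
  assumes j: "j \<in> {1..m}" and l: "lam j = 1"
  shows "j = 1" "\<And>k. k \<in> {1..m} \<Longrightarrow> u j k = 1"
proof -
  have const: "u j k = u j 1" if "k \<in> {1..m}" for k
  proof -
    have "1 \<le> k" "k \<le> m" using that by auto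
    then show ?thesis
    proof (induction k rule: dec_induct)
      case (step k)
      then have "of_nat (Suc k) * u j (Suc k) = of_nat (Suc k) * u j k"
        using u_step[OF j, of k] l by (simp add: add.commute)
      then have "u j (Suc k) = u j k" by (simp only: mult_cancel_left of_nat_eq_0_iff) simp
      then show ?case using step by simp
    qed simp
  qed
  have "(\<Sum>k=1..m. u j k * v 1 k) = u j 1 * (\<Sum>k=1..m. v 1 k)"
    unfolding sum_distrib_left by (intro sum.cong refl) (metis const)
  then have *: "u j 1 = (if j = 1 then 1 else 0)"
    using dual[of j 1] j m3 normalised by simp
  with u_first_nonzero[OF j] show "j = 1" by (simp split: if_splits)
  with * show "u j k = 1" if "k \<in> {1..m}" for k using const[OF that] by simp
qed

lemma u_one: "k \<in> {1..m} \<Longrightarrow> u 1 k = 1"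
  using eigenvalue_one(2)[of 1 k] lam1 m3 by simp

text \<open>The last coordinate of the eigenvector equation reads \<open>(\<lambda> + m) * (u m - u 1) = 0\<close>.\<close>

lemma characteristic_equation:
  assumes j: "j \<in> {1..m}"
  shows "lam j = - of_nat m \<or> (\<Prod>i=1..m-1. lam j + of_nat i) = fact m"
proof -
  have "- of_nat m * u j m + (of_nat m - 1) * u j 1 + 2 * u j 2 = lam j * u j m"
    using left[OF j, of m] sum_gap_xi_last[of m "u j"] m3 by simp
  moreover have "2 * u j 2 = (lam j + 1) * u j 1"
    using u_step[OF j, of 1] m3 by (simp add: numeral_2_eq_2)
  ultimately have "(lam j + of_nat m) * (u j m - u j 1) = 0" by (simp add: algebra_simps)
  then consider "lam j + of_nat m = 0" | "u j m = u j 1" by auto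
  then show ?thesis
  proof cases
    case 1
    then show ?thesis by (simp add: eq_neg_iff_add_eq_0)
  next
    case 2
    then have "fact m * u j 1 = (\<Prod>i=1..m-1. lam j + of_nat i) * u j 1"
      using u_explicit[OF j, of m] m3 by simp
    then show ?thesis using u_first_nonzero[OF j] by simp
  qed
qed

lemma Re_eigenvalue_less_half:
  assumes "m \<le> 26" "j \<in> {2..m}"
  shows "Re (lam j) < 1 / 2"
proof (rule ccontr)
  assume c: "\<not> Re (lam j) < 1 / 2"
  then have "lam j \<noteq> - of_nat m" using m3 by auto
  then have "(\<Prod>i=1..m-1. lam j + of_nat i) = fact m"
    using characteristic_equation[of j] assms by auto
  then have "lam j = 1" using half_plane_root[of m "lam j"] m3 assms c by simp
  then show False using eigenvalue_one(1)[of j] assms by simp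
qed

lemma v_one:
  assumes "k \<in> {1..m}"
  shows "v 1 k = of_real (gap_stationary m k)"
proof -
  \<comment> \<open>The rows \<open>k \<ge> 3\<close> say that \<open>(k + 1) * v 1 k\<close> does not depend on \<open>k \<ge> 2\<close>.\<close>
  define kap where "kap = 3 * v 1 2"
  have row: "(\<Sum>l=1..m. gap_xi m l k * v 1 l) = v 1 k" if "k \<in> {1..m}" for k
    using right[of 1 k] that m3 lam1 by simp
  have tail: "of_nat (Suc k) * v 1 k = kap" if "2 \<le> k" "k \<le> m" for k
    using that
  proof (induction k rule: dec_induct)
    case base
    then show ?case by (simp add: kap_def)
  next
    case (step k)
    have "of_nat (Suc k) * v 1 k - of_nat (Suc k) * v 1 (Suc k) = v 1 (Suc k)"
      using gap_row(2)[OF m3, of "Suc k" "v 1"] row[of "Suc k"] step by simp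
    then show ?case using step by (simp add: algebra_simps)
  qed
  have v_tail: "v 1 k = kap / of_nat (Suc k)" if "2 \<le> k" "k \<le> m" for k
    using tail[OF that] by (simp add: field_simps del: of_nat_Suc)
  have v1: "v 1 1 = kap * of_real ((real m - 1) / (2 * (real m + 1)))"
  proof -
    have "- v 1 1 + (of_nat m - 1) * v 1 m = v 1 1" using gap_row(1)[OF m3, of "v 1"] row[of 1] m3 by simp
    then have "v 1 1 = (of_nat m - 1) * v 1 m / 2" by (simp add: field_simps)
    also have "v 1 m = kap / of_nat (Suc m)" using v_tail[of m] m3 by simp
    finally have "v 1 1 = (of_nat m - 1) * (kap / of_nat (Suc m)) / 2" .
    moreover have "complex_of_real ((real m - 1) / (2 * (real m + 1))) = (of_nat m - 1) / (2 * of_nat (Suc m))"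
      by (simp add: add.commute)
    ultimately show ?thesis by (simp only: times_divide_eq_right times_divide_eq_left divide_divide_eq_left mult_ac)
  qed
  have "1 = v 1 1 + (\<Sum>i=2..m. v 1 i)"
    using normalised m3 by (simp add: sum.atLeast_Suc_atMost numeral_2_eq_2)
  also have "(\<Sum>i=2..m. v 1 i) = kap * of_real (\<Sum>i=2..m. 1 / (real i + 1))"
    unfolding of_real_sum sum_distrib_left by (intro sum.cong refl) (simp add: v_tail add.commute del: One_nat_def)
  finally have "1 = kap * of_real ((real m - 1) / (2 * (real m + 1)) + (\<Sum>i=2..m. 1 / (real i + 1)))"
    unfolding v1 by (simp only: distrib_left of_real_add)
  also have "(real m - 1) / (2 * (real m + 1)) + (\<Sum>i=2..m. 1 / (real i + 1)) = harm m - 1"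
  proof -
    have "(real m - 1) / (2 * (real m + 1)) = 1 / 2 - 1 / (real m + 1)"
    proof -
      define a where "a = real m + 1"
      have "real m - 1 = a - 2" "a \<noteq> 0" by (auto simp: a_def)
      then have "(real m - 1) / (2 * a) = 1 / 2 - 1 / a" by (simp only: diff_divide_distrib) simp
      then show ?thesis unfolding a_def .
    qed
    then show ?thesis using sum_inverse_Suc[of m] m3 by simp
  qed
  finally have kap: "kap = of_real (1 / (harm m - 1))"
    using harm_minus_one_pos[of m] m3 by (simp add: field_simps of_real_diff[symmetric] del: of_real_diff)
  show ?thesis
  proof (cases "k = 1")
    case True
    then show ?thesis using v1 unfolding kap by (simp add: gap_stationary_def)
  next
    case False
    then show ?thesis using v_tail[of k] assms unfolding kap by (simp add: gap_stationary_def add.commute)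
  qed
qed

lemma gap_stationary_nonneg: "gap_stationary m k \<ge> 0"
  using harm_minus_one_pos[of m] m3 by (simp add: gap_stationary_def)

end

section \<open>Gaps of search trees\<close>

lemma insort_map_strict_mono_on:
  assumes "strict_mono_on (insert x (set ks)) f"
  shows "insort (f x) (map f ks) = map f (insort x ks)"
  using assms
proof (induction ks)
  case (Cons k ks)
  have "f x \<le> f k \<longleftrightarrow> x \<le> k"
    using Cons.prems by (intro strict_mono_on_less_eq) auto
  moreover have "strict_mono_on (insert x (set ks)) f"
    using Cons.prems by (rule monotone_on_subset) auto
  ultimately show ?case using Cons.IH by simp
qed simp

lemma set_mst_insert: "set_mtree (mst_insert m x T) \<subseteq> insert x (set_mtree T)"
proof (induction T)
  case (Node ks ts)
  then show ?case by (fastforce simp: set_insort_key Let_def split: if_splits)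
qed auto

lemma mst_append [simp]: "mst m (xs @ [x]) = mst_insert m x (mst m xs)"
  by (simp add: mst_def)

lemma mst_Nil [simp]: "mst m [] = External"
  by (simp add: mst_def)

lemma set_mst: "set_mtree (mst m xs) \<subseteq> set xs"
proof (induction xs rule: rev_induct)
  case (snoc x xs)
  then show ?case using set_mst_insert[of m x "mst m xs"] by auto
qed simp

lemma mst_insert_map:
  assumes "strict_mono_on (insert x (set_mtree T)) f"
  shows "mst_insert m (f x) (map_mtree f T) = map_mtree f (mst_insert m x T)"
  using assms
proof (induction T)
  case (Node ks ts)
  have mono: "strict_mono_on (insert x (set ks)) f"
    using Node.prems by (rule monotone_on_subset) auto
  then have ins: "insort (f x) (map f ks) = map f (insort x ks)" by (rule insort_map_strict_mono_on)
  have "f k < f x \<longleftrightarrow> k < x" if "k \<in> set ks" for k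
    using that by (intro strict_mono_on_less[OF mono]) auto
  then have flt: "length (filter (\<lambda>k. k < f x) (map f ks)) = length (filter (\<lambda>k. k < x) ks)"
    by (simp add: filter_map o_def cong: filter_cong)
  have "mst_insert m (f x) (map_mtree f (ts i)) = map_mtree f (mst_insert m x (ts i))" for i
    using Node.prems by (intro Node.IH) (auto elim!: monotone_on_subset)
  then show ?case using ins flt by (auto simp: Let_def fun_eq_iff)
qed auto

text \<open>The shape of the tree depends only on the relative order of the keys.\<close>

lemma mst_map:
  assumes "strict_mono_on (set xs) f"
  shows "mst m (map f xs) = map_mtree f (mst m xs)"
  using assms
proof (induction xs rule: rev_induct)
  case (snoc x xs)
  have 1: "mst m (map f xs) = map_mtree f (mst m xs)"
    using snoc.prems by (intro snoc.IH) (auto elim!: monotone_on_subset)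
  have "strict_mono_on (insert x (set_mtree (mst m xs))) f"
    using snoc.prems by (rule monotone_on_subset) (use set_mst[of m xs] in auto)
  from mst_insert_map[OF this] show ?case by (simp add: 1)
qed simp

lemma map_mtree_eq_External [simp]: "map_mtree f T = External \<longleftrightarrow> T = External"
  by (cases T) auto

lemma num_leaves_map [simp]: "num_leaves m (map_mtree f T) = num_leaves m T"
  by (induction T) auto

text \<open>The types of the gaps from left to right. Position \<open>r\<close> in this list is the gap that receives a key that is larger than exactly
\<open>r\<close> keys of the tree. A node that is not full is a leaf; the only gap of the empty tree has type \<open>1\<close>.\<close>

primrec gap_types :: "nat \<Rightarrow> 'a mtree \<Rightarrow> nat list" where
  "gap_types m External = [1]"
| "gap_types m (Node ks ts) =
     (if length ks < m - 1 then replicate (length ks + 1) (length ks + 1)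
      else if \<forall>j<m. ts j = External then replicate m m
      else concat (map (\<lambda>j. gap_types m (ts j)) [0..<m]))"

lemma gap_types_map [simp]: "gap_types m (map_mtree f T) = gap_types m T"
  by (induction T) auto

text \<open>The invariant of trees grown from distinct keys. The last line places every key of the child \<open>j\<close> between the keys
\<open>j - 1\<close> and \<open>j\<close> of the node; it also makes the children with an index larger than the number of keys empty.\<close>

primrec search_tree :: "nat \<Rightarrow> 'a::linorder mtree \<Rightarrow> bool" where
  "search_tree m External = True"
| "search_tree m (Node ks ts) =
     (ks \<noteq> [] \<and> sorted ks \<and> distinct ks \<and> length ks \<le> m - 1 \<and>
      (length ks < m - 1 \<longrightarrow> (\<forall>j. ts j = External)) \<and> (\<forall>j. search_tree m (ts j)) \<and>
      (\<forall>j. \<forall>k\<in>set_mtree (ts j). k \<notin> set ks \<and> length (filter (\<lambda>k'. k' < k) ks) = j))"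

lemma search_tree_insert:
  assumes "search_tree m T" "x \<notin> set_mtree T" "m \<ge> 2"
  shows "search_tree m (mst_insert m x T) \<and> set_mtree (mst_insert m x T) = insert x (set_mtree T)"
  using assms
proof (induction T)
  case (Node ks ts)
  show ?case
  proof (cases "length ks < m - 1")
    case True
    then show ?thesis using Node.prems
      by (auto simp: sorted_insort distinct_insort set_insort_key)
  next
    case False
    define i where "i = length (filter (\<lambda>k. k < x) ks)"
    have IH: "search_tree m (mst_insert m x (ts i))" "set_mtree (mst_insert m x (ts i)) = insert x (set_mtree (ts i))"
      using Node.IH[of "ts i"] Node.prems by auto
    have eq: "mst_insert m x (Node ks ts) = Node ks (ts(i := mst_insert m x (ts i)))"
      using False by (simp add: i_def Let_def)
    define t where "t = mst_insert m x (ts i)"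
    have t: "set_mtree t = insert x (set_mtree (ts i))" "search_tree m t" using IH by (auto simp: t_def)
    have "(\<Union>j. set_mtree ((ts(i := t)) j)) = insert x (\<Union>j. set_mtree (ts j))"
    proof (intro equalityI subsetI)
      fix k assume "k \<in> (\<Union>j. set_mtree ((ts(i := t)) j))"
      then obtain j where "k \<in> set_mtree ((ts(i := t)) j)" by blast
      then show "k \<in> insert x (\<Union>j. set_mtree (ts j))" using t by (cases "j = i") auto
    next
      fix k assume "k \<in> insert x (\<Union>j. set_mtree (ts j))"
      then consider "k = x" | j where "k \<in> set_mtree (ts j)" by blast
      then show "k \<in> (\<Union>j. set_mtree ((ts(i := t)) j))"
      proof cases
        case 1
        then have "k \<in> set_mtree ((ts(i := t)) i)" using t by simp
        then show ?thesis by blast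
      next
        case (2 j)
        then have "k \<in> set_mtree ((ts(i := t)) j)" using t by (cases "j = i") auto
        then show ?thesis by blast
      qed
    qed
    moreover have "set_mtree (Node ks f) = set ks \<union> (\<Union>j. set_mtree (f j))" for f :: "nat \<Rightarrow> 'a mtree"
      by auto
    ultimately have keys: "set_mtree (Node ks (ts(i := t))) = insert x (set_mtree (Node ks ts))"
      by (simp only: Un_insert_right)
    have child: "k \<notin> set ks \<and> length (filter (\<lambda>k'. k' < k) ks) = j" if "k \<in> set_mtree ((ts(i := t)) j)" for j k
    proof (cases "j = i")
      case True
      then have "k = x \<or> k \<in> set_mtree (ts i)" using that t by simp
      then show ?thesis using True Node.prems by (auto simp: i_def)
    next
      case False
      then show ?thesis using that Node.prems by simp
    qed
    have "search_tree m ((ts(i := t)) j)" for j using Node.prems t by simp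
    then have "search_tree m (Node ks (ts(i := t)))"
      using Node.prems False child by (simp del: fun_upd_apply)
    then show ?thesis unfolding eq t_def[symmetric] using keys by simp
  qed
qed auto

lemma search_tree_mst:
  assumes "distinct xs" "m \<ge> 2"
  shows "search_tree m (mst m xs) \<and> set_mtree (mst m xs) = set xs"
  using assms
proof (induction xs rule: rev_induct)
  case (snoc x xs)
  then have "search_tree m (mst m xs)" "set_mtree (mst m xs) = set xs" by auto
  then show ?case using search_tree_insert[of m "mst m xs" x] snoc.prems by auto
qed simp

lemma node_keys:
  assumes "search_tree m (Node ks ts)" "m \<ge> 2"
  shows "set_mtree (Node ks ts) = set ks \<union> (\<Union>j<m. set_mtree (ts j))"
proof -
  have "j < m" if "k \<in> set_mtree (ts j)" for j k
  proof -
    have "j = length (filter (\<lambda>k'. k' < k) ks)" using that assms by auto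
    also have "\<dots> \<le> length ks" by simp
    also have "\<dots> < m" using assms by auto
    finally show ?thesis .
  qed
  then show ?thesis by auto
qed

lemma finite_keys: "search_tree m T \<Longrightarrow> m \<ge> 2 \<Longrightarrow> finite (set_mtree T)"
proof (induction T)
  case (Node ks ts)
  then show ?case unfolding node_keys[OF Node.prems] by auto
qed simp

lemma child_keys_disjoint:
  assumes "search_tree m (Node ks ts)"
  shows "i \<noteq> j \<Longrightarrow> set_mtree (ts i) \<inter> set_mtree (ts j) = {}" "set ks \<inter> set_mtree (ts j) = {}"
proof -
  have "i = j" if "k \<in> set_mtree (ts i)" "k \<in> set_mtree (ts j)" for k i j
  proof -
    have "length (filter (\<lambda>k'. k' < k) ks) = i" using assms that(1) by auto
    moreover have "length (filter (\<lambda>k'. k' < k) ks) = j" using assms that(2) by auto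
    ultimately show ?thesis by simp
  qed
  then show "i \<noteq> j \<Longrightarrow> set_mtree (ts i) \<inter> set_mtree (ts j) = {}" by blast
  show "set ks \<inter> set_mtree (ts j) = {}" using assms by auto
qed

text \<open>Each of the \<open>m - 1\<close> keys of a full node separates two neighbouring children.\<close>

lemma length_gap_types:
  assumes "search_tree m T" "m \<ge> 2"
  shows "length (gap_types m T) = card (set_mtree T) + 1"
  using assms
proof (induction T)
  case (Node ks ts)
  have IH: "length (gap_types m (ts j)) = card (set_mtree (ts j)) + 1" for j
    using Node by auto
  have ks: "distinct ks" "length ks \<le> m - 1" using Node.prems by auto
  have fin: "finite (set_mtree (ts j))" for j using Node.prems finite_keys[of m "ts j"] by auto
  have "card (set_mtree (Node ks ts)) = card (set ks) + card (\<Union>j<m. set_mtree (ts j))"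
    unfolding node_keys[OF Node.prems]
    using child_keys_disjoint(2)[OF Node.prems(1)] fin by (intro card_Un_disjoint) auto
  also have "card (\<Union>j<m. set_mtree (ts j)) = (\<Sum>j<m. card (set_mtree (ts j)))"
    using child_keys_disjoint(1)[OF Node.prems(1)] fin by (intro card_UN_disjoint) auto
  finally have card: "card (set_mtree (Node ks ts)) = length ks + (\<Sum>j<m. card (set_mtree (ts j)))"
    using ks distinct_card by simp
  consider "length ks < m - 1" | "length ks = m - 1" "\<forall>j<m. ts j = External" | "length ks = m - 1" "\<not> (\<forall>j<m. ts j = External)"
    using ks le_neq_implies_less by blast
  then show ?case
  proof cases
    case 1
    then have "\<forall>j. ts j = External" using Node.prems by auto
    then show ?thesis using 1 card by simp
  next
    case 2
    then show ?thesis using card Node.prems(2) by simp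
  next
    case 3
    have "length (gap_types m (Node ks ts)) = (\<Sum>j<m. length (gap_types m (ts j)))"
      using 3 by (simp add: length_concat o_def sum_list_sum_nth atLeast0LessThan)
    also have "\<dots> = (\<Sum>j<m. card (set_mtree (ts j)) + 1)" by (simp add: IH)
    also have "\<dots> = (\<Sum>j<m. card (set_mtree (ts j))) + m" unfolding sum.distrib by simp
    finally show ?thesis using card 3 Node.prems(2) by simp
  qed
qed simp

lemma nth_concat_map_upt:
  assumes "i < n" "r < length (g i)"
  shows "concat (map g [0..<n]) ! ((\<Sum>j<i. length (g j)) + r) = g i ! r"
  using assms
proof (induction n)
  case (Suc n)
  have len: "length (concat (map g [0..<n])) = (\<Sum>j<n. length (g j))" for n
    by (simp add: length_concat o_def sum_list_sum_nth atLeast0LessThan)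
  show ?case
  proof (cases "i = n")
    case True
    then show ?thesis using Suc.prems by (simp add: nth_append len)
  next
    case False
    have "(\<Sum>j<i. length (g j)) + r < (\<Sum>j<Suc i. length (g j))" using Suc.prems by simp
    also have "\<dots> \<le> (\<Sum>j<n. length (g j))" using False Suc.prems by (intro sum_mono2) auto
    finally have "(\<Sum>j<i. length (g j)) + r < length (concat (map g [0..<n]))" by (simp add: len)
    then show ?thesis using Suc False by (simp add: nth_append)
  qed
qed simp

lemma count_list_replicate: "count_list (replicate n a) i = (if a = i then n else 0)"
  by (induction n) auto

lemma count_list_concat_map_upt: "count_list (concat (map g [0..<n])) i = (\<Sum>j<n. count_list (g j) i)"
  by (induction n) auto

definition gap_change :: "nat \<Rightarrow> nat \<Rightarrow> nat \<Rightarrow> real" where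
  "gap_change m t i = Re (gap_xi m t i)"

lemma gap_change_eq:
  "gap_change m t i = (if t < m then - real t * (if i = t then 1 else 0) + real (t + 1) * (if i = t + 1 then 1 else 0)
     else - real m * (if i = m then 1 else 0) + (real m - 1) * (if i = 1 then 1 else 0) + 2 * (if i = 2 then 1 else 0))"
  by (auto simp: gap_change_def gap_xi_def unit_vector_def)

text \<open>The keys below \<open>x\<close> are those in the \<open>i\<close> children left of \<open>x\<close>, the \<open>i\<close> keys that close these children, and the ones
below \<open>x\<close> in the child to which \<open>x\<close> is passed. Counting one closing key per child gives the number of gaps to the left.\<close>

lemma rank_split:
  assumes "search_tree m (Node ks ts)" "m \<ge> 2" "x \<notin> set_mtree (Node ks ts)"
  defines "i \<equiv> length (filter (\<lambda>k. k < x) ks)"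
  shows "card {k \<in> set_mtree (Node ks ts). k < x} =
    (\<Sum>j<i. card (set_mtree (ts j)) + 1) + card {k \<in> set_mtree (ts i). k < x}"
proof -
  have "search_tree m (ts j)" for j using assms(1) unfolding search_tree.simps by blast
  then have fin: "finite (set_mtree (ts j))" for j using assms(2) finite_keys by blast
  have key: "length (filter (\<lambda>k'. k' < k) ks) = j" if "k \<in> set_mtree (ts j)" for j k
    using that assms(1) unfolding search_tree.simps by blast
  have nodeset: "set_mtree (Node ks ts) = set ks \<union> (\<Union>j. set_mtree (ts j))" by auto
  have mono: "length (filter (\<lambda>k'. k' < a) ks) \<le> length (filter (\<lambda>k'. k' < b) ks)" if "a \<le> b" for a b
    using that by (induction ks) auto
  have less: "k < x" if "k \<in> set_mtree (ts j)" "j < i" for j k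
  proof (rule ccontr)
    assume "\<not> k < x"
    then have "i \<le> j" using mono[of x k] key[OF that(1)] by (simp add: i_def)
    then show False using that(2) by simp
  qed
  have greater: "j \<le> i" if "k \<in> set_mtree (ts j)" "k < x" for j k
    using mono[of k x] key[OF that(1)] that(2) by (simp add: i_def)
  have eq: "{k \<in> set_mtree (Node ks ts). k < x} = {k \<in> set ks. k < x} \<union> ((\<Union>j<i. set_mtree (ts j)) \<union> {k \<in> set_mtree (ts i). k < x})"
  proof (intro equalityI subsetI)
    fix k assume k: "k \<in> {k \<in> set_mtree (Node ks ts). k < x}"
    then have kx: "k < x" by simp
    from k consider "k \<in> set ks" | j where "k \<in> set_mtree (ts j)" unfolding nodeset by blast
    then show "k \<in> {k \<in> set ks. k < x} \<union> ((\<Union>j<i. set_mtree (ts j)) \<union> {k \<in> set_mtree (ts i). k < x})"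
    proof cases
      case (2 j)
      then have "j \<le> i" using greater kx by blast
      then show ?thesis using 2 kx by (cases "j = i") auto
    qed (use kx in blast)
  next
    fix k assume "k \<in> {k \<in> set ks. k < x} \<union> ((\<Union>j<i. set_mtree (ts j)) \<union> {k \<in> set_mtree (ts i). k < x})"
    then show "k \<in> {k \<in> set_mtree (Node ks ts). k < x}" unfolding nodeset using less by blast
  qed
  have "card {k \<in> set ks. k < x} = i"
    using assms(1) unfolding i_def search_tree.simps by (simp only: distinct_length_filter) (simp add: Int_def conj_commute)
  moreover have "card (\<Union>j<i. set_mtree (ts j)) = (\<Sum>j<i. card (set_mtree (ts j)))"
    using child_keys_disjoint(1)[OF assms(1)] fin by (intro card_UN_disjoint) auto
  moreover have "card ({k \<in> set ks. k < x} \<union> ((\<Union>j<i. set_mtree (ts j)) \<union> {k \<in> set_mtree (ts i). k < x}))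
     = card {k \<in> set ks. k < x} + card ((\<Union>j<i. set_mtree (ts j)) \<union> {k \<in> set_mtree (ts i). k < x})"
    using child_keys_disjoint(2)[OF assms(1)] fin by (intro card_Un_disjoint) auto
  moreover have "card ((\<Union>j<i. set_mtree (ts j)) \<union> {k \<in> set_mtree (ts i). k < x})
     = card (\<Union>j<i. set_mtree (ts j)) + card {k \<in> set_mtree (ts i). k < x}"
  proof (rule card_Un_disjoint)
    have "set_mtree (ts j) \<inter> set_mtree (ts i) = {}" if "j < i" for j
      by (rule child_keys_disjoint(1)[OF assms(1)]) (use that in simp)
    then show "(\<Union>j<i. set_mtree (ts j)) \<inter> {k \<in> set_mtree (ts i). k < x} = {}" by fast
    show "finite (\<Union>j<i. set_mtree (ts j))" by (rule finite_UN_I) (auto intro: fin)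
    show "finite {k \<in> set_mtree (ts i). k < x}" by (rule finite_subset[OF _ fin[of i]]) blast
  qed
  ultimately show ?thesis unfolding eq sum.distrib by simp
qed

lemma mst_insert_not_External [simp]: "mst_insert m x T \<noteq> External"
  by (cases T) (auto simp: Let_def)

text \<open>The replacement rule of the urn, including the two boundary effects: filling the last place of a leaf turns its gaps into type \<open>m\<close>,
and a key below a full leaf destroys this leaf, which leaves \<open>m - 1\<close> gaps of type \<open>1\<close> and one new leaf with two gaps.\<close>

lemma gap_types_insert:
  assumes "search_tree m T" "x \<notin> set_mtree T" "m \<ge> 3"
  shows "real (count_list (gap_types m (mst_insert m x T)) i) = real (count_list (gap_types m T) i)
     + gap_change m (gap_types m T ! card {k \<in> set_mtree T. k < x}) i"
  using assms
proof (induction T)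
  case External
  then show ?case by (auto simp: gap_change_eq)
next
  case (Node ks ts)
  let ?r = "card {k \<in> set_mtree (Node ks ts). k < x}"
  have m2: "m \<ge> 2" using Node.prems by simp
  have ks: "distinct ks" "length ks \<le> m - 1" using Node.prems by auto
  have "?r \<le> card (set_mtree (Node ks ts))"
    using finite_keys[OF Node.prems(1) m2] by (intro card_mono) auto
  then have r: "?r < length (gap_types m (Node ks ts))"
    using length_gap_types[OF Node.prems(1) m2] by simp
  define c where "c = length (filter (\<lambda>k. k < x) ks)"
  have "c \<le> length ks" by (simp add: c_def)
  then have c: "c < m" using ks m2 by linarith
  consider "length ks < m - 1" | "length ks = m - 1" "\<forall>j<m. ts j = External" | "length ks = m - 1" "\<not> (\<forall>j<m. ts j = External)"
    using ks le_neq_implies_less by blast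
  then show ?case
  proof cases
    case 1
    then have ext: "\<forall>j. ts j = External" using Node.prems by auto
    have "gap_types m (Node ks ts) ! ?r = length ks + 1"
      using r 1 by (simp del: replicate_Suc mtree.set)
    moreover have "gap_types m (mst_insert m x (Node ks ts)) = replicate (length ks + 2) (length ks + 2)"
      using 1 ext by (auto simp: not_less simp del: replicate_Suc)
    moreover have "gap_types m (Node ks ts) = replicate (length ks + 1) (length ks + 1)"
      using 1 by (simp del: replicate_Suc)
    ultimately show ?thesis using 1 by (auto simp: gap_change_eq count_list_replicate simp del: replicate_Suc mtree.set)
  next
    case 2
    have types: "gap_types m (Node ks ts) = replicate m m" using 2 by simp
    have "gap_types m (mst_insert m x (Node ks ts)) = concat (map (\<lambda>j. gap_types m ((ts(c := mst_insert m x (ts c))) j)) [0..<m])"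
      using 2 c by (auto simp: Let_def c_def)
    also have "map (\<lambda>j. gap_types m ((ts(c := mst_insert m x (ts c))) j)) [0..<m] = map (\<lambda>j. if j = c then [2, 2] else [1]) [0..<m]"
      using 2 c Node.prems(3) by (intro map_cong refl) (auto simp: numeral_2_eq_2)
    finally have "count_list (gap_types m (mst_insert m x (Node ks ts))) i = (\<Sum>j<m. count_list (if j = c then [2, 2] else [1]) i)"
      by (simp add: count_list_concat_map_upt)
    also have "\<dots> = (if i = 2 then 2 else 0) + (if i = 1 then m - 1 else 0)"
      using c by (subst sum.remove[of _ c]) (auto simp: if_distrib cong: if_cong)
    finally show ?thesis using types r Node.prems(3)
      by (auto simp: gap_change_eq count_list_replicate simp del: mtree.set)
  next
    case 3
    have ins: "gap_types m (mst_insert m x (Node ks ts)) = concat (map (\<lambda>j. gap_types m ((ts(c := mst_insert m x (ts c))) j)) [0..<m])"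
      using 3 c by (auto simp: Let_def c_def)
    have types: "gap_types m (Node ks ts) = concat (map (\<lambda>j. gap_types m (ts j)) [0..<m])"
      using 3 by auto
    let ?r' = "card {k \<in> set_mtree (ts c). k < x}"
    have tc: "search_tree m (ts c)" "x \<notin> set_mtree (ts c)" using Node.prems by auto
    have IH: "real (count_list (gap_types m (mst_insert m x (ts c))) i) = real (count_list (gap_types m (ts c)) i)
     + gap_change m (gap_types m (ts c) ! ?r') i"
      using Node.IH[of "ts c"] tc Node.prems(3) by auto
    have len: "length (gap_types m (ts j)) = card (set_mtree (ts j)) + 1" for j
      using Node.prems length_gap_types[of m "ts j"] by auto
    have "?r' \<le> card (set_mtree (ts c))" using finite_keys[OF tc(1) m2] by (intro card_mono) auto
    then have r': "?r' < length (gap_types m (ts c))" by (simp add: len)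
    have "?r = (\<Sum>j<c. length (gap_types m (ts j))) + ?r'"
      using rank_split[OF Node.prems(1) m2 Node.prems(2)] by (simp add: len c_def)
    then have "gap_types m (Node ks ts) ! ?r = gap_types m (ts c) ! ?r'"
      unfolding types using nth_concat_map_upt[of c m "?r'" "\<lambda>j. gap_types m (ts j)", OF c r'] by simp
    moreover have "real (count_list (gap_types m (mst_insert m x (Node ks ts))) i) - real (count_list (gap_types m (Node ks ts)) i)
      = real (count_list (gap_types m (mst_insert m x (ts c))) i) - real (count_list (gap_types m (ts c)) i)"
      unfolding ins types count_list_concat_map_upt using c by (simp add: sum.remove[of "{..<m}" c])
    ultimately show ?thesis using IH by simp
  qed
qed

lemma set_gap_types: "search_tree m T \<Longrightarrow> m \<ge> 2 \<Longrightarrow> set (gap_types m T) \<subseteq> {1..m}"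
proof (induction T)
  case (Node ks ts)
  then have "\<And>j. set (gap_types m (ts j)) \<subseteq> {1..m}" by auto
  then show ?case using Node.prems by (auto simp: subset_iff simp del: replicate_Suc)
qed auto

text \<open>A leaf with \<open>i - 1\<close> keys owns exactly \<open>i\<close> gaps, all of type \<open>i\<close>, and these are all the gaps of type \<open>i \<ge> 2\<close>.\<close>

lemma num_leaves_gap_types:
  assumes "search_tree m T" "m \<ge> 2"
  shows "real (num_leaves m T) = (\<Sum>i=2..m. 1 / real i * real (count_list (gap_types m T) i))"
  using assms
proof (induction T)
  case External
  then show ?case by (auto intro!: sum.neutral[symmetric])
next
  case (Node ks ts)
  have one: "1 = (\<Sum>i=2..m. 1 / real i * real (count_list (replicate a a) i))" if "2 \<le> a" "a \<le> m" for a
  proof -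
    have "(\<Sum>i=2..m. 1 / real i * real (count_list (replicate a a) i)) = (\<Sum>i=2..m. if i = a then 1 else 0)"
      using that by (intro sum.cong refl) (auto simp: count_list_replicate)
    then show ?thesis using that by simp
  qed
  have ks: "length ks \<le> m - 1" "length ks \<ge> 1" using Node.prems by (auto simp: Suc_le_eq)
  consider "length ks < m - 1" | "length ks = m - 1" "\<forall>j<m. ts j = External" | "length ks = m - 1" "\<not> (\<forall>j<m. ts j = External)"
    using ks le_neq_implies_less by blast
  then show ?case
  proof cases
    case 1
    then have "num_leaves m (Node ks ts) = 1" using Node.prems by auto
    moreover have "gap_types m (Node ks ts) = replicate (length ks + 1) (length ks + 1)"
      using 1 by (simp del: replicate_Suc)
    ultimately show ?thesis using one[of "length ks + 1"] ks 1 by simp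
  next
    case 2
    then show ?thesis using one[of m] Node.prems by simp
  next
    case 3
    have IH: "real (num_leaves m (ts j)) = (\<Sum>i=2..m. 1 / real i * real (count_list (gap_types m (ts j)) i))" for j
      using Node by auto
    have types: "gap_types m (Node ks ts) = concat (map (\<lambda>j. gap_types m (ts j)) [0..<m])"
      using 3 by auto
    have "num_leaves m (Node ks ts) = (\<Sum>j<m. num_leaves m (ts j))" using 3 by auto
    then have "real (num_leaves m (Node ks ts)) = (\<Sum>j<m. \<Sum>i=2..m. 1 / real i * real (count_list (gap_types m (ts j)) i))"
      by (simp add: IH)
    also have "\<dots> = (\<Sum>i=2..m. 1 / real i * real (count_list (gap_types m (Node ks ts)) i))"
      unfolding types count_list_concat_map_upt of_nat_sum sum_distrib_left by (rule sum.swap)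
    finally show ?thesis .
  qed
qed

section \<open>Trees of uniformly random permutations\<close>

text \<open>Makes room for a new key of rank \<open>r\<close>.\<close>

definition relabel :: "nat \<Rightarrow> nat \<Rightarrow> nat" where
  "relabel r k = (if k < r then k else Suc k)"

lemma strict_mono_relabel: "strict_mono_on A (relabel r)"
  by (rule strict_mono_onI) (auto simp: relabel_def)

lemma inj_relabel: "inj (relabel r)"
  by (auto simp: inj_def relabel_def split: if_splits)

lemma relabel_image: "r \<le> n \<Longrightarrow> relabel r ` {0..<n} = {0..<Suc n} - {r}"
proof (intro equalityI subsetI)
  fix k assume r: "r \<le> n" and k: "k \<in> {0..<Suc n} - {r}"
  show "k \<in> relabel r ` {0..<n}"
  proof (cases "k < r")
    case True
    then show ?thesis using r by (intro image_eqI[of _ _ k]) (auto simp: relabel_def)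
  next
    case False
    then show ?thesis using k by (intro image_eqI[of _ _ "k - 1"]) (auto simp: relabel_def)
  qed
qed (auto simp: relabel_def)

text \<open>A permutation of \<open>n + 1\<close> keys is the relative order of the first \<open>n\<close> together with the rank of the last, and all combinations
occur.\<close>

lemma bij_betw_permutations_append_rank:
  "bij_betw (\<lambda>(p, r). map (relabel r) p @ [r]) (permutations_of_set {0..<n} \<times> {..n}) (permutations_of_set {0..<Suc n})"
proof -
  let ?f = "\<lambda>(p, r). map (relabel r) p @ [r]"
  have inj: "inj_on ?f (permutations_of_set {0..<n} \<times> {..n})"
  proof (rule inj_onI)
    fix a b assume "?f a = ?f b"
    then show "a = b"
      by (cases a; cases b) (auto dest: map_injective[OF _ inj_relabel])
  qed
  have sub: "?f ` (permutations_of_set {0..<n} \<times> {..n}) \<subseteq> permutations_of_set {0..<Suc n}"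
  proof safe
    fix p r assume p: "p \<in> permutations_of_set {0..<n}" and r: "r \<le> n"
    have "set (map (relabel r) p) = {0..<Suc n} - {r}"
      using permutations_of_setD(1)[OF p] relabel_image[OF r] by simp
    moreover have "distinct (map (relabel r) p)"
      using permutations_of_setD(2)[OF p] inj_relabel by (simp add: distinct_map inj_on_subset[OF inj_relabel])
    ultimately show "map (relabel r) p @ [r] \<in> permutations_of_set {0..<Suc n}"
      using r by (intro permutations_of_setI) auto
  qed
  have "card (?f ` (permutations_of_set {0..<n} \<times> {..n})) = card (permutations_of_set {0..<Suc n})"
    unfolding card_image[OF inj] by simp
  then have "?f ` (permutations_of_set {0..<n} \<times> {..n}) = permutations_of_set {0..<Suc n}"
    using sub by (intro card_subset_eq) auto
  with inj show ?thesis by (simp add: bij_betw_def)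
qed

definition gap_counts :: "nat \<Rightarrow> nat list \<Rightarrow> nat \<Rightarrow> real" where
  "gap_counts m p i = real (count_list (gap_types m (mst m p)) i)"

lemma sum_nth_count_list:
  fixes F :: "nat \<Rightarrow> 'a::comm_semiring_1"
  assumes "set xs \<subseteq> {1..m}"
  shows "(\<Sum>r<length xs. F (xs ! r)) = (\<Sum>i=1..m. of_nat (count_list xs i) * F i)"
  using assms
proof (induction xs)
  case (Cons x xs)
  have "(\<Sum>r<length (x # xs). F ((x # xs) ! r)) = F x + (\<Sum>r<length xs. F (xs ! r))"
    by (simp add: sum.lessThan_Suc_shift del: sum.lessThan_Suc)
  also have "F x = (\<Sum>i=1..m. if i = x then F i else 0)"
    using Cons.prems by simp
  also have "(\<Sum>r<length xs. F (xs ! r)) = (\<Sum>i=1..m. of_nat (count_list xs i) * F i)"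
    using Cons by simp
  also have "(\<Sum>i=1..m. if i = x then F i else 0) + \<dots> = (\<Sum>i=1..m. of_nat (count_list (x # xs) i) * F i)"
    unfolding sum.distrib[symmetric] by (intro sum.cong) (auto simp: algebra_simps)
  finally show ?case .
qed simp

lemma gap_counts_total:
  assumes "p \<in> permutations_of_set {0..<n}" "m \<ge> 2"
  shows "(\<Sum>i=1..m. gap_counts m p i) = real (Suc n)"
proof -
  have p: "distinct p" "set p = {0..<n}" using permutations_of_setD[OF assms(1)] by auto
  have t: "search_tree m (mst m p)" "set_mtree (mst m p) = {0..<n}"
    using search_tree_mst[OF p(1) assms(2)] p by auto
  have "(\<Sum>r<length (gap_types m (mst m p)). 1 :: real) = (\<Sum>i=1..m. gap_counts m p i)"
    using sum_nth_count_list[OF set_gap_types[OF t(1) assms(2)], of "\<lambda>_. 1::real"] by (simp add: gap_counts_def)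
  then show ?thesis using length_gap_types[OF t(1) assms(2)] t(2) by simp
qed

text \<open>The last key is inserted at the gap whose position is its rank, and the rank is uniform and independent of the order of
the other keys. So the inserted key chooses among all gaps uniformly, and summing over the gaps is summing over the
types with their multiplicities.\<close>

lemma gap_counts_step:
  fixes f :: "(nat \<Rightarrow> real) \<Rightarrow> complex"
  assumes m: "m \<ge> 3"
  shows "(\<Sum>s\<in>permutations_of_set {0..<Suc n}. f (gap_counts m s)) / of_nat (card (permutations_of_set {0..<Suc n})) =
    (\<Sum>s\<in>permutations_of_set {0..<n}. \<Sum>i=1..m. of_real (gap_counts m s i / real (Suc n)) * f (\<lambda>k. gap_counts m s k + gap_change m i k))
      / of_nat (card (permutations_of_set {0..<n}))"
proof -
  have m2: "m \<ge> 2" using m by simp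
  have inner: "(\<Sum>r\<le>n. f (gap_counts m (map (relabel r) p @ [r]))) = (\<Sum>i=1..m. of_real (gap_counts m p i) * f (\<lambda>k. gap_counts m p k + gap_change m i k))"
    if p: "p \<in> permutations_of_set {0..<n}" for p
  proof -
    have pd: "distinct p" "set p = {0..<n}" using permutations_of_setD[OF p] by auto
    have t: "search_tree m (mst m p)" "set_mtree (mst m p) = {0..<n}"
      using search_tree_mst[OF pd(1) m2] pd by auto
    let ?g = "gap_types m (mst m p)"
    have len: "length ?g = Suc n" using length_gap_types[OF t(1) m2] t(2) by simp
    have "gap_counts m (map (relabel r) p @ [r]) = (\<lambda>k. gap_counts m p k + gap_change m (?g ! r) k)" if r: "r \<le> n" for r
    proof -
      let ?q = "map (relabel r) p"
      have q: "set ?q = {0..<Suc n} - {r}" using relabel_image[OF r] pd by simp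
      have "distinct ?q" using pd by (simp add: distinct_map inj_on_subset[OF inj_relabel])
      then have tq: "search_tree m (mst m ?q)" "set_mtree (mst m ?q) = {0..<Suc n} - {r}"
        using search_tree_mst[of ?q m] m2 q by auto
      have same: "gap_types m (mst m ?q) = ?g"
        by (simp add: mst_map strict_mono_relabel)
      have "{k \<in> set_mtree (mst m ?q). k < r} = {0..<r}" unfolding tq(2) using r by auto
      then have rank: "card {k \<in> set_mtree (mst m ?q). k < r} = r" by simp
      show ?thesis
        using gap_types_insert[OF tq(1) _ m, of r] tq(2) rank same by (auto simp: fun_eq_iff gap_counts_def)
    qed
    then have "(\<Sum>r\<le>n. f (gap_counts m (map (relabel r) p @ [r]))) = (\<Sum>r<length ?g. f (\<lambda>k. gap_counts m p k + gap_change m (?g ! r) k))"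
      unfolding len lessThan_Suc_atMost by (intro sum.cong) auto
    also have "\<dots> = (\<Sum>i=1..m. of_nat (count_list ?g i) * f (\<lambda>k. gap_counts m p k + gap_change m i k))"
      by (rule sum_nth_count_list[OF set_gap_types[OF t(1) m2]])
    finally show ?thesis by (simp add: gap_counts_def)
  qed
  have "(\<Sum>s\<in>permutations_of_set {0..<Suc n}. f (gap_counts m s)) =
     (\<Sum>(p, r)\<in>permutations_of_set {0..<n} \<times> {..n}. f (gap_counts m (map (relabel r) p @ [r])))"
    using sum.reindex_bij_betw[OF bij_betw_permutations_append_rank[of n], of "\<lambda>s. f (gap_counts m s)"]
    by (simp add: case_prod_unfold)
  also have "\<dots> = (\<Sum>p\<in>permutations_of_set {0..<n}. \<Sum>r\<le>n. f (gap_counts m (map (relabel r) p @ [r])))"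
    by (rule sum.cartesian_product[symmetric])
  also have "\<dots> = (\<Sum>p\<in>permutations_of_set {0..<n}. \<Sum>i=1..m. of_real (gap_counts m p i) * f (\<lambda>k. gap_counts m p k + gap_change m i k))"
    by (intro sum.cong refl inner)
  also have "\<dots> = of_nat (Suc n) * (\<Sum>s\<in>permutations_of_set {0..<n}. \<Sum>i=1..m. of_real (gap_counts m s i / real (Suc n)) * f (\<lambda>k. gap_counts m s k + gap_change m i k))"
    unfolding sum_distrib_left by (intro sum.cong refl) (simp del: of_nat_Suc)
  finally have total: "(\<Sum>s\<in>permutations_of_set {0..<Suc n}. f (gap_counts m s)) = of_nat (Suc n) *
    (\<Sum>s\<in>permutations_of_set {0..<n}. \<Sum>i=1..m. of_real (gap_counts m s i / real (Suc n)) * f (\<lambda>k. gap_counts m s k + gap_change m i k))" .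
  have card: "complex_of_nat (card (permutations_of_set {0..<Suc n})) = of_nat (Suc n) * of_nat (card (permutations_of_set {0..<n}))"
    by (simp add: algebra_simps)
  show ?thesis unfolding total card by (rule mult_divide_mult_cancel_left) (rule of_nat_neq_0)
qed

section \<open>From random keys to random permutations\<close>

text \<open>The number of leaves is a function of finitely many comparisons between keys. This gives its measurability.\<close>

definition order_pattern :: "nat \<Rightarrow> (nat \<Rightarrow> real) \<Rightarrow> (nat \<times> nat) set" where
  "order_pattern n x = {(i, j). i < n \<and> j < n \<and> x i \<le> x j}"

definition leaves_of :: "nat \<Rightarrow> nat \<Rightarrow> (nat \<Rightarrow> real) \<Rightarrow> nat" where
  "leaves_of m n x = num_leaves m (mst m (map x [0..<n]))"

lemma leaves_of_order_pattern:
  assumes "order_pattern n x = order_pattern n y"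
  shows "leaves_of m n x = leaves_of m n y"
proof -
  have le: "x i \<le> x j \<longleftrightarrow> y i \<le> y j" if "i < n" "j < n" for i j
  proof -
    have "(i, j) \<in> order_pattern n x \<longleftrightarrow> (i, j) \<in> order_pattern n y" using assms by simp
    then show ?thesis using that by (simp add: order_pattern_def)
  qed
  define f where "f v = y (SOME i. i < n \<and> x i = v)" for v
  have f: "f (x i) = y i" if "i < n" for i
  proof -
    define k where "k = (SOME k. k < n \<and> x k = x i)"
    have "k < n \<and> x k = x i" unfolding k_def by (rule someI[of _ i]) (use that in auto)
    then have "y k = y i" using le[of k i] le[of i k] that by simp
    then show ?thesis by (simp add: f_def k_def)
  qed
  have "strict_mono_on (set (map x [0..<n])) f"
  proof (rule strict_mono_onI)
    fix a b assume "a \<in> set (map x [0..<n])" "b \<in> set (map x [0..<n])" "a < b"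
    then obtain i j where "i < n" "j < n" "a = x i" "b = x j" by auto
    with \<open>a < b\<close> show "f a < f b" using f le[of j i] by (simp add: not_le[symmetric])
  qed
  from mst_map[OF this, of m] have "leaves_of m n x = num_leaves m (mst m (map f (map x [0..<n])))"
    by (simp add: leaves_of_def)
  also have "map f (map x [0..<n]) = map y [0..<n]" using f by simp
  finally show ?thesis by (simp add: leaves_of_def)
qed

lemma measurable_leaves_of:
  "leaves_of m n \<in> measurable (\<Pi>\<^sub>M i\<in>{0..<n}. borel) (count_space UNIV)"
proof -
  let ?P = "\<Pi>\<^sub>M i\<in>{0..<n}. (borel :: real measure)"
  define K where "K p = leaves_of m n (SOME x. order_pattern n x = p)" for p
  have K: "leaves_of m n x = K (order_pattern n x)" for x
    unfolding K_def by (rule leaves_of_order_pattern) (metis (mono_tags, lifting) someI)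
  have "order_pattern n \<in> measurable ?P (count_space (Pow ({..<n} \<times> {..<n})))"
  proof (subst measurable_count_space_eq2)
    show "order_pattern n \<in> space ?P \<rightarrow> Pow ({..<n} \<times> {..<n}) \<and>
      (\<forall>p\<in>Pow ({..<n} \<times> {..<n}). order_pattern n -` {p} \<inter> space ?P \<in> sets ?P)"
    proof (intro conjI ballI)
      fix p assume p: "p \<in> Pow ({..<n} \<times> {..<n})"
      have "order_pattern n x = p \<longleftrightarrow> (\<forall>i\<in>{0..<n}. \<forall>j\<in>{0..<n}. (i, j) \<in> p \<longleftrightarrow> x i \<le> x j)" for x
        using p by (auto simp: order_pattern_def)
      then have "order_pattern n -` {p} \<inter> space ?P = {x \<in> space ?P. \<forall>i\<in>{0..<n}. \<forall>j\<in>{0..<n}. (i, j) \<in> p \<longleftrightarrow> x i \<le> x j}"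
        by auto
      also have "\<dots> \<in> sets ?P"
      proof (intro sets.sets_Collect_finite_All finite_atLeastLessThan)
        fix i j assume "i \<in> {0..<n}" "j \<in> {0..<n}"
        then have le: "{x \<in> space ?P. x i \<le> x j} \<in> sets ?P"
          by (intro borel_measurable_le measurable_component_singleton)
        show "{x \<in> space ?P. (i, j) \<in> p \<longleftrightarrow> x i \<le> x j} \<in> sets ?P"
          using le sets.sets_Collect_neg[OF le] by (cases "(i, j) \<in> p") auto
      qed
      finally show "order_pattern n -` {p} \<inter> space ?P \<in> sets ?P" .
    qed (auto simp: order_pattern_def)
  qed simp
  then have "(\<lambda>x. K (order_pattern n x)) \<in> measurable ?P (count_space UNIV)"
    by (rule measurable_compose) simp
  then show ?thesis by (simp add: K[abs_def, symmetric] K)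
qed

text \<open>Distinct keys have ranks, and replacing the keys by their ranks turns the sum over all orders of the keys into the sum
over all permutations, whatever the keys are.\<close>

lemma sum_orderings_of_distinct:
  fixes x :: "nat \<Rightarrow> real" and h :: "nat \<Rightarrow> complex"
  assumes inj: "inj_on x {0..<n}"
  shows "(\<Sum>s\<in>permutations_of_set {0..<n}. h (num_leaves m (mst m (map x s)))) =
    (\<Sum>s\<in>permutations_of_set {0..<n}. h (num_leaves m (mst m s)))"
proof -
  define rank where "rank i = card {j \<in> {0..<n}. x j < x i}" for i
  have rank_less: "rank i < rank j" if "i < n" "j < n" "x i < x j" for i j
    unfolding rank_def using that by (intro psubset_card_mono psubsetI) auto
  have rank_bound: "rank i < n" if "i < n" for i
  proof -
    have "{j \<in> {0..<n}. x j < x i} \<subseteq> {0..<n} - {i}" by auto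
    then have "rank i \<le> card ({0..<n} - {i})" unfolding rank_def by (intro card_mono) auto
    then show ?thesis using that by simp
  qed
  have inj_rank: "inj_on rank {0..<n}"
  proof (rule inj_onI)
    fix i j assume ij: "i \<in> {0..<n}" "j \<in> {0..<n}" "rank i = rank j"
    then have "\<not> x i < x j" "\<not> x j < x i" using rank_less[of i j] rank_less[of j i] by auto
    then have "x i = x j" by simp
    then show "i = j" using inj ij by (auto dest: inj_onD)
  qed
  have img: "rank ` {0..<n} = {0..<n}"
    by (rule endo_inj_surj[OF _ _ inj_rank]) (use rank_bound in auto)
  define f where "f = x \<circ> inv_into {0..<n} rank"
  have f: "f (rank i) = x i" if "i < n" for i
    using that by (simp add: f_def inv_into_f_f[OF inj_rank])
  have mono: "strict_mono_on {0..<n} f"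
  proof (rule strict_mono_onI)
    fix a b assume ab: "a \<in> {0..<n}" "b \<in> {0..<n}" "a < b"
    then obtain i j where ij: "i < n" "a = rank i" "j < n" "b = rank j" using img by (metis atLeastLessThan_iff imageE)
    have "x i < x j"
    proof (rule ccontr)
      assume "\<not> x i < x j"
      then have "x j < x i \<or> x i = x j" by auto
      then show False using rank_less[of j i] ij ab inj by (auto dest: inj_onD)
    qed
    then show "f a < f b" using ij f by simp
  qed
  have "num_leaves m (mst m (map x s)) = num_leaves m (mst m (map rank s))" if "s \<in> permutations_of_set {0..<n}" for s
  proof -
    have s: "set s = {0..<n}" using permutations_of_setD[OF that] by simp
    have "map x s = map f (map rank s)" using s f by simp
    moreover have "strict_mono_on (set (map rank s)) f" using s img mono by simp
    ultimately show ?thesis by (simp only: mst_map num_leaves_map)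
  qed
  then have "(\<Sum>s\<in>permutations_of_set {0..<n}. h (num_leaves m (mst m (map x s)))) =
     (\<Sum>s\<in>permutations_of_set {0..<n}. h (num_leaves m (mst m (map rank s))))"
    by (intro sum.cong) auto
  also have "\<dots> = (\<Sum>s\<in>map rank ` permutations_of_set {0..<n}. h (num_leaves m (mst m s)))"
  proof (rule sum.reindex[symmetric, unfolded o_def])
    show "inj_on (map rank) (permutations_of_set {0..<n})"
    proof (rule inj_onI)
      fix a b assume ab: "a \<in> permutations_of_set {0..<n}" "b \<in> permutations_of_set {0..<n}" "map rank a = map rank b"
      have "inj_on rank (set a \<union> set b)" using ab inj_rank by (simp add: permutations_of_setD)
      then show "a = b" using ab(3) by (rule map_inj_on[rotated])
    qed
  qed
  also have "map rank ` permutations_of_set {0..<n} = permutations_of_set {0..<n}"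
    using permutations_of_set_image_inj[OF inj_rank] img by simp
  finally show ?thesis .
qed

context prob_space
begin

lemma AE_uniform_distinct:
  fixes U :: "nat \<Rightarrow> 'a \<Rightarrow> real"
  assumes indep: "indep_vars (\<lambda>_. borel) U UNIV"
    and unif: "\<And>i. distr M borel (U i) = uniform_measure lborel {0..1}"
  shows "AE w in M. inj (\<lambda>i. U i w)"
proof -
  let ?u = "uniform_measure lborel {0..1::real}"
  have rv [measurable]: "U i \<in> borel_measurable M" for i using indep by (auto simp: indep_vars_def)
  have u: "prob_space ?u" by (rule prob_space_uniform_measure) auto
  interpret u: prob_space ?u by (rule u)
  interpret pair_sigma_finite ?u ?u ..
  have "AE w in M. U i w \<noteq> U j w" if "i \<noteq> j" for i j
  proof -
    have "indep_var borel ((\<lambda>f. f i) \<circ> (\<lambda>w. restrict (\<lambda>i. U i w) {i})) borel ((\<lambda>f. f j) \<circ> (\<lambda>w. restrict (\<lambda>i. U i w) {j}))"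
      using that by (intro indep_var_compose[OF indep_var_restrict[OF indep]]) auto
    then have "indep_var borel (U i) borel (U j)" by (simp add: o_def)
    then have eq: "distr M (borel \<Otimes>\<^sub>M borel) (\<lambda>w. (U i w, U j w)) = ?u \<Otimes>\<^sub>M ?u"
      unfolding indep_var_distribution_eq unif by simp
    have "AE p in ?u \<Otimes>\<^sub>M ?u. fst p \<noteq> snd p"
    proof (rule AE_pair_measure)
      have "AE y in ?u. x \<noteq> y" for x :: real
        using AE_lborel_singleton[of x] by (intro AE_uniform_measureI) auto
      then show "AE x in ?u. AE y in ?u. fst (x, y) \<noteq> snd (x, y)" by simp
    qed measurable
    then have "AE p in distr M (borel \<Otimes>\<^sub>M borel) (\<lambda>w. (U i w, U j w)). fst p \<noteq> snd p" by (simp only: eq)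
    then show ?thesis by (subst (asm) AE_distr_iff) auto
  qed
  then have "AE w in M. \<forall>i j. i \<noteq> j \<longrightarrow> U i w \<noteq> U j w"
    by (auto simp: AE_all_countable)
  then show ?thesis by eventually_elim (auto simp: inj_def)
qed

text \<open>Independent keys with the same law are exchangeable, so the mean stays the same when the keys arrive in another
order. The average over all orders is, for distinct keys, a constant.\<close>

lemma expectation_leaves_uniform_permutation:
  fixes U :: "nat \<Rightarrow> 'a \<Rightarrow> real" and h :: "nat \<Rightarrow> complex"
  assumes indep: "indep_vars (\<lambda>_. borel) U UNIV"
    and unif: "\<And>i. distr M borel (U i) = uniform_measure lborel {0..1}"
    and h: "\<And>k. cmod (h k) \<le> 1"
  shows "expectation (\<lambda>w. h (mst_leaves m U n w)) =
    (\<Sum>s\<in>permutations_of_set {0..<n}. h (num_leaves m (mst m s))) / of_nat (card (permutations_of_set {0..<n}))"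
proof (cases "n = 0")
  case True
  then show ?thesis by (simp add: mst_leaves_def prob_space)
next
  case False
  let ?u = "uniform_measure lborel {0..1::real}"
  let ?P = "\<Pi>\<^sub>M i\<in>{0..<n}. ?u"
  have u: "prob_space ?u" by (rule prob_space_uniform_measure) auto
  have rv [measurable]: "U i \<in> borel_measurable M" for i using indep by (auto simp: indep_vars_def)
  have sets_P: "sets ?P = sets (\<Pi>\<^sub>M i\<in>{0..<n}. (borel :: real measure))"
    by (intro sets_PiM_cong) auto
  have leaves [measurable]: "(\<lambda>x. h (leaves_of m n x)) \<in> borel_measurable (\<Pi>\<^sub>M i\<in>{0..<n}. borel)"
    by (rule measurable_compose[OF measurable_leaves_of]) simp
  then have leaves_P [measurable]: "(\<lambda>x. h (leaves_of m n x)) \<in> borel_measurable ?P"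
    by (simp add: measurable_cong_sets[OF sets_P refl])
  define J where "J = (\<integral>x. h (leaves_of m n x) \<partial>?P)"
  have joint: "distr M (\<Pi>\<^sub>M i\<in>{0..<n}. borel) (\<lambda>w. \<lambda>i\<in>{0..<n}. U i w) = ?P"
  proof -
    have "indep_vars (\<lambda>_. borel) U {0..<n}" using indep by (rule indep_vars_subset) auto
    then show ?thesis using False
      by (subst (asm) indep_vars_iff_distr_eq_PiM) (auto simp: unif)
  qed
  have expect: "expectation (\<lambda>w. h (leaves_of m n (\<lambda>i. U (s ! i) w))) = J" "integrable M (\<lambda>w. h (leaves_of m n (\<lambda>i. U (s ! i) w)))"
    if s: "s \<in> permutations_of_set {0..<n}" for s
  proof -
    have sd: "distinct s" "set s = {0..<n}" "length s = n"
      using permutations_of_setD[OF s] length_finite_permutations_of_set[OF s] by auto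
    have mem: "s ! i \<in> {0..<n}" if "i \<in> {0..<n}" for i using that sd nth_mem[of i s] by auto
    have inj: "inj_on ((!) s) {0..<n}" using sd by (auto simp: inj_on_def nth_eq_iff_index_eq)
    have "distr ?P ?P (\<lambda>x. \<lambda>i\<in>{0..<n}. x (s ! i)) = ?P"
      using distr_PiM_reindex[where M = "\<lambda>_. ?u" and f = "(!) s" and I = "{0..<n}" and K = "{0..<n}"] u inj mem by auto
    moreover have mp: "(\<lambda>x. \<lambda>i\<in>{0..<n}. x (s ! i)) \<in> measurable ?P ?P"
      using mem by (intro measurable_restrict measurable_component_singleton) auto
    ultimately have "J = (\<integral>x. h (leaves_of m n (\<lambda>i\<in>{0..<n}. x (s ! i))) \<partial>?P)"
      unfolding J_def using integral_distr[OF mp leaves_P] by simp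
    also have "\<dots> = (\<integral>x. h (leaves_of m n (\<lambda>i\<in>{0..<n}. x (s ! i))) \<partial>distr M (\<Pi>\<^sub>M i\<in>{0..<n}. borel) (\<lambda>w. \<lambda>i\<in>{0..<n}. U i w))"
      by (simp only: joint)
    also have "\<dots> = expectation (\<lambda>w. h (leaves_of m n (\<lambda>i\<in>{0..<n}. (\<lambda>i\<in>{0..<n}. U i w) (s ! i))))"
    proof (rule integral_distr)
      have "(\<lambda>x. \<lambda>i\<in>{0..<n}. x (s ! i)) \<in> measurable (\<Pi>\<^sub>M i\<in>{0..<n}. (borel::real measure)) (\<Pi>\<^sub>M i\<in>{0..<n}. borel)"
        using mem by (intro measurable_restrict measurable_component_singleton) auto
      from measurable_compose[OF this leaves] show "(\<lambda>x. h (leaves_of m n (\<lambda>i\<in>{0..<n}. x (s ! i)))) \<in> borel_measurable (\<Pi>\<^sub>M i\<in>{0..<n}. borel)" .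
    qed measurable
    also have "\<dots> = expectation (\<lambda>w. h (leaves_of m n (\<lambda>i. U (s ! i) w)))"
    proof (intro Bochner_Integration.integral_cong refl)
      fix w
      have "map (\<lambda>i\<in>{0..<n}. (\<lambda>i\<in>{0..<n}. U i w) (s ! i)) [0..<n] = map (\<lambda>i. U (s ! i) w) [0..<n]"
        using mem by (intro map_cong) auto
      then show "h (leaves_of m n (\<lambda>i\<in>{0..<n}. (\<lambda>i\<in>{0..<n}. U i w) (s ! i))) = h (leaves_of m n (\<lambda>i. U (s ! i) w))"
        by (simp only: leaves_of_def)
    qed
    finally show "expectation (\<lambda>w. h (leaves_of m n (\<lambda>i. U (s ! i) w))) = J" ..
    have "(\<lambda>w. \<lambda>i\<in>{0..<n}. U (s ! i) w) \<in> measurable M (\<Pi>\<^sub>M i\<in>{0..<n}. borel)"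
      by (intro measurable_restrict) measurable
    from measurable_compose[OF this leaves]
    have "(\<lambda>w. h (leaves_of m n (\<lambda>i\<in>{0..<n}. U (s ! i) w))) \<in> borel_measurable M" .
    moreover have "leaves_of m n (\<lambda>i\<in>{0..<n}. U (s ! i) w) = leaves_of m n (\<lambda>i. U (s ! i) w)" for w
      unfolding leaves_of_def by (intro arg_cong[where f = "num_leaves m"] arg_cong[where f = "mst m"] map_cong) auto
    ultimately show "integrable M (\<lambda>w. h (leaves_of m n (\<lambda>i. U (s ! i) w)))"
      using h by (intro integrable_const_bound[of _ 1]) auto
  qed
  have leaves_perm: "leaves_of m n (\<lambda>i. U (s ! i) w) = num_leaves m (mst m (map (\<lambda>i. U i w) s))"
    if "s \<in> permutations_of_set {0..<n}" for s w
  proof -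
    have "length s = n" using length_finite_permutations_of_set[OF that] by simp
    then have "map (\<lambda>i. U (s ! i) w) [0..<n] = map (\<lambda>i. U i w) s" by (intro nth_equalityI) auto
    then show ?thesis by (simp add: leaves_of_def)
  qed
  have id: "[0..<n] \<in> permutations_of_set {0..<n}" by (intro permutations_of_setI) auto
  have "expectation (\<lambda>w. h (mst_leaves m U n w)) = J"
    using expect(1)[OF id] leaves_perm[OF id] by (simp add: mst_leaves_def)
  moreover have "of_nat (card (permutations_of_set {0..<n})) * J = (\<Sum>s\<in>permutations_of_set {0..<n}. h (num_leaves m (mst m s)))"
  proof -
    have "of_nat (card (permutations_of_set {0..<n})) * J = (\<Sum>s\<in>permutations_of_set {0..<n}. expectation (\<lambda>w. h (leaves_of m n (\<lambda>i. U (s ! i) w))))"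
      by (simp add: expect)
    also have "\<dots> = expectation (\<lambda>w. \<Sum>s\<in>permutations_of_set {0..<n}. h (leaves_of m n (\<lambda>i. U (s ! i) w)))"
      by (rule Bochner_Integration.integral_sum[symmetric]) (rule expect)
    also have "\<dots> = expectation (\<lambda>w. \<Sum>s\<in>permutations_of_set {0..<n}. h (num_leaves m (mst m s)))"
    proof (rule integral_cong_AE)
      show "AE w in M. (\<Sum>s\<in>permutations_of_set {0..<n}. h (leaves_of m n (\<lambda>i. U (s ! i) w))) = (\<Sum>s\<in>permutations_of_set {0..<n}. h (num_leaves m (mst m s)))"
        using AE_uniform_distinct[OF indep unif]
      proof eventually_elim
        case (elim w)
        then have "inj_on (\<lambda>i. U i w) {0..<n}" by (rule inj_on_subset) simp
        from sum_orderings_of_distinct[OF this, of h m] show ?case by (simp add: leaves_perm)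
      qed
      show "(\<lambda>w. \<Sum>s\<in>permutations_of_set {0..<n}. h (leaves_of m n (\<lambda>i. U (s ! i) w))) \<in> borel_measurable M"
        by (intro borel_measurable_sum borel_measurable_integrable expect(2))
    qed simp
    also have "\<dots> = (\<Sum>s\<in>permutations_of_set {0..<n}. h (num_leaves m (mst m s)))" by (simp add: prob_space)
    finally show ?thesis .
  qed
  moreover have "of_nat (card (permutations_of_set {0..<n})) \<noteq> (0::complex)" by simp
  ultimately show ?thesis by (simp add: nonzero_eq_divide_eq mult.commute)
qed

lemma measurable_mst_leaves:
  assumes "\<And>i. U i \<in> borel_measurable M"
  shows "mst_leaves m U n \<in> measurable M (count_space UNIV)"
proof -
  have "(\<lambda>w. \<lambda>i\<in>{0..<n}. U i w) \<in> measurable M (\<Pi>\<^sub>M i\<in>{0..<n}. borel)"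
    using assms by (intro measurable_restrict)
  from measurable_compose[OF this measurable_leaves_of]
  have "(\<lambda>w. leaves_of m n (\<lambda>i\<in>{0..<n}. U i w)) \<in> measurable M (count_space UNIV)" .
  moreover have "leaves_of m n (\<lambda>i\<in>{0..<n}. U i w) = mst_leaves m U n w" for w
    unfolding leaves_of_def mst_leaves_def by (intro arg_cong[where f = "num_leaves m"] arg_cong[where f = "mst m"] map_cong) auto
  ultimately show ?thesis by simp
qed

end

section \<open>The normal law and the limit theorem\<close>

lemma char_normal_law:
  assumes "s \<ge> 0"
  shows "char (normal_law 0 s) t = of_real (exp (- (t\<^sup>2 * s / 2)))"
proof (cases "s = 0")
  case True
  then show ?thesis by (simp add: normal_law_def char_def integral_return)
next
  case False
  let ?sd = "sqrt s"
  have sd: "?sd > 0" using assms False by simp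
  interpret N: prob_space std_normal_distribution
    using real_dist_normal_dist by (simp add: real_distribution_def)
  have "distributed std_normal_distribution lborel (\<lambda>x. x) std_normal_density"
    unfolding distributed_def by (auto intro!: measure_eqI simp: emeasure_distr)
  from N.normal_density_affine[OF this, of ?sd 0]
  have "distributed std_normal_distribution lborel (\<lambda>x. 0 + ?sd * x) (normal_density (0 + ?sd * 0) (\<bar>?sd\<bar> * 1))"
    using sd by simp
  then have "distributed std_normal_distribution lborel (\<lambda>x. ?sd * x) (normal_density 0 ?sd)" using sd by simp
  from distributed_distr_eq_density[OF this]
  have eq: "normal_law 0 s = distr std_normal_distribution lborel (\<lambda>x. ?sd * x)"
    using False by (simp add: normal_law_def)
  have "char (normal_law 0 s) t = (CLINT x|std_normal_distribution. iexp (t * (?sd * x)))"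
    unfolding eq char_def by (subst integral_distr) auto
  also have "\<dots> = char std_normal_distribution (t * ?sd)"
    by (simp add: char_def mult.assoc)
  also have "\<dots> = of_real (exp (- (t * ?sd)\<^sup>2 / 2))"
    by (simp add: char_std_normal_distribution)
  also have "(t * ?sd)\<^sup>2 = t\<^sup>2 * s" using assms by (simp add: power_mult_distrib)
  finally show ?thesis by simp
qed

lemma real_distribution_normal_law:
  assumes "s \<ge> 0"
  shows "real_distribution (normal_law 0 s)"
proof (cases "s = 0")
  case True
  then show ?thesis
    by (simp add: normal_law_def real_distribution_def real_distribution_axioms_def prob_space_return)
next
  case False
  then have "prob_space (density lborel (normal_density 0 (sqrt s)))"
    using assms by (intro prob_space_normal_density) auto
  then show ?thesis using False
    by (simp add: normal_law_def real_distribution_def real_distribution_axioms_def)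
qed

lemma of_real_gap_change: "of_real (gap_change m t i) = gap_xi m t i"
  by (simp add: gap_change_eq gap_xi_def unit_vector_def complex_eq_iff)

lemma sum_swap_pairs:
  "(\<Sum>a\<in>A. \<Sum>b\<in>B. \<Sum>c\<in>C. \<Sum>d\<in>D. f a b c d) = (\<Sum>c\<in>C. \<Sum>d\<in>D. \<Sum>a\<in>A. \<Sum>b\<in>B. f a b c d)"
proof -
  have "(\<Sum>a\<in>A. \<Sum>b\<in>B. \<Sum>c\<in>C. \<Sum>d\<in>D. f a b c d) = (\<Sum>a\<in>A. \<Sum>c\<in>C. \<Sum>d\<in>D. \<Sum>b\<in>B. f a b c d)"
    by (rule sum.cong[OF refl], subst sum.swap, rule sum.cong[OF refl], rule sum.swap)
  also have "\<dots> = (\<Sum>c\<in>C. \<Sum>d\<in>D. \<Sum>a\<in>A. \<Sum>b\<in>B. f a b c d)"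
    by (subst sum.swap, rule sum.cong[OF refl], rule sum.swap)
  finally show ?thesis .
qed

context gap_spectrum
begin

lemma gap_B_form:
  assumes "j \<in> {1..m}" "k \<in> {1..m}"
  shows "(\<Sum>p=1..m. \<Sum>q=1..m. u j p * gap_B m v p q * u k q) = (\<Sum>i=1..m. v 1 i * (lam j * u j i) * (lam k * u k i))"
proof -
  have "(\<Sum>i=1..m. v 1 i * (lam j * u j i) * (lam k * u k i)) =
     (\<Sum>i=1..m. v 1 i * ((\<Sum>p=1..m. u j p * gap_xi m i p) * (\<Sum>q=1..m. u k q * gap_xi m i q)))"
    using assms by (intro sum.cong refl) (simp add: left mult.assoc del: One_nat_def)
  also have "\<dots> = (\<Sum>i=1..m. \<Sum>p=1..m. \<Sum>q=1..m. u j p * (v 1 i * gap_xi m i p * gap_xi m i q) * u k q)"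
    unfolding sum_product unfolding sum_distrib_left by (intro sum.cong refl) (simp only: mult_ac)
  also have "\<dots> = (\<Sum>p=1..m. \<Sum>q=1..m. \<Sum>i=1..m. u j p * (v 1 i * gap_xi m i p * gap_xi m i q) * u k q)"
    by (subst sum.swap, rule sum.cong[OF refl], rule sum.swap)
  finally show ?thesis unfolding gap_B_def sum_distrib_left sum_distrib_right ..
qed

text \<open>The double sum is the quadratic form of \<open>gap_Sigma\<close> at the vector with entries \<open>0\<close>, \<open>1 / 2\<close>, \<dots>, \<open>1 / m\<close>. It factors
into the coefficients of that functional in the basis of left eigenvectors.\<close>

lemma gap_Sigma_form:
  "(\<Sum>r=2..m. \<Sum>c=2..m. gap_Sigma m lam u v r c / (of_nat r * of_nat c)) =
    (\<Sum>j=2..m. \<Sum>k=2..m. (\<Sum>r=2..m. v j r / of_nat r) * (\<Sum>c=2..m. v k c / of_nat c) *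
      (\<Sum>i=1..m. v 1 i * (lam j * u j i) * (lam k * u k i)) / (1 - lam j - lam k))"
proof -
  let ?Q = "\<lambda>j k. (\<Sum>i=1..m. v 1 i * (lam j * u j i) * (lam k * u k i)) / (1 - lam j - lam k)"
  have "gap_Sigma m lam u v r c = (\<Sum>j=2..m. \<Sum>k=2..m. ?Q j k * v j r * v k c)" for r c
    unfolding gap_Sigma_def lam1 by (intro sum.cong refl) (subst gap_B_form, auto)
  then have "(\<Sum>r=2..m. \<Sum>c=2..m. gap_Sigma m lam u v r c / (of_nat r * of_nat c)) =
     (\<Sum>r=2..m. \<Sum>c=2..m. \<Sum>j=2..m. \<Sum>k=2..m. ?Q j k * v j r * v k c / (of_nat r * of_nat c))"
    by (simp only: sum_divide_distrib)
  also have "\<dots> = (\<Sum>j=2..m. \<Sum>k=2..m. \<Sum>r=2..m. \<Sum>c=2..m. ?Q j k * v j r * v k c / (of_nat r * of_nat c))"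
    by (rule sum_swap_pairs)
  also have "\<dots> = (\<Sum>j=2..m. \<Sum>k=2..m. ((\<Sum>r=2..m. v j r / of_nat r) * (\<Sum>c=2..m. v k c / of_nat c)) * ?Q j k)"
  proof (intro sum.cong refl)
    fix j k
    define q where "q = ?Q j k"
    have "(\<Sum>r=2..m. \<Sum>c=2..m. q * v j r * v k c / (of_nat r * of_nat c)) = ((\<Sum>r=2..m. v j r / of_nat r) * (\<Sum>c=2..m. v k c / of_nat c)) * q"
      unfolding sum_product unfolding sum_distrib_right by (intro sum.cong refl) (simp add: mult_ac)
    then show "(\<Sum>r=2..m. \<Sum>c=2..m. ?Q j k * v j r * v k c / (of_nat r * of_nat c)) = ((\<Sum>r=2..m. v j r / of_nat r) * (\<Sum>c=2..m. v k c / of_nat c)) * ?Q j k"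
      unfolding q_def .
  qed
  finally show ?thesis by (simp only: times_divide_eq_right)
qed

end

theorem theorem5p2:
  fixes m :: nat
    and M :: "'w measure" and U :: "nat \<Rightarrow> 'w \<Rightarrow> real"
    and lam :: "nat \<Rightarrow> complex" and u v :: "nat \<Rightarrow> nat \<Rightarrow> complex"
  assumes m: "3 \<le> m" "m \<le> 26"
    and M: "prob_space M"
    and indep: "prob_space.indep_vars M (\<lambda>_. borel) U UNIV"
    and unif: "\<And>i. distr M borel (U i) = uniform_measure lborel {0..1}"
    and eigen: "dual_eigenbases m (gap_A m) lam u v"
    and lam1: "lam 1 = 1"
    and normalised: "(\<Sum>i=1..m. v 1 i) = 1"
  shows "mu_L m = 1 / (harm m - 1) * ((real m - 1) / (2 * (real m + 1))) \<and>
    (\<exists>sigma2::real. sigma2 \<ge> 0 \<and>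
       complex_of_real sigma2 =
         (\<Sum>i=2..m. \<Sum>j=2..m. gap_Sigma m lam u v i j / (of_nat i * of_nat j)) \<and>
       weak_conv_m
         (\<lambda>n. distr M borel (\<lambda>\<omega>. (real (mst_leaves m U n \<omega>) - mu_L m * real n) / sqrt (real n)))
         (normal_law 0 sigma2))"
proof -
  interpret prob_space M by (rule M)
  interpret gs: gap_spectrum m lam u v by unfold_locales (use m eigen lam1 normalised in auto)
  interpret urn: unit_urn_spectrum m "gap_change m" "\<lambda>n. permutations_of_set {0..<n}" "\<lambda>n. gap_counts m" lam u v "gap_stationary m"
  proof unfold_locales
    fix f :: "(nat \<Rightarrow> real) \<Rightarrow> complex" and n
    show "(\<Sum>s\<in>permutations_of_set {0..<Suc n}. f (gap_counts m s)) / of_nat (card (permutations_of_set {0..<Suc n})) =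
      (\<Sum>s\<in>permutations_of_set {0..<n}. \<Sum>i=1..m. of_real (gap_counts m s i / real (Suc n)) * f (\<lambda>k. gap_counts m s k + gap_change m i k))
      / of_nat (card (permutations_of_set {0..<n}))"
      by (rule gap_counts_step) (rule m)
  next
    fix n and s :: "nat list" assume "s \<in> permutations_of_set {0..<n}"
    then show "(\<Sum>i=1..m. gap_counts m s i) = real (Suc n)" using m by (intro gap_counts_total) auto
  next
    fix j i assume "j \<in> {1..m}" "i \<in> {1..m}"
    then show "(\<Sum>l=1..m. u j l * of_real (gap_change m i l)) = lam j * u j i"
      unfolding of_real_gap_change by (rule gs.left)
  qed (use gs.dual gs.complete gs.u_one gs.v_one gs.gap_stationary_nonneg gs.Re_eigenvalue_less_half[OF m(2)] m
       in \<open>auto simp: gap_counts_def simp del: One_nat_def\<close>)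
  \<comment> \<open>A gap of type \<open>i \<ge> 2\<close> counts as \<open>1 / i\<close> of a leaf; a gap of type \<open>1\<close> belongs to no leaf.\<close>
  define w where "w i = (if i = 1 then 0 else 1 / real i)" for i :: nat
  have w_sum: "(\<Sum>i=1..m. g (w i) i) = (\<Sum>i=2..m. g (1 / real i) i)" if "\<And>i. g 0 i = 0" for g :: "real \<Rightarrow> nat \<Rightarrow> 'c::comm_monoid_add"
    unfolding urn.split_first using that by (auto simp: w_def intro!: sum.cong)
  have drift: "urn.drift w = mu_L m"
    unfolding urn.drift_def using w_sum[of "\<lambda>a i. a * gap_stationary m i"] mu_L_stationary[of m] m by simp
  have coef: "urn.coef w j = (\<Sum>r=2..m. v j r / of_nat r)" for j
    unfolding urn.coef_def using w_sum[of "\<lambda>a i. of_real a * v j i"] by simp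
  obtain sigma2 where s0: "sigma2 \<ge> 0" and s1: "urn.limit_variance w = of_real sigma2"
    and s2: "\<And>t. (\<lambda>n. urn.mean n (\<lambda>s. iexp (t * (((\<Sum>i=1..m. w i * gap_counts m s i) - urn.drift w * real (Suc n)) / sqrt (real n)))))
        \<longlonglongrightarrow> of_real (exp (- (t\<^sup>2 * sigma2 / 2)))"
    using urn.urn_characteristic_function_tendsto[of w] by blast
  have variance: "complex_of_real sigma2 = (\<Sum>i=2..m. \<Sum>j=2..m. gap_Sigma m lam u v i j / (of_nat i * of_nat j))"
    unfolding gs.gap_Sigma_form s1[symmetric] urn.limit_variance_def coef
    by (intro sum.cong refl) (simp add: gs.v_one del: One_nat_def)
  let ?Z = "\<lambda>n \<omega>. (real (mst_leaves m U n \<omega>) - mu_L m * real n) / sqrt (real n)"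
  have U: "U i \<in> borel_measurable M" for i using indep by (auto simp: indep_vars_def)
  have Z: "?Z n \<in> borel_measurable M" for n
    by (rule measurable_compose[OF measurable_mst_leaves[OF U]]) simp
  have "(\<lambda>n. char (distr M borel (?Z n)) t) \<longlonglongrightarrow> char (normal_law 0 sigma2) t" for t
  proof -
    \<comment> \<open>The urn starts with one ball, so its natural centring is \<open>mu_L m * (n + 1)\<close>; the difference to \<open>mu_L m * n\<close> is a vanishing shift.\<close>
    let ?g = "\<lambda>n s. ((\<Sum>i=1..m. w i * gap_counts m s i) - mu_L m * real (Suc n)) / sqrt (real n)"
    have eq: "char (distr M borel (?Z n)) t = iexp (t * (mu_L m / sqrt (real n))) * urn.mean n (\<lambda>s. iexp (t * ?g n s))" for n
    proof -
      have "char (distr M borel (?Z n)) t = expectation (\<lambda>\<omega>. iexp (t * ?Z n \<omega>))"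
        unfolding char_def by (rule integral_distr[OF Z]) measurable
      also have "\<dots> = urn.mean n (\<lambda>s. iexp (t * ((real (num_leaves m (mst m s)) - mu_L m * real n) / sqrt (real n))))"
        unfolding urn.mean_def
        by (rule expectation_leaves_uniform_permutation[OF indep unif, of "\<lambda>k. iexp (t * ((real k - mu_L m * real n) / sqrt (real n)))"]) simp
      also have "\<dots> = urn.mean n (\<lambda>s. iexp (t * (mu_L m / sqrt (real n))) * iexp (t * ?g n s))"
      proof (rule urn.mean_cong)
        fix s assume "s \<in> permutations_of_set {0..<n}"
        then have "search_tree m (mst m s)" using m search_tree_mst[of s m] by (auto dest: permutations_of_setD)
        then have "real (num_leaves m (mst m s)) = (\<Sum>i=2..m. 1 / real i * gap_counts m s i)"
          using m num_leaves_gap_types[of m "mst m s"] by (simp add: gap_counts_def)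
        also have "\<dots> = (\<Sum>i=1..m. w i * gap_counts m s i)"
          using w_sum[of "\<lambda>a i. a * gap_counts m s i"] by simp
        finally have "real (num_leaves m (mst m s)) - mu_L m * real n = mu_L m + ((\<Sum>i=1..m. w i * gap_counts m s i) - mu_L m * real (Suc n))"
          by (simp add: distrib_left del: One_nat_def)
        then have "t * ((real (num_leaves m (mst m s)) - mu_L m * real n) / sqrt (real n)) = t * (mu_L m / sqrt (real n)) + t * ?g n s"
          by (simp only: add_divide_distrib distrib_left)
        then show "iexp (t * ((real (num_leaves m (mst m s)) - mu_L m * real n) / sqrt (real n))) = iexp (t * (mu_L m / sqrt (real n))) * iexp (t * ?g n s)"
          by (simp only: of_real_add distrib_left exp_add)
      qed
      finally show ?thesis by (simp only: urn.mean_cmult)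
    qed
    have "(\<lambda>n. mu_L m / sqrt (real n)) \<longlonglongrightarrow> 0"
      by (intro tendsto_divide_0[OF tendsto_const] filterlim_at_top_imp_at_infinity
          filterlim_compose[OF sqrt_at_top filterlim_real_sequentially])
    then have "(\<lambda>n. iexp (t * (mu_L m / sqrt (real n)))) \<longlonglongrightarrow> iexp (t * 0)"
      by (intro tendsto_intros)
    from tendsto_mult[OF this s2[of t]]
    show ?thesis unfolding eq char_normal_law[OF s0] drift by simp
  qed
  then have "weak_conv_m (\<lambda>n. distr M borel (?Z n)) (normal_law 0 sigma2)"
    by (intro levy_continuity real_distribution_normal_law s0 real_distribution_distr Z)
  then show ?thesis using mu_L_eq[of m] m s0 variance by auto
qed

end
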